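(* For any $\sigma>0$, $\alpha\ge1$ and integer $L\ge2$, there exists an unbounded code $\mathcal{C}\subset\mathbb{R}^n$ of rate $R=\frac12\ln\frac{1}{2\pi e\sigma^2\alpha^2}$ such that, when used over an AWGN channel with noise variance $\sigma^2$ and no input constraint, the exponent of the average probability of $(L-1)$-list-decoding error of $\mathcal{C}$, $\lim_{n\to\infty}-\frac1n\ln P_{\mathrm{e},\mathrm{avg},L-1}^{\mathrm{ML}}(\mathcal{C})$, is at least $$E_{\mathrm{ex},L-1}(\alpha)=\begin{cases}\frac{\alpha^2}{2}-\ln\alpha-\frac12,&1\le\alpha\le\sqrt L,\\[2pt]\frac{L-1}{2}-\frac L2\ln L+(L-1)\ln\alpha,&\sqrt L<\alpha\le\sqrt{2L},\\[2pt]F(\alpha,L),&\alpha>\sqrt{2L},\end{cases}$$ where $$\begin{aligned}F(\alpha,L)={}&\frac{\alpha^2}{16}+\frac1{16}\sqrt{\alpha^4+8\alpha^2(2L-3)+16}-\frac{L-1}{2}\ln\left(\sqrt{\alpha^4+8\alpha^2(2L-3)+16}-\alpha^2+4\right)\\&+\frac{L-2}{2}\ln\left(\sqrt{\alpha^4+8\alpha^2(2L-3)+16}+\alpha^2+4\right)+\frac32\ln2-\frac14.\end{aligned}$$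
   Context: The AWGN channel with noise variance $\sigma^2$ and no input constraint maps $x\in\mathbb{R}^n$ to $x+\mathbf{g}$, $\mathbf{g}\sim\mathcal{N}(0,\sigma^2I_n)$. An unbounded code is a (countable, locally finite) set $\mathcal{C}\subset\mathbb{R}^n$; its rate is $$R(\mathcal{C})=\limsup_{K\to\infty}\frac1n\ln\frac{|\mathcal{C}\cap K\mathcal{B}|}{|K\mathcal{B}|},$$ where $\mathcal{B}\subset\mathbb{R}^n$ is an arbitrary centrally symmetric connected compact set with nonempty interior (e.g. the unit ball or $[-1,1]^n$), numerators are cardinalities and denominators are Lebesgue volumes. The maximum-likelihood $(L-1)$-list-decoder outputs the $L-1$ codewords nearest to the channel output; the error probability of $x\in\mathcal{C}$ is $$P_{\mathrm{e},L-1}^{\mathrm{ML}}(x,\mathcal{C})=\Pr\left[\exists\text{ distinct }x_1,\dots,x_{L-1}\in\mathcal{C}\setminus\{x\}\ \forall i:\ \|x_i-(x+\mathbf{g})\|_2<\|\mathbf{g}\|_2\right].$$ The average probability of error is the average over codewords, $P_{\mathrm{e},\mathrm{avg},L-1}^{\mathrm{ML}}(\mathcal{C})=\limsup_{K\to\infty}\frac{1}{|\mathcal{C}\cap K\mathcal{B}|}\sum_{x\in\mathcal{C}\cap K\mathcal{B}}P_{\mathrm{e},L-1}^{\mathrm{ML}}(x,\mathcal{C})$. Throughout, "a code" means a sequence of codes of increasing dimensions $n$, its rate being understood asymptotically as $n\to\infty$. *)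

theory Defs
  imports "HOL-Probability.Probability"
begin

text \<open>
  The dimension varies inside the statement, so R^n is the set of functions
  \<open>{..<n} \<rightarrow>\<^sub>E UNIV\<close> (value \<open>undefined\<close> off \<open>{..<n}\<close>). This is at the same
  time the carrier of the product topology \<^term>\<open>powertop_real {..<n}\<close> and the space of the
  product measures below; the Euclidean norm of \<open>x\<close> is \<^term>\<open>L2_set x {..<n}\<close>.
\<close>

definition lebesgue_Rn :: "nat \<Rightarrow> (nat \<Rightarrow> real) measure" where
  "lebesgue_Rn n = PiM {..<n} (\<lambda>_. lborel)"

definition awgn :: "nat \<Rightarrow> real \<Rightarrow> (nat \<Rightarrow> real) measure" where
  "awgn n \<sigma> = PiM {..<n} (\<lambda>_. density lborel (\<lambda>t. ennreal (normal_density 0 \<sigma> t)))"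

definition scale_set :: "nat \<Rightarrow> real \<Rightarrow> (nat \<Rightarrow> real) set \<Rightarrow> (nat \<Rightarrow> real) set" where
  "scale_set n K B = (\<lambda>x. \<lambda>i\<in>{..<n}. K * x i) ` B"

definition reference_body :: "nat \<Rightarrow> (nat \<Rightarrow> real) set \<Rightarrow> bool" where
  "reference_body n B \<longleftrightarrow>
     compactin (powertop_real {..<n}) B \<and>
     connectedin (powertop_real {..<n}) B \<and>
     powertop_real {..<n} interior_of B \<noteq> {} \<and>
     (\<forall>x\<in>B. (\<lambda>i\<in>{..<n}. - x i) \<in> B)"

definition unbounded_code :: "nat \<Rightarrow> (nat \<Rightarrow> real) set \<Rightarrow> bool" where
  "unbounded_code n C \<longleftrightarrow>
     C \<subseteq> ({..<n} \<rightarrow>\<^sub>E UNIV) \<and> countable C \<and> (\<forall>r. finite {x\<in>C. L2_set x {..<n} \<le> r})"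

text \<open>Extended logarithm; \<^term>\<open>ln (0::real) = 0\<close> would give empty intersections and
  zero error probabilities a spurious finite value.\<close>

definition ext_ln :: "ereal \<Rightarrow> ereal" where
  "ext_ln x = (if x \<le> 0 then -\<infinity> else if x = \<infinity> then \<infinity> else ereal (ln (real_of_ereal x)))"

definition code_rate :: "nat \<Rightarrow> (nat \<Rightarrow> real) set \<Rightarrow> (nat \<Rightarrow> real) set \<Rightarrow> ereal" where
  "code_rate n B C = Limsup at_top (\<lambda>K::real.
     ereal (1 / real n) *
       ext_ln (ereal (real (card (C \<inter> scale_set n K B)) /
                      measure (lebesgue_Rn n) (scale_set n K B))))"

definition list_error :: "nat \<Rightarrow> real \<Rightarrow> nat \<Rightarrow> (nat \<Rightarrow> real) set \<Rightarrow> (nat \<Rightarrow> real) \<Rightarrow> real" where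
  "list_error n \<sigma> l C x = measure (awgn n \<sigma>)
     {g \<in> space (awgn n \<sigma>).
        \<exists>xs. length xs = l \<and> distinct xs \<and> set xs \<subseteq> C - {x} \<and>
          (\<forall>y\<in>set xs. L2_set (\<lambda>i. y i - (x i + g i)) {..<n} < L2_set g {..<n})}"

definition avg_list_error ::
    "nat \<Rightarrow> real \<Rightarrow> nat \<Rightarrow> (nat \<Rightarrow> real) set \<Rightarrow> (nat \<Rightarrow> real) set \<Rightarrow> ereal" where
  "avg_list_error n \<sigma> l B C = Limsup at_top (\<lambda>K::real.
     ereal (1 / real (card (C \<inter> scale_set n K B)) *
            (\<Sum>x\<in>C \<inter> scale_set n K B. list_error n \<sigma> l C x)))"

definition exponent_F :: "real \<Rightarrow> nat \<Rightarrow> real" where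
  "exponent_F \<alpha> L =
     (let s = sqrt (\<alpha>^4 + 8 * \<alpha>^2 * (2 * real L - 3) + 16) in
      \<alpha>^2 / 16 + 1/16 * s
      - (real L - 1) / 2 * ln (s - \<alpha>^2 + 4)
      + (real L - 2) / 2 * ln (s + \<alpha>^2 + 4)
      + 3/2 * ln 2 - 1/4)"

definition exponent_ex :: "nat \<Rightarrow> real \<Rightarrow> real" where
  "exponent_ex L \<alpha> =
     (if \<alpha> \<le> sqrt (real L) then \<alpha>^2 / 2 - ln \<alpha> - 1/2
      else if \<alpha> \<le> sqrt (2 * real L) then
        (real L - 1) / 2 - real L / 2 * ln (real L) + (real L - 1) * ln \<alpha>
      else exponent_F \<alpha> L)"

lemma reference_body_cube: "reference_body n ({..<n} \<rightarrow>\<^sub>E {-1..1})"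
proof -
  have "openin (powertop_real {..<n}) ({..<n} \<rightarrow>\<^sub>E {-1<..<1})"
    by (subst openin_PiE) auto
  moreover have "(\<lambda>i\<in>{..<n}. 0) \<in> {..<n} \<rightarrow>\<^sub>E {-1<..<1::real}" by auto
  moreover have "({..<n} \<rightarrow>\<^sub>E {-1<..<1::real}) \<subseteq> ({..<n} \<rightarrow>\<^sub>E {-1..1})"
    by (intro PiE_mono) auto
  ultimately have "powertop_real {..<n} interior_of ({..<n} \<rightarrow>\<^sub>E {-1..1}) \<noteq> {}"
    unfolding interior_of_def by blast
  moreover have "compactin (powertop_real {..<n}) ({..<n} \<rightarrow>\<^sub>E {-1..1})"
    by (subst compactin_PiE) auto
  moreover have "connectedin (powertop_real {..<n}) ({..<n} \<rightarrow>\<^sub>E {-1..1})"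
    by (subst connectedin_PiE) auto
  moreover have "\<forall>x\<in>{..<n} \<rightarrow>\<^sub>E {-1..1::real}. (\<lambda>i\<in>{..<n}. - x i) \<in> {..<n} \<rightarrow>\<^sub>E {-1..1}"
    by (auto simp: PiE_iff)
  ultimately show ?thesis unfolding reference_body_def by blast
qed

end

theory Submission
  imports Defs
begin

text \<open>
  Why the theorem holds. Write \<open>r = \<bar>g\<bar>\<close> for the noise length. A list error at \<open>x\<close> means that
  \<open>L - 1\<close> other codewords lie in the open ball of radius \<open>r\<close> around \<open>x + g\<close>. If the codewords are
  independent and uniform with density at most \<open>exp (n * R)\<close>, \<open>R\<close> being the rate, and those closer to \<open>x\<close> than
  \<open>d = sqrt n * \<sigma> * \<alpha>\<close> are ignored, the candidates lie in a ball minus a ball, a lens which is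
  itself contained in a ball whose squared radius, in units of \<open>n * \<sigma>\<^sup>2\<close>, is the function
  \<open>lens_sq\<close> of \<open>t = r\<^sup>2 / (n * \<sigma>\<^sup>2)\<close>. The conditional error probability is therefore at most
  \<open>min 1 (sqrt (max 0 (lens_sq \<alpha> t) / \<alpha>\<^sup>2) ^ (n * (L - 1)))\<close>. Its logarithm divided by \<open>n\<close> lies below
  an affine function \<open>lam * t + b\<close> of \<open>t\<close>, the tangent at the noise length from which most errors arise, and the
  exponential moment of \<open>r\<^sup>2\<close> is explicit. The choice of tangent point gives exactly \<open>exponent_ex\<close>
  (\<open>exponent_tangent\<close>), so no asymptotic estimate of volumes or of the law of \<open>r\<close> is needed: every
  bound holds for each \<open>n\<close> up to a constant factor. Since a codeword has few neighbours within
  distance \<open>d\<close> on average, discarding the bad half of the words leaves a finite code in a cube all of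
  whose words have error at most \<open>8 * exp (- n * exponent_ex L \<alpha>)\<close> (\<open>finite_code_exists\<close>).

  The unbounded code repeats this finite code periodically, with a guard band between the copies so
  wide that the copies hardly disturb one another (\<open>list_error_isolated_le\<close>). Two points need care,
  because the reference body is an arbitrary compact set, possibly with a boundary of positive
  measure which, in every dilate, a periodic set may miss. First, the upper density of the code with respect
  to the body is the expected one only after a suitable translation, found by averaging over all
  translations and the reverse Fatou lemma (\<open>exists_good_shift\<close>). Secondly, the exponent has to
  converge, whereas so far it is only bounded from below. For this, \<open>m\<close> closely packed
  words, all but \<open>L - 1\<close> of which have errors of constant probability (\<open>list_error_crowd_ge\<close>), are added to each
  period. The number \<open>m\<close> is the least one for which the crowded words make up a fraction
  \<open>exp (- n * max 0 (exponent_ex L \<alpha>)) / 4\<close> of the code for arbitrarily large dilates of the body; as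
  the period is huge, one more word changes the fraction by a negligible amount, whatever the
  body is. The average error then equals \<open>exp (- n * max 0 (exponent_ex L \<alpha>))\<close> up to constant factors
  (\<open>code_exists_in_dimension\<close>), so that the exponent converges to \<open>max 0 (exponent_ex L \<alpha>)\<close>.
\<close>

section \<open>The exponent as a tangent line\<close>

text \<open>
  Squared radius, in units of \<open>n * \<sigma>\<^sup>2\<close>, of a ball that contains the points at distance
  less than \<open>sqrt t\<close> from the channel output and at least \<open>\<alpha>\<close> from the sent word. For
  \<open>t \<le> \<alpha>\<^sup>2 / 2\<close> this region is at most a half ball and the radius is that of its rim; there,
  for \<open>t > 0\<close>, the value fails to be positive exactly when the region is empty.
\<close>

definition lens_sq :: "real \<Rightarrow> real \<Rightarrow> real" where
  "lens_sq \<alpha> t = (if t \<le> \<alpha>\<^sup>2 / 2 then \<alpha>\<^sup>2 * (1 - \<alpha>\<^sup>2 / (4 * t)) else t)"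

lemma lens_sq_le:
  assumes "t > 0" shows "lens_sq \<alpha> t \<le> t"
proof -
  have "\<alpha>\<^sup>2 * (1 - \<alpha>\<^sup>2 / (4 * t)) = t - (t - \<alpha>\<^sup>2/2)\<^sup>2 / t"
    using assms by (simp add: field_simps power2_eq_square)
  also have "\<dots> \<le> t" using assms by simp
  finally show ?thesis by (simp add: lens_sq_def)
qed

text \<open>
  The tangent is taken at \<open>T\<close>, the minimiser of
  \<open>t / 2 - ln t / 2 - 1 / 2 + (L - 1) / 2 * max 0 (ln \<alpha>\<^sup>2 - ln t)\<close>. For \<open>\<alpha>\<^sup>2 \<le> L\<close> the minimum is at
  the kink \<open>t = \<alpha>\<^sup>2\<close>, where every slope between the two one-sided ones gives a majorant; \<open>lam\<close> is the one
  for which the exponential moment of the noise is concentrated at \<open>T\<close>.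
\<close>

lemma exponent_tangent_no_expurgation:
  fixes \<alpha> T :: real and L :: nat
  assumes "\<alpha> \<ge> 1" and "L \<ge> 2" and T: "T = min (\<alpha>\<^sup>2) (real L)"
  defines "lam \<equiv> 1/2 - 1/(2 * T)" and "b \<equiv> (real L - 1) / 2 * ln (T / \<alpha>\<^sup>2) - (1/2 - 1/(2 * T)) * T"
  shows "0 \<le> lam" "lam < 1/2"
    "b - 1/2 * ln (1 - 2 * lam) =
       - (if \<alpha> \<le> sqrt (real L) then \<alpha>\<^sup>2 / 2 - ln \<alpha> - 1/2
          else (real L - 1) / 2 - real L / 2 * ln (real L) + (real L - 1) * ln \<alpha>)"
    "\<And>t. t > 0 \<Longrightarrow> 0 \<le> lam * t + b \<or> (real L - 1) / 2 * ln (t / \<alpha>\<^sup>2) \<le> lam * t + b"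
proof -
  have a2: "\<alpha>\<^sup>2 \<ge> 1" using assms(1) by (simp add: one_le_power)
  have T1: "T \<ge> 1" using a2 assms(2) T by auto
  show lam0: "0 \<le> lam" "lam < 1/2" using T1 unfolding lam_def by (auto simp: field_simps)
  have iff: "\<alpha> \<le> sqrt (real L) \<longleftrightarrow> \<alpha>\<^sup>2 \<le> real L"
    using assms(1) by (metis abs_of_nonneg order.trans real_sqrt_abs real_sqrt_le_iff zero_le_one)
  have l: "ln (1 - 2 * lam) = - ln T" using T1 by (simp add: lam_def ln_div)
  have lT: "ln (T / \<alpha>\<^sup>2) = ln T - 2 * ln \<alpha>" using T1 assms(1) by (simp add: ln_div ln_realpow)
  have lamT: "(1/2 - 1/(2 * T)) * T = T/2 - 1/2" using T1 by (simp add: field_simps)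
  show "b - 1/2 * ln (1 - 2 * lam) =
       - (if \<alpha> \<le> sqrt (real L) then \<alpha>\<^sup>2 / 2 - ln \<alpha> - 1/2
          else (real L - 1) / 2 - real L / 2 * ln (real L) + (real L - 1) * ln \<alpha>)"
  proof (cases "\<alpha>\<^sup>2 \<le> real L")
    case True
    then have "T = \<alpha>\<^sup>2" using T by simp
    then have "ln T = 2 * ln \<alpha>" using assms(1) by (simp add: ln_realpow)
    then show ?thesis using True \<open>T = \<alpha>\<^sup>2\<close> unfolding b_def l lT lamT iff by simp
  next
    case False
    then have "T = real L" using T by simp
    then show ?thesis using False unfolding b_def l lT lamT iff by (simp add: field_simps)
  qed
  fix t :: real assume t: "t > 0"
  have tT: "ln (t / \<alpha>\<^sup>2) = ln (T / \<alpha>\<^sup>2) + ln (t / T)"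
    using t T1 assms(1) by (simp add: ln_div)
  have lt: "ln (t / T) \<le> t / T - 1" using t T1 by (intro ln_le_minus_one) auto
  have LL: "(real L - 1) / 2 \<ge> 0" using assms(2) by simp
  have "(real L - 1) / 2 * ln (t / \<alpha>\<^sup>2) \<le> (real L - 1) / 2 * ln (T / \<alpha>\<^sup>2) + (real L - 1) / 2 * (t / T - 1)"
    unfolding tT distrib_left using LL lt by (intro add_left_mono mult_left_mono)
  also have "(real L - 1) / 2 * (t / T - 1) = (real L - 1) / (2 * T) * (t - T)"
    using T1 by (simp add: field_simps)
  finally have A: "(real L - 1) / 2 * ln (t / \<alpha>\<^sup>2)
      \<le> (real L - 1) / 2 * ln (T / \<alpha>\<^sup>2) + (real L - 1) / (2 * T) * (t - T)" .
  have B: "lam * t + b = (real L - 1) / 2 * ln (T / \<alpha>\<^sup>2) + lam * (t - T)"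
  proof -
    have "b = (real L - 1) / 2 * ln (T / \<alpha>\<^sup>2) - lam * T" unfolding b_def lam_def by simp
    then show ?thesis by (simp add: right_diff_distrib)
  qed
  show "0 \<le> lam * t + b \<or> (real L - 1) / 2 * ln (t / \<alpha>\<^sup>2) \<le> lam * t + b"
  proof (cases "\<alpha>\<^sup>2 \<le> real L")
    case True
    then have TT: "T = \<alpha>\<^sup>2" using T by simp
    have slope: "lam \<le> (real L - 1) / (2 * T)"
    proof -
      have "lam = (T - 1) / (2 * T)" using T1 unfolding lam_def by (simp add: field_simps)
      also have "\<dots> \<le> (real L - 1) / (2 * T)"
        using True TT T1 by (intro divide_right_mono) auto
      finally show ?thesis .
    qed
    show ?thesis
    proof (cases "t \<ge> T")
      case True
      then have "0 \<le> lam * t + b" unfolding B using TT lam0 a2 by simp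
      then show ?thesis ..
    next
      case False
      then have "(real L - 1) / (2 * T) * (t - T) \<le> lam * (t - T)"
        using slope by (intro mult_right_mono_neg) auto
      then show ?thesis using A B by linarith
    qed
  next
    case False
    then have "T = real L" using T by simp
    then have "(real L - 1) / (2 * T) = lam" using assms(2) unfolding lam_def by (simp add: field_simps)
    then show ?thesis using A B by simp
  qed
qed

lemma ln_one_minus_div_tangent:
  fixes a t t0 :: real
  assumes "0 < a" "a < t" "a < t0"
  shows "ln (1 - a / t) \<le> ln (1 - a / t0) + a / (t0 * (t0 - a)) * (t - t0)"
proof -
  have e: "(1 - a / t) / (1 - a / t0) = 1 + a * (t - t0) / (t * (t0 - a))"
    using assms by (simp add: divide_simps) (simp add: algebra_simps)
  have "ln (1 - a / t) - ln (1 - a / t0) = ln ((1 - a / t) / (1 - a / t0))"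
    using assms by (simp add: ln_div)
  also have "\<dots> \<le> (1 - a / t) / (1 - a / t0) - 1"
    using assms by (intro ln_le_minus_one) auto
  also have "\<dots> = a * (t - t0) / (t * (t0 - a))" unfolding e by simp
  also have "\<dots> \<le> a * (t - t0) / (t0 * (t0 - a))"
  proof -
    have "a * (t - t0) / (t0 * (t0 - a)) - a * (t - t0) / (t * (t0 - a)) = a * (t - t0)\<^sup>2 / (t * t0 * (t0 - a))"
      using assms by (simp add: divide_simps) (simp add: power2_eq_square algebra_simps)
    moreover have "a * (t - t0)\<^sup>2 / (t * t0 * (t0 - a)) \<ge> 0" using assms by simp
    ultimately show ?thesis by linarith
  qed
  finally show ?thesis by (simp add: algebra_simps)
qed

text \<open>
  Beyond \<open>\<alpha> = sqrt (2 * L)\<close> the tangent point is the root \<open>T\<close> of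
  \<open>T\<^sup>2 - (a + 1) * T - (L - 2) * a = 0\<close> with \<open>a = \<alpha>\<^sup>2 / 4\<close>, which is the stationarity condition for
  \<open>t / 2 - ln t / 2 - 1 / 2 - (L - 1) / 2 * ln (1 - a / t)\<close>; the radicand in \<open>exponent_F\<close> is \<open>16\<close> times
  its discriminant. The condition on \<open>\<alpha>\<close> gives \<open>T \<le> 2 * a\<close>, so that the tangent touches the
  branch of \<open>lens_sq\<close> on which expurgation matters.
\<close>

lemma exponent_tangent_expurgation:
  fixes \<alpha> :: real and L :: nat
  assumes "\<alpha> > sqrt (2 * real L)" and "L \<ge> 2"
  obtains lam b :: real where "0 \<le> lam" "lam < 1/2"
    "b - 1/2 * ln (1 - 2 * lam) = - exponent_F \<alpha> L"
    "\<And>t. t > 0 \<Longrightarrow> lens_sq \<alpha> t > 0 \<Longrightarrow> (real L - 1) / 2 * ln (lens_sq \<alpha> t / \<alpha>\<^sup>2) \<le> lam * t + b"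
proof -
  define a where "a = \<alpha>\<^sup>2 / 4"
  define s where "s = sqrt (\<alpha>^4 + 8 * \<alpha>^2 * (2 * real L - 3) + 16)"
  define T where "T = (s + \<alpha>\<^sup>2 + 4) / 8"
  define m where "m = real L - 1"
  have m1: "m \<ge> 1" using assms(2) m_def by simp
  have al: "\<alpha> > 0" using assms(1) by (smt (verit) real_sqrt_ge_zero of_nat_0_le_iff)
  have "\<alpha>\<^sup>2 > 2 * real L"
    using assms(1) al by (metis real_sqrt_less_iff real_sqrt_abs abs_of_pos)
  then have aL: "2 * a > m + 1" unfolding a_def m_def by simp
  then have a1: "a > 0" using m1 by simp
  have al2: "\<alpha>\<^sup>2 = 4 * a" by (simp add: a_def)
  have al4: "\<alpha>^4 = 16 * a\<^sup>2" unfolding a_def by (simp add: power_divide flip: power_mult)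
  have rad: "\<alpha>^4 + 8 * \<alpha>^2 * (2 * real L - 3) + 16 = 16 * ((a + 1)\<^sup>2 + 4 * (m - 1) * a)"
    unfolding al4 al2 m_def by (simp add: power2_eq_square algebra_simps)
  have radpos: "(a + 1)\<^sup>2 + 4 * (m - 1) * a \<ge> 0" using a1 m1 by simp
  have s2: "s\<^sup>2 = 16 * ((a + 1)\<^sup>2 + 4 * (m - 1) * a)" unfolding s_def rad using radpos by simp
  have s0: "s \<ge> 0" unfolding s_def rad using radpos by simp
  have sT: "s = 8 * T - 4 * a - 4" unfolding T_def al2 by (simp add: field_simps)
  have quad: "T\<^sup>2 - (a + 1) * T - (m - 1) * a = 0"
    using s2 unfolding sT by (simp add: power2_eq_square algebra_simps)
  have "s\<^sup>2 > (4 * a - 4)\<^sup>2"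
    unfolding s2 using a1 m1 by (simp add: power2_eq_square algebra_simps)
  then have "\<bar>4 * a - 4\<bar> < s" using s0 by (metis abs_of_nonneg abs_square_less_1 power2_less_imp_less power2_abs)
  then have Ta: "T > a" unfolding T_def al2 by simp
  have "s \<le> 12 * a - 4"
  proof (rule power2_le_imp_le)
    have "0 \<le> a * (2 * a - (m + 1))" using a1 aL by simp
    then show "s\<^sup>2 \<le> (12 * a - 4)\<^sup>2" unfolding s2 by (simp add: power2_eq_square algebra_simps)
    show "0 \<le> 12 * a - 4" using aL m1 by simp
  qed
  then have T2a: "T \<le> 2 * a" unfolding T_def al2 by simp
  define lam where "lam = m / 2 * (a / (T * (T - a)))"
  have T0: "T > 0" using Ta a1 by simp
  have lam_eq: "lam = 1/2 - 1 / (2 * T)"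
  proof -
    have "m * a = (T - 1) * (T - a)" using quad by (simp add: power2_eq_square algebra_simps)
    then have "lam = ((T - 1) * (T - a)) / (2 * (T * (T - a)))" unfolding lam_def by simp
    also have "\<dots> = (T - 1) / (2 * T)" using Ta by simp
    also have "\<dots> = 1/2 - 1 / (2 * T)" using T0 by (simp add: field_simps)
    finally show ?thesis .
  qed
  have lam0: "0 \<le> lam" using m1 a1 Ta T0 unfolding lam_def by simp
  have lam1: "lam < 1/2" using T0 unfolding lam_eq by simp
  define b where "b = m / 2 * ln (1 - a / T) - lam * T"
  have "b - 1/2 * ln (1 - 2 * lam) = - exponent_F \<alpha> L"
  proof -
    have l: "ln (1 - 2 * lam) = - ln T" using T0 by (simp add: lam_eq ln_div)
    have l2: "ln (1 - a / T) = ln (T - a) - ln T"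
    proof -
      have "1 - a / T = (T - a) / T" using T0 by (simp add: diff_divide_distrib)
      then show ?thesis using Ta T0 by (simp add: ln_div)
    qed
    have lT: "lam * T = T/2 - 1/2" using T0 by (simp add: lam_eq field_simps)
    have g: "ln (s - \<alpha>\<^sup>2 + 4) = 3 * ln 2 + ln (T - a)"
    proof -
      have "s - \<alpha>\<^sup>2 + 4 = 2^3 * (T - a)" unfolding sT al2 by simp
      also have "ln \<dots> = ln (2^3) + ln (T - a)" using Ta by (intro ln_mult_pos) auto
      also have "ln (2^3::real) = 3 * ln 2" by (subst ln_realpow) auto
      finally show ?thesis .
    qed
    have h: "ln (s + \<alpha>\<^sup>2 + 4) = 3 * ln 2 + ln T"
    proof -
      have "s + \<alpha>\<^sup>2 + 4 = 2^3 * T" unfolding sT al2 by simp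
      also have "ln \<dots> = ln (2^3) + ln T" using T0 by (intro ln_mult_pos) auto
      also have "ln (2^3::real) = 3 * ln 2" by (subst ln_realpow) auto
      finally show ?thesis .
    qed
    have "exponent_F \<alpha> L = \<alpha>\<^sup>2 / 16 + 1/16 * s - m / 2 * ln (s - \<alpha>^2 + 4)
       + (m - 1) / 2 * ln (s + \<alpha>^2 + 4) + 3/2 * ln 2 - 1/4"
      unfolding exponent_F_def Let_def s_def[symmetric] m_def by simp
    also have "\<dots> = T / 2 - 1/2 - m / 2 * ln (T - a) + (m - 1) / 2 * ln T"
      unfolding g h unfolding sT al2 by (simp add: field_simps)
    finally show ?thesis unfolding b_def l l2 lT by (simp add: field_simps)
  qed
  moreover have "m / 2 * ln (lens_sq \<alpha> t / \<alpha>\<^sup>2) \<le> lam * t + b"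
    if t: "t > 0" and pos: "lens_sq \<alpha> t > 0" for t
  proof -
    have "ln (lens_sq \<alpha> t / \<alpha>\<^sup>2) \<le> ln (1 - a / T) + a / (T * (T - a)) * (t - T)"
    proof (cases "t \<le> 2 * a")
      case True
      then have e: "lens_sq \<alpha> t = 4 * a * (1 - a / t)" unfolding lens_sq_def al2 by simp
      then have "1 - a / t > 0" using pos a1 by (simp add: zero_less_mult_iff)
      then have "a < t" using t by (simp add: field_simps)
      then show ?thesis using ln_one_minus_div_tangent[OF a1 _ Ta] a1 unfolding e al2 by simp
    next
      case False
      then have e: "lens_sq \<alpha> t = t" unfolding lens_sq_def al2 by simp
      have "ln (t / (4 * a)) = ln (1/2) + ln (t / (2 * a))"
        using t a1 by (subst ln_mult_pos[symmetric]) auto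
      also have "ln (t / (2 * a)) \<le> t / (2 * a) - 1"
        using t a1 by (intro ln_le_minus_one) auto
      also have "t / (2 * a) - 1 = (1 / (2 * a)) * (t - 2 * a)" using a1 by (simp add: field_simps)
      also have "\<dots> \<le> a / (T * (T - a)) * (t - 2 * a)"
      proof -
        have "T * (T - a) \<le> (2 * a) * a" using T2a Ta T0 by (intro mult_mono) auto
        then have "1 / (2 * a) \<le> a / (T * (T - a))"
          using a1 T0 Ta by (simp add: field_simps)
        then show ?thesis using False by (intro mult_right_mono) auto
      qed
      also have "ln (1/2) = ln (1 - a / (2 * a))" using a1 by simp
      also have "ln (1 - a / (2 * a)) \<le> ln (1 - a / T) + a / (T * (T - a)) * (2 * a - T)"
        using a1 Ta by (intro ln_one_minus_div_tangent) auto
      also have "ln (1 - a / T) + a / (T * (T - a)) * (2 * a - T) + a / (T * (T - a)) * (t - 2 * a)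
          = ln (1 - a / T) + a / (T * (T - a)) * (t - T)"
        unfolding add.assoc distrib_left[symmetric] by simp
      finally show ?thesis unfolding e al2 by simp
    qed
    then have "m / 2 * ln (lens_sq \<alpha> t / \<alpha>\<^sup>2) \<le> m / 2 * (ln (1 - a / T) + a / (T * (T - a)) * (t - T))"
      using m1 by (intro mult_left_mono) auto
    also have "\<dots> = lam * t + b"
    proof -
      define c where "c = a / (T * (T - a))"
      show ?thesis unfolding b_def lam_def c_def[symmetric] by (simp add: algebra_simps)
    qed
    finally show ?thesis .
  qed
  ultimately show ?thesis using that lam0 lam1 unfolding m_def by blast
qed

text \<open>
  In each regime the point where the line touches minimises the sum of the large deviation rate of
  the noise length and the cost of finding \<open>L - 1\<close> words in the lens. The alternative
  \<open>0 \<le> lam * t + b\<close> accounts for the probability bound \<open>1\<close>, which is the better one for long noise.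
\<close>

lemma exponent_tangent:
  fixes \<alpha> :: real and L :: nat
  assumes "\<alpha> \<ge> 1" and "L \<ge> 2"
  obtains lam b :: real where "0 \<le> lam" "lam < 1/2"
    "b - 1/2 * ln (1 - 2 * lam) = - exponent_ex L \<alpha>"
    "\<And>t. t > 0 \<Longrightarrow> lens_sq \<alpha> t > 0 \<Longrightarrow>
       0 \<le> lam * t + b \<or> (real L - 1) / 2 * ln (lens_sq \<alpha> t / \<alpha>\<^sup>2) \<le> lam * t + b"
proof (cases "\<alpha> \<le> sqrt (2 * real L)")
  case True
  note N = exponent_tangent_no_expurgation[OF assms refl]
  have "0 \<le> lam * t + b \<or> (real L - 1) / 2 * ln (lens_sq \<alpha> t / \<alpha>\<^sup>2) \<le> lam * t + b"
    if t: "t > 0" "lens_sq \<alpha> t > 0"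
      and h: "0 \<le> lam * t + b \<or> (real L - 1) / 2 * ln (t / \<alpha>\<^sup>2) \<le> lam * t + b" for t lam b :: real
  proof -
    have "lens_sq \<alpha> t / \<alpha>\<^sup>2 \<le> t / \<alpha>\<^sup>2" using lens_sq_le[OF t(1)] by (intro divide_right_mono) auto
    then have "ln (lens_sq \<alpha> t / \<alpha>\<^sup>2) \<le> ln (t / \<alpha>\<^sup>2)" using t assms(1) by (subst ln_le_cancel_iff) auto
    then have "(real L - 1) / 2 * ln (lens_sq \<alpha> t / \<alpha>\<^sup>2) \<le> (real L - 1) / 2 * ln (t / \<alpha>\<^sup>2)"
      using assms(2) by (intro mult_left_mono) auto
    then show ?thesis using h by linarith
  qed
  note mono = this
  show ?thesis
  proof (rule that[OF N(1,2)])
    show "(real L - 1) / 2 * ln (min (\<alpha>\<^sup>2) (real L) / \<alpha>\<^sup>2)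
       - (1 / 2 - 1 / (2 * min (\<alpha>\<^sup>2) (real L))) * min (\<alpha>\<^sup>2) (real L)
       - 1 / 2 * ln (1 - 2 * (1 / 2 - 1 / (2 * min (\<alpha>\<^sup>2) (real L)))) = - exponent_ex L \<alpha>"
      unfolding N(3) exponent_ex_def using True by simp
  qed (rule mono[OF _ _ N(4)])
next
  case False
  have "sqrt (real L) \<le> sqrt (2 * real L)" by simp
  with False have "\<not> \<alpha> \<le> sqrt (real L)" by linarith
  with False have e: "exponent_ex L \<alpha> = exponent_F \<alpha> L" unfolding exponent_ex_def by simp
  from False have "\<alpha> > sqrt (2 * real L)" by simp
  from exponent_tangent_expurgation[OF this assms(2)] show ?thesis
    using that unfolding e by metis
qed

section \<open>Gaussian estimates\<close>

lemma space_lebesgue_Rn: "space (lebesgue_Rn n) = {..<n} \<rightarrow>\<^sub>E UNIV"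
  by (simp add: lebesgue_Rn_def space_PiM)

lemma sets_lebesgue_Rn [measurable_cong]: "sets (lebesgue_Rn n) = sets (PiM {..<n} (\<lambda>_. borel))"
  unfolding lebesgue_Rn_def by (intro sets_PiM_cong) auto

lemma sets_awgn [measurable_cong]: "sets (awgn n \<sigma>) = sets (PiM {..<n} (\<lambda>_. borel))"
  unfolding awgn_def by (intro sets_PiM_cong) auto

lemma L2_set_less_iff: "L2_set f A < L2_set g A \<longleftrightarrow> (\<Sum>i\<in>A. (f i)\<^sup>2) < (\<Sum>i\<in>A. (g i)\<^sup>2)"
  by (simp add: L2_set_def)

lemma measurable_L2_set [measurable (raw)]:
  assumes "\<And>i. i \<in> A \<Longrightarrow> (\<lambda>x. f x i) \<in> borel_measurable M"
  shows "(\<lambda>x. L2_set (f x) A) \<in> borel_measurable M"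
  unfolding L2_set_def using assms by measurable

lemma nn_integral_normal_density:
  assumes "\<sigma> > 0"
  shows "(\<integral>\<^sup>+x. ennreal (normal_density \<mu> \<sigma> x) \<partial>lborel) = 1"
  using assms by (subst nn_integral_eq_integral) (auto simp: normal_density_nonneg)

lemma prob_space_awgn:
  assumes "\<sigma> > 0" shows "prob_space (awgn n \<sigma>)"
  unfolding awgn_def by (intro prob_space_PiM prob_space_normal_density assms)

lemma nn_integral_gaussian:
  fixes c v :: real assumes v: "v > 0"
  shows "(\<integral>\<^sup>+x. ennreal (exp (- (x - c)\<^sup>2 / (2 * v))) \<partial>lborel) = ennreal (sqrt (2 * pi * v))"
proof -
  have e: "ennreal (exp (- (x - c)\<^sup>2 / (2 * v))) =
      ennreal (sqrt (2 * pi * v)) * ennreal (normal_density c (sqrt v) x)" for x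
    using v unfolding normal_density_def by (simp add: ennreal_mult''[symmetric])
  show ?thesis unfolding e using v
    by (subst nn_integral_cmult) (auto simp: nn_integral_normal_density)
qed

text \<open>
  Chernoff bound for the volume: the indicator of the ball is dominated by
  \<open>exp (n / 2 * (1 - \<bar>p - c\<bar>\<^sup>2 / H))\<close>, whose integral is a product of Gaussian integrals. The bound is
  what Stirling's formula would give for the exact volume.
\<close>

lemma emeasure_ball_le:
  fixes c :: "nat \<Rightarrow> real" and H :: real
  assumes n: "n \<ge> 1"
  shows "emeasure (lebesgue_Rn n) {p \<in> space (lebesgue_Rn n). (\<Sum>i<n. (p i - c i)\<^sup>2) < H}
      \<le> ennreal (sqrt (2 * pi * exp 1 * max 0 H / n) ^ n)"
proof (cases "H > 0")
  case False
  then have "{p \<in> space (lebesgue_Rn n). (\<Sum>i<n. (p i - c i)\<^sup>2) < H} = {}"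
    by (auto simp: not_less intro: order.trans[OF _ sum_nonneg])
  then show ?thesis by (simp only: emeasure_empty zero_le)
next
  case True
  interpret P: product_sigma_finite "\<lambda>_::nat. lborel :: real measure" ..
  let ?f = "\<lambda>i x. ennreal (exp (1/2)) * ennreal (exp (- (x - c i)\<^sup>2 / (2 * (H / n))))"
  let ?S = "{p \<in> space (lebesgue_Rn n). (\<Sum>i<n. (p i - c i)\<^sup>2) < H}"
  have S[measurable]: "?S \<in> sets (lebesgue_Rn n)" by measurable
  have "emeasure (lebesgue_Rn n) ?S = (\<integral>\<^sup>+p. indicator ?S p \<partial>lebesgue_Rn n)" by simp
  also have "\<dots> \<le> (\<integral>\<^sup>+p. (\<Prod>i<n. ?f i (p i)) \<partial>lebesgue_Rn n)"
  proof (rule nn_integral_mono)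
    fix p
    have "(\<Prod>i<n. ?f i (p i)) = ennreal (\<Prod>i<n. exp (1/2) * exp (- (p i - c i)\<^sup>2 / (2 * (H / n))))"
      by (subst prod_ennreal[symmetric]) (auto simp: ennreal_mult'')
    also have "(\<Prod>i<n. exp (1/2) * exp (- (p i - c i)\<^sup>2 / (2 * (H / n)))) =
       exp (\<Sum>i<n. 1/2 - (p i - c i)\<^sup>2 / (2 * (H / n)))"
      by (subst exp_sum) (auto simp: exp_add[symmetric])
    also have "(\<Sum>i<n. 1/2 - (p i - c i)\<^sup>2 / (2 * (H / n))) = n/2 * (1 - (\<Sum>i<n. (p i - c i)\<^sup>2) / H)"
      using True n by (simp add: sum_subtractf sum_divide_distrib[symmetric] right_diff_distrib sum_distrib_right[symmetric])
    finally have e: "(\<Prod>i<n. ?f i (p i)) = ennreal (exp (n/2 * (1 - (\<Sum>i<n. (p i - c i)\<^sup>2) / H)))" .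
    show "indicator ?S p \<le> (\<Prod>i<n. ?f i (p i))"
    proof (cases "p \<in> ?S")
      case True
      then have "1 \<le> exp (n/2 * (1 - (\<Sum>i<n. (p i - c i)\<^sup>2) / H))" using \<open>H > 0\<close> by simp
      then show ?thesis unfolding e using True by simp
    qed simp
  qed
  also have "\<dots> = (\<Prod>i<n. integral\<^sup>N lborel (?f i))"
    unfolding lebesgue_Rn_def by (rule P.product_nn_integral_prod) auto
  also have "\<dots> = (\<Prod>i<n. ennreal (sqrt (2 * pi * exp 1 * max 0 H / n)))"
  proof (rule prod.cong[OF refl])
    fix i
    have "integral\<^sup>N lborel (?f i) = ennreal (exp (1/2)) * ennreal (sqrt (2 * pi * (H / n)))"
    proof (subst nn_integral_cmult)
      have "H / n > 0" using True n by simp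
      then show "ennreal (exp (1/2)) * (\<integral>\<^sup>+x. ennreal (exp (- (x - c i)\<^sup>2 / (2 * (H / n)))) \<partial>lborel)
          = ennreal (exp (1/2)) * ennreal (sqrt (2 * pi * (H / n)))"
        by (subst nn_integral_gaussian) auto
    qed measurable
    also have "\<dots> = ennreal (exp (1/2) * sqrt (2 * pi * (H / n)))"
      using True by (subst ennreal_mult) auto
    also have "exp (1/2) * sqrt (2 * pi * (H / n)) = sqrt (2 * pi * exp 1 * max 0 H / n)"
    proof -
      have "exp (1/2) = sqrt (exp (1::real))"
        by (rule real_sqrt_unique[symmetric]) (auto simp: power2_eq_square exp_add[symmetric])
      then show ?thesis using True by (simp add: real_sqrt_mult[symmetric] mult_ac)
    qed
    finally show "integral\<^sup>N lborel (?f i) = ennreal (sqrt (2 * pi * exp 1 * max 0 H / n))" .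
  qed
  also have "\<dots> = ennreal (sqrt (2 * pi * exp 1 * max 0 H / n) ^ n)"
    by (simp add: ennreal_power)
  finally show ?thesis .
qed

lemma awgn_exponential_moment:
  fixes lam \<sigma> :: real
  assumes "\<sigma> > 0" "lam < 1/2"
  shows "(\<integral>\<^sup>+g. ennreal (exp (lam * (\<Sum>i<n. (g i)\<^sup>2) / \<sigma>\<^sup>2)) \<partial>awgn n \<sigma>)
     = ennreal ((1 / sqrt (1 - 2 * lam)) ^ n)"
proof -
  interpret P: product_sigma_finite "\<lambda>_::nat. density lborel (\<lambda>t. ennreal (normal_density 0 \<sigma> t))"
    unfolding product_sigma_finite_def
    using prob_space_normal_density[OF assms(1)] prob_space_imp_sigma_finite by blast
  let ?f = "\<lambda>(i::nat) t. ennreal (exp (lam * t\<^sup>2 / \<sigma>\<^sup>2))"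
  define v where "v = \<sigma>\<^sup>2 / (1 - 2 * lam)"
  have v: "v > 0" using assms by (simp add: v_def)
  have one: "(\<integral>\<^sup>+t. ennreal (exp (lam * t\<^sup>2 / \<sigma>\<^sup>2)) \<partial>density lborel (\<lambda>t. ennreal (normal_density 0 \<sigma> t)))
      = ennreal (1 / sqrt (1 - 2 * lam))"
  proof -
    have e: "ennreal (normal_density 0 \<sigma> t) * ennreal (exp (lam * t\<^sup>2 / \<sigma>\<^sup>2))
       = ennreal (1 / sqrt (2 * pi * \<sigma>\<^sup>2)) * ennreal (exp (- (t - 0)\<^sup>2 / (2 * v)))" for t
    proof -
      have "- t\<^sup>2 / (2 * \<sigma>\<^sup>2) + lam * t\<^sup>2 / \<sigma>\<^sup>2 = - t\<^sup>2 / (2 * v)"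
        using assms unfolding v_def by (simp add: field_simps)
      then have "exp (- t\<^sup>2 / (2 * \<sigma>\<^sup>2)) * exp (lam * t\<^sup>2 / \<sigma>\<^sup>2) = exp (- t\<^sup>2 / (2 * v))"
        by (simp add: exp_add[symmetric])
      then show ?thesis
        by (simp add: normal_density_def ennreal_mult''[symmetric])
    qed
    have "(\<integral>\<^sup>+t. ennreal (exp (lam * t\<^sup>2 / \<sigma>\<^sup>2)) \<partial>density lborel (\<lambda>t. ennreal (normal_density 0 \<sigma> t)))
      = (\<integral>\<^sup>+t. ennreal (1 / sqrt (2 * pi * \<sigma>\<^sup>2)) * ennreal (exp (- (t - 0)\<^sup>2 / (2 * v))) \<partial>lborel)"
      by (subst nn_integral_density) (auto simp: e)
    also have "\<dots> = ennreal (1 / sqrt (2 * pi * \<sigma>\<^sup>2)) * ennreal (sqrt (2 * pi * v))"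
      by (subst nn_integral_cmult) (auto simp only: nn_integral_gaussian[OF v], measurable)
    also have "\<dots> = ennreal (1 / sqrt (2 * pi * \<sigma>\<^sup>2) * sqrt (2 * pi * v))"
      using v by (subst ennreal_mult) auto
    also have "1 / sqrt (2 * pi * \<sigma>\<^sup>2) * sqrt (2 * pi * v) = 1 / sqrt (1 - 2 * lam)"
      using assms unfolding v_def by (simp add: real_sqrt_mult real_sqrt_divide)
    finally show ?thesis .
  qed
  have "(\<integral>\<^sup>+g. ennreal (exp (lam * (\<Sum>i<n. (g i)\<^sup>2) / \<sigma>\<^sup>2)) \<partial>awgn n \<sigma>)
     = (\<integral>\<^sup>+g. (\<Prod>i<n. ?f i (g i)) \<partial>awgn n \<sigma>)"
    by (intro nn_integral_cong)
       (simp add: prod_ennreal exp_sum[symmetric] sum_distrib_left sum_divide_distrib)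
  also have "\<dots> = (\<Prod>i<n. ennreal (1 / sqrt (1 - 2 * lam)))"
    unfolding awgn_def by (subst P.product_nn_integral_prod) (auto simp: one)
  also have "\<dots> = ennreal ((1 / sqrt (1 - 2 * lam)) ^ n)"
    using assms by (simp add: ennreal_power)
  finally show ?thesis .
qed

lemma awgn_first_coordinate:
  assumes "\<sigma> > 0" "n \<ge> 1"
  shows "measure (awgn n \<sigma>) {g \<in> space (awgn n \<sigma>). g 0 > \<sigma>} \<ge> exp (-2) / sqrt (2 * pi)"
proof -
  interpret prob_space "awgn n \<sigma>" by (rule prob_space_awgn[OF assms(1)])
  let ?D = "density lborel (\<lambda>t. ennreal (normal_density 0 \<sigma> t))"
  have d: "distr (awgn n \<sigma>) ?D (\<lambda>g. g 0) = ?D"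
    unfolding awgn_def using assms(2)
    by (intro distr_PiM_component prob_space_normal_density assms(1)) auto
  have m: "(\<lambda>g. g 0) \<in> measurable (awgn n \<sigma>) ?D"
    unfolding awgn_def using assms(2) by (intro measurable_component_singleton) auto
  have "emeasure (awgn n \<sigma>) {g \<in> space (awgn n \<sigma>). g 0 > \<sigma>} = emeasure ?D {\<sigma><..}"
    by (subst d[symmetric], subst emeasure_distr[OF m])
       (auto intro!: arg_cong[where f="emeasure (awgn n \<sigma>)"])
  also have "\<dots> = (\<integral>\<^sup>+t. ennreal (normal_density 0 \<sigma> t) * indicator {\<sigma><..} t \<partial>lborel)"
    by (subst emeasure_density) auto
  also have "\<dots> \<ge> (\<integral>\<^sup>+t. ennreal (exp (-2) / (sqrt (2 * pi) * \<sigma>)) * indicator {\<sigma><..2*\<sigma>} t \<partial>lborel)"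
  proof (rule nn_integral_mono)
    fix t
    show "ennreal (exp (-2) / (sqrt (2 * pi) * \<sigma>)) * indicator {\<sigma><..2*\<sigma>} t
       \<le> ennreal (normal_density 0 \<sigma> t) * indicator {\<sigma><..} t"
    proof (cases "t \<in> {\<sigma><..2*\<sigma>}")
      case True
      have "t\<^sup>2 \<le> (2*\<sigma>)\<^sup>2" using True assms by (intro power_mono) auto
      then have "exp (-2) \<le> exp (- t\<^sup>2 / (2 * \<sigma>\<^sup>2))"
        using assms by (simp add: field_simps power2_eq_square)
      then have "exp (-2) / (sqrt (2 * pi) * \<sigma>) \<le> normal_density 0 \<sigma> t"
        using assms unfolding normal_density_def by (simp add: real_sqrt_mult divide_right_mono)
      then show ?thesis using True by (simp add: ennreal_leI)
    qed simp
  qed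
  also have "(\<integral>\<^sup>+t. ennreal (exp (-2) / (sqrt (2 * pi) * \<sigma>)) * indicator {\<sigma><..2*\<sigma>} t \<partial>lborel)
     = ennreal (exp (-2) / sqrt (2 * pi))"
    using assms by (subst nn_integral_cmult_indicator) (auto simp: ennreal_mult''[symmetric])
  finally show ?thesis by (simp add: emeasure_eq_measure)
qed

text \<open>
  If \<open>t \<le> \<alpha>\<^sup>2 / 2\<close>, then with \<open>k = \<alpha>\<^sup>2 / (2 * t)\<close> the point \<open>k * g\<close> is the centre of the rim of the lens. Both defining
  inequalities enter linearly in \<open>\<bar>p\<bar>\<^sup>2\<close> and in the inner product of \<open>p\<close> and \<open>g\<close>, and \<open>k \<ge> 1\<close>
  gives them the right signs.
\<close>

lemma list_region_in_ball:
  fixes p g :: "nat \<Rightarrow> real" and n :: nat and \<sigma> \<alpha> :: real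
  assumes n: "n \<ge> 1" and \<sigma>: "\<sigma> > 0" and \<alpha>: "\<alpha> > 0"
    and near: "(\<Sum>i<n. (p i - g i)\<^sup>2) < (\<Sum>i<n. (g i)\<^sup>2)"
    and far: "(\<Sum>i<n. (p i)\<^sup>2) \<ge> n * \<sigma>\<^sup>2 * \<alpha>\<^sup>2"
  defines "t \<equiv> (\<Sum>i<n. (g i)\<^sup>2) / (n * \<sigma>\<^sup>2)"
  shows "(\<Sum>i<n. (p i - max 1 (\<alpha>\<^sup>2 / (2 * t)) * g i)\<^sup>2) < n * \<sigma>\<^sup>2 * lens_sq \<alpha> t"
proof -
  define q where "q = n * \<sigma>\<^sup>2"
  define P where "P = (\<Sum>i<n. (p i)\<^sup>2)"
  define A where "A = (\<Sum>i<n. p i * g i)"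
  define r where "r = (\<Sum>i<n. (g i)\<^sup>2)"
  have q: "q > 0" using n \<sigma> by (simp add: q_def)
  have expand: "(\<Sum>i<n. (p i - k * g i)\<^sup>2) = P - 2 * k * A + k\<^sup>2 * r" for k
    unfolding P_def A_def r_def
    by (simp add: power2_diff sum.distrib sum_subtractf sum_distrib_left power_mult_distrib algebra_simps)
  have nr: "P < 2 * A" using near expand[of 1] by (simp add: r_def)
  have fr: "P \<ge> q * \<alpha>\<^sup>2" using far by (simp add: P_def q_def)
  have P0: "P \<ge> 0" unfolding P_def by (intro sum_nonneg) auto
  have "r > 0" using near unfolding r_def by (smt (verit) sum_nonneg zero_le_power2)
  then have t0: "t > 0" and rt: "r = q * t" using q unfolding t_def q_def r_def by auto
  show ?thesis
  proof (cases "t \<le> \<alpha>\<^sup>2 / 2")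
    case True
    define k where "k = \<alpha>\<^sup>2 / (2 * t)"
    have k1: "k \<ge> 1" using True t0 unfolding k_def by (simp add: field_simps)
    have "P - 2 * k * A + k\<^sup>2 * r < P - k * P + k\<^sup>2 * r"
      using nr k1 by (simp add: mult.commute)
    also have "\<dots> = (1 - k) * P + k\<^sup>2 * r" by (simp add: algebra_simps)
    also have "\<dots> \<le> (1 - k) * (q * \<alpha>\<^sup>2) + k\<^sup>2 * r"
      using fr k1 by (intro add_right_mono mult_left_mono_neg) auto
    also have "\<dots> = q * (\<alpha>\<^sup>2 * (1 - \<alpha>\<^sup>2 / (4 * t)))"
      using t0 unfolding rt k_def by (simp add: field_simps power2_eq_square)
    finally show ?thesis using k1 True unfolding expand q_def[symmetric] lens_sq_def k_def
      by (simp add: max_absorb2)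
  next
    case False
    then have "\<alpha>\<^sup>2 / (2 * t) \<le> 1" using t0 by (simp add: field_simps)
    then have m: "max 1 (\<alpha>\<^sup>2 / (2 * t)) = 1" by simp
    show ?thesis unfolding m expand using nr False rt
      by (simp add: lens_sq_def q_def)
  qed
qed

section \<open>Expurgated random codes in a cube\<close>

text \<open>
  Given the point with index \<open>i\<close>, the other coordinates are independent, so the conditional
  probability is a product.
\<close>

lemma emeasure_PiM_all_related_le:
  fixes \<mu> :: "'b measure" and i :: 'a and v :: ennreal
  assumes "prob_space \<mu>" and I: "finite I" "i \<in> I" and J: "J \<subseteq> I - {i}"
    and S[measurable]: "S \<in> sets (\<mu> \<Otimes>\<^sub>M \<mu>)"
    and v: "\<And>x. x \<in> space \<mu> \<Longrightarrow> emeasure \<mu> {p \<in> space \<mu>. (x, p) \<in> S} \<le> v"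
  shows "emeasure (PiM I (\<lambda>_. \<mu>)) {\<omega> \<in> space (PiM I (\<lambda>_. \<mu>)). \<forall>j\<in>J. (\<omega> i, \<omega> j) \<in> S} \<le> v ^ card J"
proof -
  interpret m: prob_space \<mu> by fact
  interpret P: product_sigma_finite "\<lambda>_::'a. \<mu>" ..
  define K where "K = I - {i}"
  have K: "finite K" "i \<notin> K" "insert i K = I" "J \<subseteq> K" "finite J"
    using I J by (auto simp: K_def intro: finite_subset)
  let ?A = "{\<omega> \<in> space (PiM I (\<lambda>_. \<mu>)). \<forall>j\<in>J. (\<omega> i, \<omega> j) \<in> S}"
  have comp: "(\<lambda>\<omega>. \<omega> j) \<in> measurable (PiM I (\<lambda>_. \<mu>)) \<mu>" if "j \<in> I" for j
    using that by (rule measurable_component_singleton)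
  have A[measurable]: "?A \<in> sets (PiM I (\<lambda>_. \<mu>))"
  proof (rule sets.sets_Collect_finite_All[OF _ K(5)])
    fix j assume "j \<in> J"
    then have [measurable]: "(\<lambda>\<omega>. \<omega> j) \<in> measurable (PiM I (\<lambda>_. \<mu>)) \<mu>"
      "(\<lambda>\<omega>. \<omega> i) \<in> measurable (PiM I (\<lambda>_. \<mu>)) \<mu>" using K I by (auto intro!: comp)
    show "{\<omega> \<in> space (PiM I (\<lambda>_. \<mu>)). (\<omega> i, \<omega> j) \<in> S} \<in> sets (PiM I (\<lambda>_. \<mu>))"
      by measurable
  qed
  have "emeasure (PiM I (\<lambda>_. \<mu>)) ?A = (\<integral>\<^sup>+\<omega>. indicator ?A \<omega> \<partial>PiM (insert i K) (\<lambda>_. \<mu>))"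
    unfolding K(3) by simp
  also have "\<dots> = (\<integral>\<^sup>+y. (\<integral>\<^sup>+x. indicator ?A (x(i := y)) \<partial>PiM K (\<lambda>_. \<mu>)) \<partial>\<mu>)"
    using K by (intro P.product_nn_integral_insert_rev) auto
  also have "\<dots> \<le> (\<integral>\<^sup>+y. v ^ card J \<partial>\<mu>)"
  proof (rule nn_integral_mono)
    fix y assume y: "y \<in> space \<mu>"
    let ?T = "{p \<in> space \<mu>. (y, p) \<in> S}"
    let ?B = "PiE K (\<lambda>j. if j \<in> J then ?T else space \<mu>)"
    have [measurable]: "?T \<in> sets \<mu>" using y by measurable
    have "(\<integral>\<^sup>+x. indicator ?A (x(i := y)) \<partial>PiM K (\<lambda>_. \<mu>)) \<le> (\<integral>\<^sup>+x. indicator ?B x \<partial>PiM K (\<lambda>_. \<mu>))"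
    proof (rule nn_integral_mono)
      fix x assume x: "x \<in> space (PiM K (\<lambda>_. \<mu>))"
      show "(indicator ?A (x(i := y)) :: ennreal) \<le> indicator ?B x"
      proof (cases "x(i := y) \<in> ?A")
        case True
        have "x \<in> ?B"
        proof (rule PiE_I)
          fix j assume j: "j \<in> K"
          then have "j \<noteq> i" using K by auto
          then show "x j \<in> (if j \<in> J then ?T else space \<mu>)"
            using True x j by (auto simp: space_PiM PiE_iff)
        qed (use x in \<open>auto simp: space_PiM PiE_iff extensional_def\<close>)
        then show ?thesis by (simp add: indicator_def)
      qed simp
    qed
    also have "\<dots> = emeasure (PiM K (\<lambda>_. \<mu>)) ?B"
      using K by (intro nn_integral_indicator sets_PiM_I_finite) auto
    also have "\<dots> = (\<Prod>j\<in>K. emeasure \<mu> (if j \<in> J then ?T else space \<mu>))"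
      using K by (intro P.emeasure_PiM) auto
    also have "\<dots> = (\<Prod>j\<in>K. if j \<in> J then emeasure \<mu> ?T else 1)"
      by (intro prod.cong) (auto simp: m.emeasure_space_1)
    also have "\<dots> = emeasure \<mu> ?T ^ card J"
      using K by (simp add: prod.If_cases Int_absorb1)
    also have "\<dots> \<le> v ^ card J" using v[OF y] by (intro power_mono) auto
    finally show "(\<integral>\<^sup>+x. indicator ?A (x(i := y)) \<partial>PiM K (\<lambda>_. \<mu>)) \<le> v ^ card J" .
  qed
  also have "\<dots> = v ^ card J" by (simp add: m.emeasure_space_1)
  finally show ?thesis .
qed

text \<open>
  This is \<open>exp (n * R)\<close> for the rate \<open>R\<close> of the theorem.
\<close>

definition critical_density :: "nat \<Rightarrow> real \<Rightarrow> real \<Rightarrow> real" where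
  "critical_density n \<sigma> \<alpha> = (1 / sqrt (2 * pi * exp 1 * \<sigma>\<^sup>2 * \<alpha>\<^sup>2)) ^ n"

text \<open>
  The density is critical for radius \<open>sqrt n * \<sigma> * \<alpha>\<close>: at \<open>h = \<alpha>\<^sup>2\<close> the expected number of
  points in the ball is bounded by \<open>1\<close>.
\<close>

lemma critical_density_ball:
  assumes "\<sigma> > 0" "\<alpha> > 0" "n \<ge> 1"
  shows "critical_density n \<sigma> \<alpha> * sqrt (2 * pi * exp 1 * max 0 (n * \<sigma>\<^sup>2 * h) / n) ^ n
     = sqrt (max 0 h / \<alpha>\<^sup>2) ^ n"
proof -
  have m: "max 0 (n * \<sigma>\<^sup>2 * h) = n * \<sigma>\<^sup>2 * max 0 h"
    using assms by (auto simp: max_def mult_le_0_iff zero_le_mult_iff not_le)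
  have "1 / sqrt (2 * pi * exp 1 * \<sigma>\<^sup>2 * \<alpha>\<^sup>2) * sqrt (2 * pi * exp 1 * max 0 (n * \<sigma>\<^sup>2 * h) / n)
    = sqrt (max 0 h / \<alpha>\<^sup>2)"
    unfolding m using assms by (simp add: real_sqrt_mult real_sqrt_divide)
  then show ?thesis
    unfolding critical_density_def power_mult_distrib[symmetric] by simp
qed

text \<open>
  Expurgation. Each word of a random code is charged for lying outside the cube (a null event), for
  having a neighbour within distance \<open>sqrt n * \<sigma> * \<alpha>\<close>, and for its error probability against the
  words beyond that distance. The expected charge is at most \<open>1/4\<close> per word, so some realisation has
  total charge at most \<open>N/2\<close>, and at least half of its words are charged less than \<open>1\<close>. Those
  words have no close neighbours, and hence their error probability in the remaining code is bounded
  by the one that was charged.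
\<close>

lemma finite_code_exists:
  fixes \<sigma> \<alpha> w t :: real and L n N :: nat
  assumes n: "n \<ge> 1" and \<sigma>: "\<sigma> > 0" and \<alpha>: "\<alpha> \<ge> 1" and L: "L \<ge> 2" and t: "t > 0" and N: "N \<ge> 1"
    and dens: "real N \<le> critical_density n \<sigma> \<alpha> * t ^ n / 8"
  obtains X where "finite X" "X \<subseteq> {..<n} \<rightarrow>\<^sub>E {w..w+t}" "real (card X) \<ge> real N / 2" "card X \<le> N"
    "\<And>x. x \<in> X \<Longrightarrow> list_error n \<sigma> (L - 1) X x \<le> 8 * exp (- n * exponent_ex L \<alpha>)"
proof -
  define E where "E = exponent_ex L \<alpha>"
  define q where "q = n * \<sigma>\<^sup>2 * \<alpha>\<^sup>2"
  define Q where "Q = PiE {..<n} (\<lambda>_. {w..w+t})"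
  define \<mu> where "\<mu> = uniform_measure (lebesgue_Rn n) Q"
  define \<Omega> where "\<Omega> = PiM {..<N} (\<lambda>_. \<mu>)"
  obtain lam b where lam: "0 \<le> lam" "lam < 1/2" and bE: "b - 1/2 * ln (1 - 2 * lam) = - E"
    and tang: "\<And>t. t > 0 \<Longrightarrow> lens_sq \<alpha> t > 0 \<Longrightarrow>
       0 \<le> lam * t + b \<or> (real L - 1) / 2 * ln (lens_sq \<alpha> t / \<alpha>\<^sup>2) \<le> lam * t + b"
    unfolding E_def using exponent_tangent[OF \<alpha> L] by blast
  interpret LB: product_sigma_finite "\<lambda>_::nat. lborel :: real measure" ..
  have Q[measurable]: "Q \<in> sets (lebesgue_Rn n)"
    unfolding Q_def lebesgue_Rn_def by (intro sets_PiM_I_finite) auto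
  have eQ: "emeasure (lebesgue_Rn n) Q = ennreal (t ^ n)"
    unfolding Q_def lebesgue_Rn_def using t by (subst LB.emeasure_PiM) (auto simp: ennreal_power)
  have sets_\<mu>[measurable_cong]: "sets \<mu> = sets (PiM {..<n} (\<lambda>_. borel))"
    unfolding \<mu>_def by (simp add: sets_lebesgue_Rn)
  have space_\<mu>: "space \<mu> = {..<n} \<rightarrow>\<^sub>E UNIV"
    unfolding \<mu>_def by (simp add: space_lebesgue_Rn)
  interpret m: prob_space \<mu>
    unfolding \<mu>_def using eQ t by (intro prob_space_uniform_measure) auto
  interpret O: prob_space \<Omega> unfolding \<Omega>_def by (intro prob_space_PiM m.prob_space_axioms)
  interpret G: prob_space "awgn n \<sigma>" by (rule prob_space_awgn[OF \<sigma>])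
  interpret OG: pair_sigma_finite \<Omega> "awgn n \<sigma>" ..
  have mu_ball: "emeasure \<mu> {p \<in> space \<mu>. P p}
      \<le> ennreal (sqrt (2 * pi * exp 1 * max 0 (n * \<sigma>\<^sup>2 * h) / n) ^ n / t ^ n)"
    if "\<And>p. P p \<Longrightarrow> (\<Sum>i<n. (p i - c i)\<^sup>2) < n * \<sigma>\<^sup>2 * h"
      and [measurable]: "Measurable.pred \<mu> P" for P c h
  proof -
    have [measurable]: "Measurable.pred (lebesgue_Rn n) P"
      using that(2) unfolding \<mu>_def by simp
    have "emeasure \<mu> {p \<in> space \<mu>. P p} =
       emeasure (lebesgue_Rn n) (Q \<inter> {p \<in> space (lebesgue_Rn n). P p}) / ennreal (t ^ n)"
      unfolding \<mu>_def eQ[symmetric] by (subst emeasure_uniform_measure) auto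
    also have "\<dots> \<le> emeasure (lebesgue_Rn n) {p \<in> space (lebesgue_Rn n). (\<Sum>i<n. (p i - c i)\<^sup>2) < n * \<sigma>\<^sup>2 * h}
        / ennreal (t ^ n)"
      using that(1) by (intro divide_right_mono_ennreal emeasure_mono) auto
    also have "\<dots> \<le> ennreal (sqrt (2 * pi * exp 1 * max 0 (n * \<sigma>\<^sup>2 * h) / n) ^ n) / ennreal (t ^ n)"
      using n by (intro divide_right_mono_ennreal emeasure_ball_le)
    also have "\<dots> = ennreal (sqrt (2 * pi * exp 1 * max 0 (n * \<sigma>\<^sup>2 * h) / n) ^ n / t ^ n)"
      using t by (intro divide_ennreal) auto
    finally show ?thesis .
  qed
  have NV: "real N * (sqrt (2 * pi * exp 1 * max 0 (n * \<sigma>\<^sup>2 * h) / n) ^ n / t ^ n)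
      \<le> sqrt (max 0 h / \<alpha>\<^sup>2) ^ n / 8" for h
  proof -
    let ?V = "sqrt (2 * pi * exp 1 * max 0 (n * \<sigma>\<^sup>2 * h) / n) ^ n"
    have "real N * (?V / t ^ n) \<le> (critical_density n \<sigma> \<alpha> * t ^ n / 8) * (?V / t ^ n)"
      using dens t by (intro mult_right_mono) auto
    also have "\<dots> = critical_density n \<sigma> \<alpha> * ?V / 8" using t by simp
    also have "critical_density n \<sigma> \<alpha> * ?V = sqrt (max 0 h / \<alpha>\<^sup>2) ^ n"
      using critical_density_ball[OF \<sigma> _ n] \<alpha> by simp
    finally show ?thesis .
  qed
  have comp: "(\<lambda>\<omega>. \<omega> j) \<in> measurable \<Omega> \<mu>" if "j < N" for j
    unfolding \<Omega>_def using that by (intro measurable_component_singleton) auto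
  have comp2: "(\<lambda>\<omega>. \<omega> j k) \<in> borel_measurable \<Omega>" if "j < N" "k < n" for j k
  proof (rule measurable_compose[OF comp[OF that(1)]])
    show "(\<lambda>p. p k) \<in> borel_measurable \<mu>"
      unfolding measurable_cong_sets[OF sets_\<mu> refl]
      using that by (intro measurable_component_singleton) auto
  qed
  define rel where "rel g x p \<longleftrightarrow> (\<Sum>k<n. (p k - x k - g k)\<^sup>2) < (\<Sum>k<n. (g k)\<^sup>2) \<and> q \<le> (\<Sum>k<n. (p k - x k)\<^sup>2)"
    for g x p :: "nat \<Rightarrow> real"
  define near where "near \<omega> i j \<longleftrightarrow> (\<Sum>k<n. (\<omega> j k - \<omega> i k)\<^sup>2) < q"
    for \<omega> :: "nat \<Rightarrow> nat \<Rightarrow> real" and i j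
  \<comment> \<open>Competing lists are indexed by sets of positions in the random code.\<close>
  define \<J> where "\<J> i = {J. J \<subseteq> {..<N} - {i} \<and> card J = L - 1}" for i
  have fin_J: "finite (\<J> i)" for i unfolding \<J>_def by (rule finite_subset[of _ "Pow {..<N}"]) auto
  have card_J: "card (\<J> i) \<le> N ^ (L - 1)" if "i < N" for i
  proof -
    have "card (\<J> i) = (N - 1) choose (L - 1)"
      unfolding \<J>_def using that by (subst n_subsets) auto
    also have "\<dots> \<le> (N - 1) ^ (L - 1)"
      by (cases "L - 1 \<le> N - 1") (auto intro: binomial_le_pow simp: binomial_eq_0)
    also have "\<dots> \<le> N ^ (L - 1)" by (intro power_mono) auto
    finally show ?thesis .
  qed
  define W where "W i = {(\<omega>, g). \<exists>J\<in>\<J> i. \<forall>j\<in>J. rel g (\<omega> i) (\<omega> j)}" for i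
  define W' where "W' i = W i \<inter> space (\<Omega> \<Otimes>\<^sub>M awgn n \<sigma>)" for i
  have W'[measurable]: "W' i \<in> sets (\<Omega> \<Otimes>\<^sub>M awgn n \<sigma>)" if i: "i < N" for i
  proof -
    have [measurable]: "Measurable.pred (\<Omega> \<Otimes>\<^sub>M awgn n \<sigma>) (\<lambda>x. rel (snd x) (fst x i) (fst x j))"
      if j: "j < N" for j
    proof -
      have [measurable]: "(\<lambda>x. fst x j k) \<in> borel_measurable (\<Omega> \<Otimes>\<^sub>M awgn n \<sigma>)" if "k \<in> {..<n}" for k
        using comp2[OF j] that by (auto intro: measurable_compose[OF measurable_fst])
      have [measurable]: "(\<lambda>x. fst x i k) \<in> borel_measurable (\<Omega> \<Otimes>\<^sub>M awgn n \<sigma>)" if "k \<in> {..<n}" for k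
        using comp2[OF i] that by (auto intro: measurable_compose[OF measurable_fst])
      show ?thesis unfolding rel_def by measurable
    qed
    have "W' i = {x \<in> space (\<Omega> \<Otimes>\<^sub>M awgn n \<sigma>). \<exists>J\<in>\<J> i. \<forall>j\<in>J. rel (snd x) (fst x i) (fst x j)}"
      unfolding W'_def W_def by (intro set_eqI) (simp add: case_prod_beta conj_commute)
    also have "\<dots> \<in> sets (\<Omega> \<Otimes>\<^sub>M awgn n \<sigma>)"
    proof (intro sets.sets_Collect_finite_Ex fin_J sets.sets_Collect_finite_All)
      fix J j assume "J \<in> \<J> i" "j \<in> J"
      then have "j < N" unfolding \<J>_def by auto
      then show "{x \<in> space (\<Omega> \<Otimes>\<^sub>M awgn n \<sigma>). rel (snd x) (fst x i) (fst x j)} \<in> sets (\<Omega> \<Otimes>\<^sub>M awgn n \<sigma>)"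
        by measurable
    qed (use L in \<open>auto simp: \<J>_def intro: finite_subset\<close>)
    finally show ?thesis .
  qed
  define err where "err i \<omega> = emeasure (awgn n \<sigma>) (Pair \<omega> -` W' i)" for i \<omega>
  define Out where "Out i = {\<omega> \<in> space \<Omega>. \<omega> i \<notin> Q}" for i
  define Near where "Near i = {\<omega> \<in> space \<Omega>. \<exists>j\<in>{..<N} - {i}. near \<omega> i j}" for i
  have err_meas[measurable]: "err i \<in> borel_measurable \<Omega>" if "i < N" for i
    unfolding err_def by (intro G.measurable_emeasure_Pair W' that)
  have Out: "Out i \<in> sets \<Omega>" "emeasure \<Omega> (Out i) = 0" if i: "i < N" for i
  proof -
    note comp[OF i, measurable]
    have Qm[measurable]: "Q \<in> sets \<mu>" unfolding \<mu>_def by simp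
    show "Out i \<in> sets \<Omega>" unfolding Out_def by measurable
    have "emeasure \<Omega> (Out i) = emeasure (distr \<Omega> \<mu> (\<lambda>\<omega>. \<omega> i)) (space \<mu> - Q)"
      by (subst emeasure_distr) (auto simp: Out_def measurable_space[OF comp[OF i]] intro!: arg_cong[where f="emeasure \<Omega>"])
    also have "distr \<Omega> \<mu> (\<lambda>\<omega>. \<omega> i) = \<mu>"
      unfolding \<Omega>_def using i by (intro distr_PiM_component m.prob_space_axioms) auto
    also have "emeasure \<mu> (space \<mu> - Q) = 0"
      unfolding \<mu>_def by (subst emeasure_uniform_measure) (auto)
    finally show "emeasure \<Omega> (Out i) = 0" .
  qed
  have Near: "Near i \<in> sets \<Omega>" "emeasure \<Omega> (Near i) \<le> ennreal (1/8)" if i: "i < N" for i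
  proof -
    define S where "S = {z \<in> space (\<mu> \<Otimes>\<^sub>M \<mu>). (\<Sum>k<n. (snd z k - fst z k)\<^sup>2) < q}"
    have [measurable]: "S \<in> sets (\<mu> \<Otimes>\<^sub>M \<mu>)" unfolding S_def by measurable
    define v where "v = sqrt (2 * pi * exp 1 * max 0 (n * \<sigma>\<^sup>2 * \<alpha>\<^sup>2) / n) ^ n / t ^ n"
    have vS: "emeasure \<mu> {p \<in> space \<mu>. (x, p) \<in> S} \<le> ennreal v" if "x \<in> space \<mu>" for x
      unfolding v_def using that
      by (intro mu_ball[of _ x]) (auto simp: S_def q_def)
    define A where "A j = {\<omega> \<in> space \<Omega>. \<forall>j\<in>{j}. (\<omega> i, \<omega> j) \<in> S}" for j
    have A: "A j \<in> sets \<Omega>" "emeasure \<Omega> (A j) \<le> ennreal v" if j: "j \<in> {..<N} - {i}" for j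
    proof -
      have [measurable]: "(\<lambda>\<omega>. \<omega> i) \<in> measurable \<Omega> \<mu>" "(\<lambda>\<omega>. \<omega> j) \<in> measurable \<Omega> \<mu>"
        using comp i j by auto
      have "{\<omega> \<in> space \<Omega>. (\<omega> i, \<omega> j) \<in> S} \<in> sets \<Omega>" by measurable
      then show "A j \<in> sets \<Omega>" unfolding A_def by simp
      show "emeasure \<Omega> (A j) \<le> ennreal v"
        using emeasure_PiM_all_related_le[OF m.prob_space_axioms, of "{..<N}" i "{j}" S "ennreal v"] i j vS
        unfolding A_def \<Omega>_def by simp
    qed
    have eq: "Near i = (\<Union>j\<in>{..<N} - {i}. A j)"
      unfolding Near_def A_def S_def near_def using i
      by (auto simp: space_pair_measure intro: measurable_space[OF comp])
    show "Near i \<in> sets \<Omega>" unfolding eq using A by (intro sets.finite_UN) auto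
    have "emeasure \<Omega> (Near i) \<le> (\<Sum>j\<in>{..<N} - {i}. emeasure \<Omega> (A j))"
      unfolding eq using A by (intro emeasure_subadditive_finite) auto
    also have "\<dots> \<le> (\<Sum>j\<in>{..<N} - {i}. ennreal v)" using A by (intro sum_mono) auto
    also have "\<dots> = of_nat (N - 1) * ennreal v" using i by simp
    also have "\<dots> \<le> of_nat N * ennreal v" by (intro mult_right_mono) auto
    also have "\<dots> = ennreal (real N * v)" by (simp add: ennreal_mult' ennreal_of_nat_eq_real_of_nat)
    also have "real N * v \<le> 1/8" using NV[of "\<alpha>\<^sup>2"] \<alpha> by (simp add: v_def)
    finally show "emeasure \<Omega> (Near i) \<le> ennreal (1/8)" by (simp add: ennreal_leI)
  qed
  have err_int: "(\<integral>\<^sup>+\<omega>. err i \<omega> \<partial>\<Omega>) \<le> ennreal (exp (- n * E))" if i: "i < N" for i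
  proof -
    have "(\<integral>\<^sup>+\<omega>. err i \<omega> \<partial>\<Omega>) = emeasure (\<Omega> \<Otimes>\<^sub>M awgn n \<sigma>) (W' i)"
      unfolding err_def using W'[OF i] by (simp add: G.emeasure_pair_measure_alt)
    also have "\<dots> = (\<integral>\<^sup>+g. emeasure \<Omega> ((\<lambda>\<omega>. (\<omega>, g)) -` W' i) \<partial>awgn n \<sigma>)"
      using W'[OF i] by (rule OG.emeasure_pair_measure_alt2)
    also have "\<dots> \<le> (\<integral>\<^sup>+g. ennreal (exp (n * b)) * ennreal (exp (lam * (\<Sum>k<n. (g k)\<^sup>2) / \<sigma>\<^sup>2)) \<partial>awgn n \<sigma>)"
    proof (rule nn_integral_mono)
      fix g assume g: "g \<in> space (awgn n \<sigma>)"
      define T where "T = (\<Sum>k<n. (g k)\<^sup>2) / (n * \<sigma>\<^sup>2)"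
      have T0: "T \<ge> 0" unfolding T_def by (intro divide_nonneg_nonneg sum_nonneg) auto
      define h where "h = lens_sq \<alpha> T"
      define S where "S = {z \<in> space (\<mu> \<Otimes>\<^sub>M \<mu>). rel g (fst z) (snd z)}"
      have [measurable]: "S \<in> sets (\<mu> \<Otimes>\<^sub>M \<mu>)" unfolding S_def rel_def by measurable
      define v where "v = sqrt (2 * pi * exp 1 * max 0 (n * \<sigma>\<^sup>2 * h) / n) ^ n / t ^ n"
      have v0: "v \<ge> 0" unfolding v_def using t by simp
      have vS: "emeasure \<mu> {p \<in> space \<mu>. (x, p) \<in> S} \<le> ennreal v" if x: "x \<in> space \<mu>" for x
        unfolding v_def
      proof (rule mu_ball[of _ "\<lambda>k. x k + max 1 (\<alpha>\<^sup>2 / (2 * T)) * g k"])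
        show "Measurable.pred \<mu> (\<lambda>p. (x, p) \<in> S)" using x by measurable
        fix p assume "(x, p) \<in> S"
        then have "rel g x p" by (simp add: S_def)
        then show "(\<Sum>k<n. (p k - (x k + max 1 (\<alpha>\<^sup>2 / (2 * T)) * g k))\<^sup>2) < n * \<sigma>\<^sup>2 * h"
          using list_region_in_ball[OF n \<sigma>, of \<alpha> "\<lambda>k. p k - x k" g] \<alpha>
          unfolding rel_def h_def T_def q_def by (simp add: diff_diff_eq)
      qed
      define A where "A J = {\<omega> \<in> space \<Omega>. \<forall>j\<in>J. (\<omega> i, \<omega> j) \<in> S}" for J
      have A: "A J \<in> sets \<Omega>" "emeasure \<Omega> (A J) \<le> ennreal (v ^ (L - 1))" if J: "J \<in> \<J> i" for J
      proof -
        have J': "J \<subseteq> {..<N} - {i}" "card J = L - 1" "finite J"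
          using J by (auto simp: \<J>_def intro: finite_subset)
        show "A J \<in> sets \<Omega>" unfolding A_def
        proof (rule sets.sets_Collect_finite_All[OF _ J'(3)])
          fix j assume "j \<in> J"
          then have [measurable]: "(\<lambda>\<omega>. \<omega> i) \<in> measurable \<Omega> \<mu>" "(\<lambda>\<omega>. \<omega> j) \<in> measurable \<Omega> \<mu>"
            using comp i J' by auto
          show "{\<omega> \<in> space \<Omega>. (\<omega> i, \<omega> j) \<in> S} \<in> sets \<Omega>" by measurable
        qed
        show "emeasure \<Omega> (A J) \<le> ennreal (v ^ (L - 1))"
          using emeasure_PiM_all_related_le[OF m.prob_space_axioms, of "{..<N}" i J S "ennreal v"] i J' vS v0
          unfolding A_def \<Omega>_def by (simp add: ennreal_power)
      qed
      have eq: "(\<lambda>\<omega>. (\<omega>, g)) -` W' i = (\<Union>J\<in>\<J> i. A J)"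
      proof -
        have "(\<omega> i, \<omega> j) \<in> S \<longleftrightarrow> rel g (\<omega> i) (\<omega> j)" if "\<omega> \<in> space \<Omega>" "j \<in> J" "J \<in> \<J> i" for \<omega> J j
          using that i comp[THEN measurable_space] unfolding S_def \<J>_def by (auto simp: space_pair_measure)
        then show ?thesis using g unfolding W'_def W_def A_def
          by (auto simp: space_pair_measure) blast+
      qed
      have "emeasure \<Omega> ((\<lambda>\<omega>. (\<omega>, g)) -` W' i) \<le> (\<Sum>J\<in>\<J> i. emeasure \<Omega> (A J))"
        unfolding eq using A fin_J by (intro emeasure_subadditive_finite) auto
      also have "\<dots> \<le> (\<Sum>J\<in>\<J> i. ennreal (v ^ (L - 1)))" using A by (intro sum_mono) auto
      also have "\<dots> = of_nat (card (\<J> i)) * ennreal (v ^ (L - 1))" by simp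
      also have "\<dots> \<le> of_nat (N ^ (L - 1)) * ennreal (v ^ (L - 1))"
        by (intro mult_right_mono of_nat_mono card_J[OF i]) simp
      also have "\<dots> = ennreal ((real N * v) ^ (L - 1))"
        using v0 by (simp add: power_mult_distrib ennreal_mult' ennreal_of_nat_eq_real_of_nat)
      finally have le1: "emeasure \<Omega> ((\<lambda>\<omega>. (\<omega>, g)) -` W' i) \<le> ennreal ((real N * v) ^ (L - 1))" .
      have le2: "emeasure \<Omega> ((\<lambda>\<omega>. (\<omega>, g)) -` W' i) \<le> 1" by (rule O.emeasure_le_1)
      have Tn: "n * (lam * T + b) = n * b + lam * (\<Sum>k<n. (g k)\<^sup>2) / \<sigma>\<^sup>2"
        unfolding T_def using n \<sigma> by (simp add: field_simps)
      have "emeasure \<Omega> ((\<lambda>\<omega>. (\<omega>, g)) -` W' i) \<le> ennreal (exp (n * (lam * T + b)))"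
      proof (cases "T > 0 \<and> h > 0")
        case False
        have "real N * v = 0 \<or> T = 0"
        proof (cases "T = 0")
          case neq: False
          then have "h \<le> 0" using False T0 by auto
          then have "n * \<sigma>\<^sup>2 * h \<le> 0" by (intro mult_nonneg_nonpos) auto
          then have "max 0 (n * \<sigma>\<^sup>2 * h) = 0" by simp
          then show ?thesis unfolding v_def using n by simp
        qed simp
        then show ?thesis
        proof
          assume z: "real N * v = 0"
          have "ennreal ((real N * v) ^ (L - 1)) = 0" unfolding z using L by (simp add: power_0_left)
          then show ?thesis using le1 by simp
        next
          assume "T = 0"
          then have z: "(\<Sum>k<n. (g k)\<^sup>2) = 0" using n \<sigma> unfolding T_def by simp
          then have "\<not> rel g x p" for x p
            unfolding rel_def by (smt (verit) sum_nonneg zero_le_power2)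
          moreover have "J \<noteq> {}" if "J \<in> \<J> i" for J using that L unfolding \<J>_def by auto
          ultimately have "(\<lambda>\<omega>. (\<omega>, g)) -` W' i = {}" unfolding W'_def W_def by auto
          then show ?thesis by simp
        qed
      next
        case True
        define z where "z = sqrt (h / \<alpha>\<^sup>2)"
        have z: "z > 0" using True \<alpha> unfolding z_def by simp
        have "real N * v \<le> z ^ n / 8" using NV[of h] True unfolding v_def z_def by simp
        moreover have "z ^ n \<ge> 0" using z by simp
        ultimately have "real N * v \<le> z ^ n" by linarith
        then have "(real N * v) ^ (L - 1) \<le> (z ^ n) ^ (L - 1)" using v0 by (intro power_mono) auto
        also have "\<dots> = exp (n * ((real L - 1) / 2 * ln (h / \<alpha>\<^sup>2)))"
        proof -
          have "z = exp (ln (h / \<alpha>\<^sup>2) / 2)"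
            using True \<alpha> z unfolding z_def by (simp add: ln_sqrt[symmetric])
          then show ?thesis using L
            by (simp add: power_mult[symmetric] exp_of_nat_mult[symmetric] of_nat_diff mult_ac)
        qed
        finally have le3: "emeasure \<Omega> ((\<lambda>\<omega>. (\<omega>, g)) -` W' i) \<le> ennreal (exp (n * ((real L - 1) / 2 * ln (h / \<alpha>\<^sup>2))))"
          using le1 by (meson ennreal_leI order.trans)
        from tang[of T] True consider "0 \<le> lam * T + b" | "(real L - 1) / 2 * ln (h / \<alpha>\<^sup>2) \<le> lam * T + b"
          unfolding h_def by blast
        then show ?thesis
        proof cases
          case 1
          then have "1 \<le> exp (n * (lam * T + b))" by simp
          then have "1 \<le> ennreal (exp (n * (lam * T + b)))" by (metis ennreal_1 ennreal_leI)
          then show ?thesis using le2 by (rule order.trans[rotated])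
        next
          case 2
          then have "exp (n * ((real L - 1) / 2 * ln (h / \<alpha>\<^sup>2))) \<le> exp (n * (lam * T + b))"
            unfolding exp_le_cancel_iff by (rule mult_left_mono) simp
          then show ?thesis using le3 by (meson ennreal_leI order.trans)
        qed
      qed
      then show "emeasure \<Omega> ((\<lambda>\<omega>. (\<omega>, g)) -` W' i)
          \<le> ennreal (exp (n * b)) * ennreal (exp (lam * (\<Sum>k<n. (g k)\<^sup>2) / \<sigma>\<^sup>2))"
        unfolding Tn exp_add by (simp add: ennreal_mult)
    qed
    also have "\<dots> = ennreal (exp (n * b)) * (\<integral>\<^sup>+g. ennreal (exp (lam * (\<Sum>k<n. (g k)\<^sup>2) / \<sigma>\<^sup>2)) \<partial>awgn n \<sigma>)"
      by (intro nn_integral_cmult) measurable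
    also have "\<dots> = ennreal (exp (n * b) * (1 / sqrt (1 - 2 * lam)) ^ n)"
      using lam by (subst awgn_exponential_moment[OF \<sigma>]) (auto simp: ennreal_mult)
    also have "exp (n * b) * (1 / sqrt (1 - 2 * lam)) ^ n = exp (- n * E)"
    proof -
      have "sqrt (1 - 2 * lam) = exp (ln (1 - 2 * lam) / 2)"
        using lam by (subst ln_sqrt[symmetric]) auto
      then have "1 / sqrt (1 - 2 * lam) = exp (- (ln (1 - 2 * lam) / 2))"
        by (simp add: exp_minus inverse_eq_divide)
      then have "exp (n * b) * (1 / sqrt (1 - 2 * lam)) ^ n = exp (n * (b - 1/2 * ln (1 - 2 * lam)))"
        by (simp add: exp_of_nat_mult[symmetric] exp_add[symmetric] algebra_simps)
      then show ?thesis unfolding bE by simp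
    qed
    finally show ?thesis .
  qed
  \<comment> \<open>The factor makes an error probability of \<open>8 * exp (- n * E)\<close> cost exactly \<open>1\<close>.\<close>
  define cost where "cost i \<omega> = indicator (Out i) \<omega> + indicator (Near i) \<omega> + ennreal (exp (n * E) / 8) * err i \<omega>"
    for i \<omega>
  have cost_meas: "cost i \<in> borel_measurable \<Omega>" if "i < N" for i
    unfolding cost_def using Out[OF that] Near[OF that] err_meas[OF that] by measurable
  have cost_int: "(\<integral>\<^sup>+\<omega>. cost i \<omega> \<partial>\<Omega>) \<le> ennreal (1/4)" if i: "i < N" for i
  proof -
    note Out(1)[OF i, measurable] Near(1)[OF i, measurable] err_meas[OF i, measurable]
    have "(\<integral>\<^sup>+\<omega>. cost i \<omega> \<partial>\<Omega>) = emeasure \<Omega> (Out i) + emeasure \<Omega> (Near i) + ennreal (exp (n * E) / 8) * (\<integral>\<^sup>+\<omega>. err i \<omega> \<partial>\<Omega>)"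
      unfolding cost_def by (simp add: nn_integral_add nn_integral_cmult)
    also have "\<dots> \<le> 0 + ennreal (1/8) + ennreal (exp (n * E) / 8) * ennreal (exp (- n * E))"
      using Out[OF i] Near[OF i] err_int[OF i] by (intro add_mono mult_left_mono) auto
    also have "\<dots> = ennreal (1/8) + ennreal (1/8)"
      by (simp add: ennreal_mult'[symmetric] exp_minus)
    also have "\<dots> = ennreal (1/4)" by (subst ennreal_plus[symmetric]) auto
    finally show ?thesis .
  qed
  have "\<exists>\<omega>\<in>space \<Omega>. (\<Sum>i<N. cost i \<omega>) \<le> ennreal (real N / 2)"
  proof (rule ccontr)
    assume neg: "\<not> (\<exists>\<omega>\<in>space \<Omega>. (\<Sum>i<N. cost i \<omega>) \<le> ennreal (real N / 2))"
    then have gt: "ennreal (real N / 2) \<le> (\<Sum>i<N. cost i \<omega>)" if "\<omega> \<in> space \<Omega>" for \<omega>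
      using that linorder_linear by blast
    have "ennreal (real N / 2) = (\<integral>\<^sup>+\<omega>. ennreal (real N / 2) \<partial>\<Omega>)" by (simp add: O.emeasure_space_1)
    also have "\<dots> \<le> (\<integral>\<^sup>+\<omega>. (\<Sum>i<N. cost i \<omega>) \<partial>\<Omega>)" using gt by (intro nn_integral_mono)
    also have "\<dots> = (\<Sum>i<N. \<integral>\<^sup>+\<omega>. cost i \<omega> \<partial>\<Omega>)" using cost_meas by (intro nn_integral_sum) auto
    also have "\<dots> \<le> (\<Sum>i<N. ennreal (1/4))" using cost_int by (intro sum_mono) auto
    also have "\<dots> = ennreal (real N * (1/4))"
      by (simp add: ennreal_mult''[symmetric] ennreal_of_nat_eq_real_of_nat)
    finally show False using N by (subst (asm) ennreal_le_iff) auto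
  qed
  then obtain \<omega> where \<omega>: "\<omega> \<in> space \<Omega>" "(\<Sum>i<N. cost i \<omega>) \<le> ennreal (real N / 2)"
    by blast
  define Good where "Good = {i. i < N \<and> cost i \<omega> < 1}"
  define X where "X = \<omega> ` Good"
  have finG: "finite Good" unfolding Good_def by simp
  have in_Q: "\<omega> i \<in> Q" and far: "\<And>j. j < N \<Longrightarrow> j \<noteq> i \<Longrightarrow> \<not> near \<omega> i j"
    and err_le: "err i \<omega> \<le> ennreal (8 * exp (- n * E))" if "i \<in> Good" for i
  proof -
    have c: "cost i \<omega> < 1" "i < N" using that by (auto simp: Good_def)
    have "indicator (Out i) \<omega> \<le> cost i \<omega>" "indicator (Near i) \<omega> \<le> cost i \<omega>"
      and e: "ennreal (exp (n * E) / 8) * err i \<omega> \<le> cost i \<omega>"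
      unfolding cost_def by (auto simp: add_increasing add_increasing2)
    then have "\<omega> \<notin> Out i" "\<omega> \<notin> Near i" using c by (auto simp: indicator_def split: if_splits)
    then show "\<omega> i \<in> Q" "\<And>j. j < N \<Longrightarrow> j \<noteq> i \<Longrightarrow> \<not> near \<omega> i j"
      using \<omega>(1) by (auto simp: Out_def Near_def)
    have "err i \<omega> = ennreal (8 * exp (- n * E)) * (ennreal (exp (n * E) / 8) * err i \<omega>)"
      by (simp add: mult.assoc[symmetric] ennreal_mult'[symmetric] exp_minus)
    also have "\<dots> \<le> ennreal (8 * exp (- n * E)) * 1"
      using e c by (intro mult_left_mono) auto
    finally show "err i \<omega> \<le> ennreal (8 * exp (- n * E))" by simp
  qed
  have q0: "q > 0" unfolding q_def using n \<sigma> \<alpha> by simp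
  have inj: "inj_on \<omega> Good"
  proof (rule inj_onI, rule ccontr)
    fix i j assume ij: "i \<in> Good" "j \<in> Good" "\<omega> i = \<omega> j" "i \<noteq> j"
    then have "\<not> near \<omega> i j" using far[OF ij(1), of j] by (auto simp: Good_def)
    then show False using ij(3) q0 unfolding near_def by simp
  qed
  have cardX: "real (card X) \<ge> real N / 2"
  proof -
    let ?B = "{..<N} - Good"
    have "ennreal (real (card ?B)) = (\<Sum>i\<in>?B. 1)" by (simp add: ennreal_of_nat_eq_real_of_nat)
    also have "\<dots> \<le> (\<Sum>i\<in>?B. cost i \<omega>)" by (intro sum_mono) (auto simp: Good_def not_less)
    also have "\<dots> \<le> (\<Sum>i<N. cost i \<omega>)" by (intro sum_mono2) auto
    also have "\<dots> \<le> ennreal (real N / 2)" by (rule \<omega>(2))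
    finally have "real (card ?B) \<le> real N / 2" by (subst (asm) ennreal_le_iff) auto
    moreover have "card ?B = N - card Good"
      using finG by (subst card_Diff_subset) (auto simp: Good_def)
    moreover have "card Good \<le> N" using card_mono[of "{..<N}" Good] by (auto simp: Good_def)
    ultimately show ?thesis unfolding X_def card_image[OF inj] by (simp add: of_nat_diff)
  qed
  have errX: "list_error n \<sigma> (L - 1) X x \<le> 8 * exp (- n * E)" if x: "x \<in> X" for x
  proof -
    obtain i where i: "i \<in> Good" "x = \<omega> i" using x unfolding X_def by auto
    have iN: "i < N" using i by (simp add: Good_def)
    let ?S = "{g \<in> space (awgn n \<sigma>). \<exists>xs. length xs = L - 1 \<and> distinct xs \<and> set xs \<subseteq> X - {x} \<and>
          (\<forall>y\<in>set xs. L2_set (\<lambda>i. y i - (x i + g i)) {..<n} < L2_set g {..<n})}"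
    have "?S \<subseteq> Pair \<omega> -` W' i"
    proof
      fix g assume "g \<in> ?S"
      then obtain xs where g: "g \<in> space (awgn n \<sigma>)" and xs: "length xs = L - 1" "distinct xs" "set xs \<subseteq> X - {x}"
        "\<And>y. y \<in> set xs \<Longrightarrow> L2_set (\<lambda>i. y i - (x i + g i)) {..<n} < L2_set g {..<n}" by blast
      define J where "J = {j \<in> Good. \<omega> j \<in> set xs}"
      have "\<omega> ` J = set xs" using xs(3) unfolding J_def X_def by auto
      moreover have "inj_on \<omega> J" using inj by (rule inj_on_subset) (auto simp: J_def)
      ultimately have "card J = L - 1" using xs(1,2) by (metis card_image distinct_card)
      moreover have "i \<notin> J" using xs(3) i by (auto simp: J_def)
      ultimately have JJ: "J \<in> \<J> i" unfolding \<J>_def J_def Good_def by auto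
      have "rel g (\<omega> i) (\<omega> j)" if j: "j \<in> J" for j
      proof -
        have "\<omega> j \<in> set xs" "j < N" "j \<noteq> i" using j \<open>i \<notin> J\<close> by (auto simp: J_def Good_def)
        then have "\<not> near \<omega> i j" using far[OF i(1)] by auto
        moreover have "(\<Sum>k<n. (\<omega> j k - \<omega> i k - g k)\<^sup>2) < (\<Sum>k<n. (g k)\<^sup>2)"
          using xs(4)[OF \<open>\<omega> j \<in> set xs\<close>] unfolding L2_set_less_iff i by (simp add: diff_diff_eq)
        ultimately show ?thesis unfolding rel_def near_def by simp
      qed
      then show "g \<in> Pair \<omega> -` W' i"
        unfolding W'_def W_def using JJ g \<omega>(1) by (auto simp: space_pair_measure)
    qed
    then have "emeasure (awgn n \<sigma>) ?S \<le> err i \<omega>"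
      unfolding err_def using W'[OF iN] by (intro emeasure_mono sets_Pair1) auto
    also have "\<dots> \<le> ennreal (8 * exp (- n * E))" by (rule err_le[OF i(1)])
    finally show ?thesis unfolding list_error_def G.emeasure_eq_measure by simp
  qed
  have "card X \<le> N"
    unfolding X_def card_image[OF inj] using card_mono[of "{..<N}" Good] by (auto simp: Good_def)
  then show ?thesis
    using that[of X] finG in_Q cardX errX unfolding X_def Q_def E_def by auto
qed

section \<open>Lattice points in dilates of the reference body\<close>

lemma lebesgue_Rn_affine:
  fixes a :: real and b :: "nat \<Rightarrow> real"
  assumes a: "a > 0" and A: "A \<in> sets (lebesgue_Rn n)"
  shows "ennreal (a ^ n) * emeasure (lebesgue_Rn n) {x \<in> space (lebesgue_Rn n). (\<lambda>i\<in>{..<n}. b i + a * x i) \<in> A}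
     = emeasure (lebesgue_Rn n) A"
proof -
  interpret P: product_sigma_finite "\<lambda>_::nat. lborel :: real measure" ..
  let ?M = "PiM {..<n} (\<lambda>_. lborel :: real measure)"
  let ?T = "\<lambda>x. \<lambda>i\<in>{..<n}. b i + a * x i"
  have T[measurable]: "?T \<in> measurable ?M ?M" by measurable
  define D where "D = density (distr ?M ?M ?T) (\<lambda>_. ennreal (a ^ n))"
  have D: "emeasure D A = ennreal (a ^ n) * emeasure ?M {x \<in> space ?M. ?T x \<in> A}" if "A \<in> sets ?M" for A
    using that unfolding D_def
    by (subst emeasure_density_const) (auto simp: emeasure_distr intro!: arg_cong2[where f="(*)"] arg_cong[where f="emeasure ?M"])
  have "D = ?M"
  proof (rule P.PiM_eqI)
    show "sets D = sets ?M" by (simp add: D_def)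
    fix X :: "nat \<Rightarrow> real set" assume X: "\<And>i. i \<in> {..<n} \<Longrightarrow> X i \<in> sets lborel"
    have one: "ennreal a * emeasure lborel {x. b i + a * x \<in> X i} = emeasure lborel (X i)" if "i < n" for i
    proof -
      have Xi: "X i \<in> sets borel" using X that by simp
      have "emeasure lborel (X i) = emeasure (density (distr lborel borel (\<lambda>x. b i + a * x)) (\<lambda>_. ennreal \<bar>a\<bar>)) (X i)"
        using lborel_real_affine[of a "b i"] a by simp
      also have "\<dots> = ennreal a * emeasure lborel ((\<lambda>x. b i + a * x) -` X i)"
        using a Xi by (subst emeasure_density_const) (auto simp: emeasure_distr)
      finally show ?thesis by (simp add: vimage_def)
    qed
    have "emeasure D (PiE {..<n} X) = ennreal (a ^ n) * emeasure ?M {x \<in> space ?M. ?T x \<in> PiE {..<n} X}"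
      using X by (intro D sets_PiM_I_finite) auto
    also have "{x \<in> space ?M. ?T x \<in> PiE {..<n} X} = PiE {..<n} (\<lambda>i. {x. b i + a * x \<in> X i})"
      by (intro set_eqI) (simp add: space_PiM PiE_iff conj_commute cong: conj_cong)
    also have "emeasure ?M \<dots> = (\<Prod>i<n. emeasure lborel {x. b i + a * x \<in> X i})"
    proof (rule P.emeasure_PiM)
      fix i assume "i \<in> {..<n}"
      then have "X i \<in> sets borel" using X by simp
      then have "(\<lambda>x. b i + a * x) -` X i \<inter> space borel \<in> sets borel"
        by (rule measurable_sets[rotated]) simp
      then show "{x. b i + a * x \<in> X i} \<in> sets lborel" by (simp add: vimage_def)
    qed simp
    also have "ennreal (a ^ n) = (\<Prod>i<n. ennreal a)" using a by (simp add: ennreal_power)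
    also have "(\<Prod>i<n. ennreal a) * (\<Prod>i<n. emeasure lborel {x. b i + a * x \<in> X i})
       = (\<Prod>i<n. emeasure lborel (X i))"
      unfolding prod.distrib[symmetric] using one by (intro prod.cong) auto
    finally show "emeasure D (PiE {..<n} X) = (\<Prod>i<n. emeasure lborel (X i))" .
  qed simp
  then show ?thesis using D[of A] A unfolding lebesgue_Rn_def by simp
qed

definition lattice_pt :: "nat \<Rightarrow> real \<Rightarrow> (nat \<Rightarrow> real) \<Rightarrow> (nat \<Rightarrow> int) \<Rightarrow> nat \<Rightarrow> real" where
  "lattice_pt n s v z = (\<lambda>i\<in>{..<n}. v i + s * real_of_int (z i))"

abbreviation int_vectors :: "nat \<Rightarrow> (nat \<Rightarrow> int) set" where
  "int_vectors n \<equiv> {..<n} \<rightarrow>\<^sub>E UNIV"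

definition lattice_hits :: "nat \<Rightarrow> real \<Rightarrow> (nat \<Rightarrow> real) set \<Rightarrow> (nat \<Rightarrow> real) \<Rightarrow> (nat \<Rightarrow> int) set" where
  "lattice_hits n s A v = {z \<in> int_vectors n. lattice_pt n s v z \<in> A}"

definition half_open_cube :: "nat \<Rightarrow> real \<Rightarrow> (nat \<Rightarrow> real) set" where
  "half_open_cube n s = ({..<n} \<rightarrow>\<^sub>E {0..<s})"

lemma countable_int_vectors: "countable (int_vectors n)"
  by (intro countable_PiE) auto

lemma half_open_cube_sets [measurable]: "half_open_cube n s \<in> sets (lebesgue_Rn n)"
  unfolding half_open_cube_def lebesgue_Rn_def by (intro sets_PiM_I_finite) auto

lemma emeasure_half_open_cube:
  assumes "s > 0" shows "emeasure (lebesgue_Rn n) (half_open_cube n s) = ennreal (s ^ n)"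
proof -
  interpret P: product_sigma_finite "\<lambda>_::nat. lborel :: real measure" ..
  show ?thesis unfolding half_open_cube_def lebesgue_Rn_def
    using assms by (subst P.emeasure_PiM) (auto simp: ennreal_power)
qed

lemma lattice_pt_in_space: "lattice_pt n s v z \<in> space (lebesgue_Rn n)"
  by (simp add: lattice_pt_def space_lebesgue_Rn)

lemma lattice_pt_measurable [measurable]:
  "(\<lambda>u. lattice_pt n s (\<lambda>i. v i + u i) z) \<in> measurable (lebesgue_Rn n) (lebesgue_Rn n)"
proof -
  have "(\<lambda>u. lattice_pt n s (\<lambda>i. v i + u i) z) \<in> measurable (PiM {..<n} (\<lambda>_. borel)) (PiM {..<n} (\<lambda>_. borel))"
    unfolding lattice_pt_def by measurable
  then show ?thesis by (simp add: measurable_cong_sets[OF sets_lebesgue_Rn sets_lebesgue_Rn])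
qed

lemma lattice_hits_measurable:
  assumes [measurable]: "A \<in> sets (lebesgue_Rn n)"
  shows "(\<lambda>u. \<integral>\<^sup>+z. indicator A (lattice_pt n s (\<lambda>i. v i + u i) z) \<partial>count_space (int_vectors n)) \<in> borel_measurable (lebesgue_Rn n)"
proof -
  interpret sigma_finite_measure "count_space (int_vectors n)"
    by (rule sigma_finite_measure_count_space_countable[OF countable_int_vectors])
  have "(\<lambda>(z, u). indicator A (lattice_pt n s (\<lambda>i. v i + u i) z) :: ennreal)
      \<in> borel_measurable (count_space (int_vectors n) \<Otimes>\<^sub>M lebesgue_Rn n)"
    by (rule measurable_pair_measure_countable1[OF countable_int_vectors]) simp
  then have "(\<lambda>(u, z). indicator A (lattice_pt n s (\<lambda>i. v i + u i) z) :: ennreal)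
      \<in> borel_measurable (lebesgue_Rn n \<Otimes>\<^sub>M count_space (int_vectors n))"
    by (subst measurable_pair_swap_iff) (simp add: case_prod_beta)
  then show ?thesis by (rule borel_measurable_nn_integral)
qed

text \<open>
  The translates of the half-open cube by the lattice tile the space. Hence a lattice translated by
  a uniformly random vector of the cube meets \<open>A\<close>, on average, in \<open>emeasure A / s\<^sup>n\<close> points.
\<close>

lemma lattice_averaging:
  fixes s :: real
  assumes s: "s > 0" and A[measurable]: "A \<in> sets (lebesgue_Rn n)"
  shows "(\<integral>\<^sup>+u. (\<integral>\<^sup>+z. indicator A (lattice_pt n s (\<lambda>i. v i + u i) z) \<partial>count_space (int_vectors n))
             * indicator (half_open_cube n s) u \<partial>lebesgue_Rn n) = emeasure (lebesgue_Rn n) A"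
proof -
  let ?Z = "int_vectors n" and ?M = "lebesgue_Rn n" and ?Q = "half_open_cube n s"
  define cell where "cell z = {x \<in> space ?M. \<forall>i<n. 0 \<le> x i - v i - s * real_of_int (z i) \<and> x i - v i - s * real_of_int (z i) < s}" for z
  have cell[measurable]: "cell z \<in> sets ?M" for z unfolding cell_def by measurable
  have fl: "x \<in> cell z \<longleftrightarrow> x \<in> space ?M \<and> (\<forall>i<n. z i = \<lfloor>(x i - v i) / s\<rfloor>)" for x z
  proof -
    have "(0 \<le> x i - v i - s * real_of_int (z i) \<and> x i - v i - s * real_of_int (z i) < s) \<longleftrightarrow> z i = \<lfloor>(x i - v i) / s\<rfloor>" for i
      using s by (simp add: floor_eq_iff eq_commute[of "z i"] field_simps)
    then show ?thesis unfolding cell_def by simp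
  qed
  have "(\<integral>\<^sup>+u. (\<integral>\<^sup>+z. indicator A (lattice_pt n s (\<lambda>i. v i + u i) z) \<partial>count_space ?Z) * indicator ?Q u \<partial>?M)
     = (\<integral>\<^sup>+u. (\<integral>\<^sup>+z. indicator A (lattice_pt n s (\<lambda>i. v i + u i) z) * indicator ?Q u \<partial>count_space ?Z) \<partial>?M)"
    by (intro nn_integral_cong, subst nn_integral_multc) auto
  also have "\<dots> = (\<integral>\<^sup>+z. (\<integral>\<^sup>+u. indicator A (lattice_pt n s (\<lambda>i. v i + u i) z) * indicator ?Q u \<partial>?M) \<partial>count_space ?Z)"
    by (intro nn_integral_count_space_nn_integral countable_int_vectors) measurable
  also have "\<dots> = (\<integral>\<^sup>+z. emeasure ?M (A \<inter> cell z) \<partial>count_space ?Z)"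
  proof (intro nn_integral_cong)
    fix z
    let ?S = "{u \<in> space ?M. (\<lambda>i\<in>{..<n}. (v i + s * real_of_int (z i)) + 1 * u i) \<in> A \<inter> cell z}"
    have eq: "(\<lambda>i\<in>{..<n}. (v i + s * real_of_int (z i)) + 1 * u i) = lattice_pt n s (\<lambda>i. v i + u i) z" for u
      by (auto simp: lattice_pt_def)
    have S: "?S \<in> sets ?M" unfolding eq by measurable
    have "(\<integral>\<^sup>+u. indicator A (lattice_pt n s (\<lambda>i. v i + u i) z) * indicator ?Q u \<partial>?M) = (\<integral>\<^sup>+u. indicator ?S u \<partial>?M)"
    proof (rule nn_integral_cong)
      fix u assume u: "u \<in> space ?M"
      have "u \<in> ?Q \<longleftrightarrow> lattice_pt n s (\<lambda>i. v i + u i) z \<in> cell z"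
        using u lattice_pt_in_space by (auto simp: half_open_cube_def cell_def lattice_pt_def space_lebesgue_Rn PiE_iff)
      then show "indicator A (lattice_pt n s (\<lambda>i. v i + u i) z) * indicator ?Q u = (indicator ?S u :: ennreal)"
        using u by (simp only: eq) (auto simp: indicator_def)
    qed
    also have "\<dots> = emeasure ?M ?S" using S by simp
    also have "\<dots> = emeasure ?M (A \<inter> cell z)"
      using lebesgue_Rn_affine[of 1 "A \<inter> cell z" n "\<lambda>i. v i + s * real_of_int (z i)"] by simp
    finally show "(\<integral>\<^sup>+u. indicator A (lattice_pt n s (\<lambda>i. v i + u i) z) * indicator ?Q u \<partial>?M) = emeasure ?M (A \<inter> cell z)" .
  qed
  also have "\<dots> = emeasure ?M (\<Union>z\<in>?Z. A \<inter> cell z)"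
  proof (rule emeasure_UN_countable[symmetric])
    show "disjoint_family_on (\<lambda>z. A \<inter> cell z) ?Z"
      unfolding disjoint_family_on_def
    proof (intro ballI impI)
      fix z z' assume z: "z \<in> ?Z" "z' \<in> ?Z" "z \<noteq> z'"
      have "z = z'" if "x \<in> cell z" "x \<in> cell z'" for x
        using that z unfolding fl by (intro PiE_ext[of z _ _ z']) auto
      then show "(A \<inter> cell z) \<inter> (A \<inter> cell z') = {}" using z(3) by blast
    qed
  qed (auto simp: countable_int_vectors)
  also have "(\<Union>z\<in>?Z. A \<inter> cell z) = A"
  proof -
    have "x \<in> (\<Union>z\<in>?Z. A \<inter> cell z)" if x: "x \<in> A" for x
    proof -
      have "x \<in> space ?M" using x sets.sets_into_space[OF A] by auto
      then have "x \<in> cell (\<lambda>i\<in>{..<n}. \<lfloor>(x i - v i) / s\<rfloor>)" unfolding fl by simp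
      then show ?thesis using x by (intro UN_I[where a="\<lambda>i\<in>{..<n}. \<lfloor>(x i - v i) / s\<rfloor>"]) auto
    qed
    then show ?thesis by blast
  qed
  finally show ?thesis .
qed

definition coord_bounded :: "nat \<Rightarrow> (nat \<Rightarrow> real) set \<Rightarrow> bool" where
  "coord_bounded n A \<longleftrightarrow> (\<exists>R. \<forall>x\<in>A. \<forall>i<n. \<bar>x i\<bar> \<le> R)"

lemma finite_lattice_hits:
  assumes s: "s > 0" and A: "coord_bounded n A"
  shows "finite (lattice_hits n s A v)"
proof -
  obtain R where R: "\<And>x i. x \<in> A \<Longrightarrow> i < n \<Longrightarrow> \<bar>x i\<bar> \<le> R" using A unfolding coord_bounded_def by blast
  have "lattice_hits n s A v \<subseteq> PiE {..<n} (\<lambda>i. {\<lfloor>(- R - v i) / s\<rfloor>..\<lceil>(R - v i) / s\<rceil>})"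
  proof
    fix z assume z: "z \<in> lattice_hits n s A v"
    have "\<lfloor>(- R - v i) / s\<rfloor> \<le> z i \<and> z i \<le> \<lceil>(R - v i) / s\<rceil>" if i: "i < n" for i
    proof -
      have "\<bar>v i + s * real_of_int (z i)\<bar> \<le> R"
        using R[of "lattice_pt n s v z" i] z i by (simp add: lattice_hits_def lattice_pt_def)
      then have "(- R - v i) / s \<le> real_of_int (z i)" "real_of_int (z i) \<le> (R - v i) / s"
        using s by (auto simp: field_simps abs_le_iff)
      then show ?thesis by linarith
    qed
    then show "z \<in> PiE {..<n} (\<lambda>i. {\<lfloor>(- R - v i) / s\<rfloor>..\<lceil>(R - v i) / s\<rceil>})"
      using z by (auto simp: lattice_hits_def PiE_iff)
  qed
  then show ?thesis by (rule finite_subset) (intro finite_PiE, auto)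
qed

lemma card_lattice_hits:
  assumes "s > 0" "coord_bounded n A"
  shows "ennreal (real (card (lattice_hits n s A v))) = (\<integral>\<^sup>+z. indicator A (lattice_pt n s v z) \<partial>count_space (int_vectors n))"
proof -
  have "(\<integral>\<^sup>+z. indicator A (lattice_pt n s v z) \<partial>count_space (int_vectors n))
     = (\<integral>\<^sup>+z. indicator (lattice_hits n s A v) z \<partial>count_space (int_vectors n))"
    by (intro nn_integral_cong) (auto simp: lattice_hits_def indicator_def)
  also have "\<dots> = emeasure (count_space (int_vectors n)) (lattice_hits n s A v)"
    by (intro nn_integral_indicator) (auto simp: lattice_hits_def)
  also have "\<dots> = of_nat (card (lattice_hits n s A v))"
    using finite_lattice_hits[OF assms] by (intro emeasure_count_space_finite) (auto simp: lattice_hits_def)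
  finally show ?thesis by (simp add: ennreal_of_nat_eq_real_of_nat)
qed

text \<open>
  A bound for every single translate follows from the average for a thickened set: a point of the
  lattice that lies in \<open>A\<close> stays in \<open>A'\<close> under all translations by vectors of the cube.
\<close>

lemma card_lattice_hits_le:
  fixes s :: real
  assumes s: "s > 0" and A: "coord_bounded n A" and A'[measurable]: "A' \<in> sets (lebesgue_Rn n)"
    and thick: "\<And>x y. x \<in> A \<Longrightarrow> y \<in> {..<n} \<rightarrow>\<^sub>E UNIV \<Longrightarrow> (\<And>i. i < n \<Longrightarrow> \<bar>y i - x i\<bar> \<le> s) \<Longrightarrow> y \<in> A'"
  shows "ennreal (real (card (lattice_hits n s A v)) * s ^ n) \<le> emeasure (lebesgue_Rn n) A'"
proof -
  let ?M = "lebesgue_Rn n"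
  have "ennreal (real (card (lattice_hits n s A v)) * s ^ n)
     = (\<integral>\<^sup>+u. ennreal (real (card (lattice_hits n s A v))) * indicator (half_open_cube n s) u \<partial>?M)"
    using s by (subst nn_integral_cmult_indicator) (auto simp: emeasure_half_open_cube ennreal_mult)
  also have "\<dots> \<le> (\<integral>\<^sup>+u. (\<integral>\<^sup>+z. indicator A' (lattice_pt n s (\<lambda>i. v i + u i) z) \<partial>count_space (int_vectors n))
             * indicator (half_open_cube n s) u \<partial>?M)"
  proof (rule nn_integral_mono)
    fix u
    show "ennreal (real (card (lattice_hits n s A v))) * indicator (half_open_cube n s) u
       \<le> (\<integral>\<^sup>+z. indicator A' (lattice_pt n s (\<lambda>i. v i + u i) z) \<partial>count_space (int_vectors n)) * indicator (half_open_cube n s) u"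
    proof (cases "u \<in> half_open_cube n s")
      case True
      have "lattice_pt n s (\<lambda>i. v i + u i) z \<in> A'" if "lattice_pt n s v z \<in> A" for z
      proof (rule thick[OF that])
        fix i assume "i < n"
        then show "\<bar>lattice_pt n s (\<lambda>i. v i + u i) z i - lattice_pt n s v z i\<bar> \<le> s"
          using PiE_mem[OF True[unfolded half_open_cube_def], of i] by (simp add: lattice_pt_def)
      qed (simp add: lattice_pt_def)
      then show ?thesis unfolding card_lattice_hits[OF s A]
        by (intro mult_right_mono nn_integral_mono) (auto simp: indicator_def)
    qed simp
  qed
  also have "\<dots> = emeasure ?M A'" by (rule lattice_averaging[OF s A'])
  finally show ?thesis .
qed

lemma card_lattice_hits_ge:
  fixes s w :: real and p v :: "nat \<Rightarrow> real"
  assumes s: "s > 0" and w: "w \<ge> s" and A: "coord_bounded n A"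
    and box: "({..<n} \<rightarrow>\<^sub>E UNIV) \<inter> {x. \<forall>i<n. p i \<le> x i \<and> x i \<le> p i + w} \<subseteq> A"
  shows "(w / (2 * s)) ^ n \<le> real (card (lattice_hits n s A v))"
proof -
  define m where "m = nat \<lfloor>w / s\<rfloor>"
  have ws: "w / s \<ge> 1" using s w by simp
  have m: "real m \<le> w / s" "w / s < real m + 1" "m \<ge> 1"
    using ws unfolding m_def by (auto simp: le_nat_iff)
  define f where "f k = (\<lambda>i\<in>{..<n}. \<lceil>(p i - v i) / s\<rceil> + int (k i))" for k :: "nat \<Rightarrow> nat"
  let ?K = "PiE {..<n} (\<lambda>_. {..<m})"
  have inj: "inj_on f ?K"
  proof (rule inj_onI)
    fix k l assume kl: "k \<in> ?K" "l \<in> ?K" "f k = f l"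
    have "k i = l i" if "i < n" for i using fun_cong[OF kl(3), of i] that by (simp add: f_def)
    then show "k = l" using kl by (intro PiE_ext[of k _ _ l]) auto
  qed
  have sub: "f ` ?K \<subseteq> lattice_hits n s A v"
  proof
    fix z assume "z \<in> f ` ?K"
    then obtain k where k: "k \<in> ?K" "z = f k" by auto
    have "p i \<le> v i + s * real_of_int (z i) \<and> v i + s * real_of_int (z i) \<le> p i + w" if i: "i < n" for i
    proof -
      have ki: "real (k i) + 1 \<le> real m" using PiE_mem[OF k(1), of i] i by simp
      have zi: "real_of_int (z i) = real_of_int \<lceil>(p i - v i) / s\<rceil> + real (k i)" using i by (simp add: k(2) f_def)
      have "(p i - v i) / s \<le> real_of_int (z i)" unfolding zi by linarith
      moreover have "real_of_int (z i) \<le> (p i - v i) / s + w / s" unfolding zi using ki m(1) by linarith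
      ultimately show ?thesis using s by (simp add: field_simps)
    qed
    then have "lattice_pt n s v z \<in> A" by (intro subsetD[OF box]) (auto simp: lattice_pt_def)
    moreover have "z \<in> int_vectors n" unfolding k(2) f_def by auto
    ultimately show "z \<in> lattice_hits n s A v" by (simp add: lattice_hits_def)
  qed
  have "m ^ n = card (f ` ?K)" by (simp add: card_image[OF inj] card_PiE)
  also have "\<dots> \<le> card (lattice_hits n s A v)"
    by (intro card_mono finite_lattice_hits s A sub)
  finally have "real m ^ n \<le> real (card (lattice_hits n s A v))" by (metis of_nat_le_iff of_nat_power)
  moreover have "(w / (2 * s)) ^ n \<le> real m ^ n"
  proof (rule power_mono)
    have "w / (2 * s) = (w / s) / 2" by simp
    then show "w / (2 * s) \<le> real m" using m by linarith
  qed (use s w in auto)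
  ultimately show ?thesis by linarith
qed

lemma openin_box:
  fixes n :: nat
  assumes U: "openin (powertop_real {..<n}) U" and x: "x \<in> U"
  obtains r where "r > 0" "({..<n} \<rightarrow>\<^sub>E UNIV) \<inter> {y. \<forall>i<n. \<bar>y i - x i\<bar> \<le> r} \<subseteq> U"
proof -
  obtain W where "\<forall>i\<in>{..<n}. openin euclideanreal (W i)" and W: "x \<in> PiE {..<n} W" "PiE {..<n} W \<subseteq> U"
    using U[unfolded openin_product_topology_alt, rule_format, OF x] by blast
  then have Wo: "open (W i)" if "i < n" for i using that by simp
  have "\<exists>e>0. \<forall>y. \<bar>y - x i\<bar> \<le> e \<longrightarrow> y \<in> W i" if i: "i < n" for i
  proof -
    have "x i \<in> W i" using W(1) i by auto
    then obtain e where "e > 0" "cball (x i) e \<subseteq> W i" using Wo[OF i] open_contains_cball by blast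
    then show ?thesis by (intro exI[of _ e]) (auto simp: subset_eq dist_real_def abs_minus_commute)
  qed
  then obtain e where e: "\<And>i. i < n \<Longrightarrow> e i > 0 \<and> (\<forall>y. \<bar>y - x i\<bar> \<le> e i \<longrightarrow> y \<in> W i)" by metis
  define r where "r = Min (insert 1 (e ` {..<n}))"
  have "r > 0" unfolding r_def using e by (subst Min_gr_iff) auto
  moreover have re: "r \<le> e i" if "i < n" for i unfolding r_def using that by (intro Min_le) auto
  ultimately show ?thesis
  proof (intro that[of r] subsetI)
    fix y assume y: "y \<in> ({..<n} \<rightarrow>\<^sub>E UNIV) \<inter> {y. \<forall>i<n. \<bar>y i - x i\<bar> \<le> r}"
    have "y i \<in> W i" if "i < n" for i
      using e[OF that] y re[OF that] that by force
    then show "y \<in> U" using y by (intro subsetD[OF W(2)]) (auto simp: PiE_iff)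
  qed
qed

text \<open>
  Product \<open>\<sigma>\<close>-algebra and Borel sets agree for the index type \<^typ>\<open>nat\<close>; restricting to \<open>{..<n}\<close>
  and extending by \<open>0\<close> carries this over to the finite index set.
\<close>

lemma openin_measurable:
  assumes U: "openin (powertop_real {..<n}) U"
  shows "U \<in> sets (lebesgue_Rn n)"
proof -
  define V where "V = {x :: nat \<Rightarrow> real. restrict x {..<n} \<in> U}"
  have "continuous_map (powertop_real UNIV) (powertop_real {..<n}) (\<lambda>x. restrict x {..<n})"
    by (auto simp: continuous_map_componentwise intro: continuous_map_product_projection
        continuous_map_eq[OF continuous_map_product_projection])
  from openin_continuous_map_preimage[OF this U] have "open V"
    unfolding V_def euclidean_product_topology by simp
  then have V: "V \<in> sets (PiM UNIV (\<lambda>_. borel))" unfolding sets_PiM_equal_borel by simp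
  define h :: "(nat \<Rightarrow> real) \<Rightarrow> nat \<Rightarrow> real" where "h y = (\<lambda>i. if i < n then y i else 0)" for y
  have h: "h \<in> measurable (lebesgue_Rn n) (PiM UNIV (\<lambda>_. borel))"
    unfolding h_def
  proof (rule measurable_PiM_single')
    fix i :: nat
    show "(\<lambda>y. if i < n then y i else 0) \<in> borel_measurable (lebesgue_Rn n)"
      by (cases "i < n") (auto simp: lebesgue_Rn_def)
  qed auto
  have "h -` V \<inter> space (lebesgue_Rn n) = U"
  proof -
    have "restrict (h y) {..<n} = y" if "y \<in> space (lebesgue_Rn n)" for y
      using that by (auto simp: space_lebesgue_Rn h_def PiE_iff extensional_def)
    moreover have "U \<subseteq> space (lebesgue_Rn n)" using openin_subset[OF U] by (simp add: space_lebesgue_Rn)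
    ultimately show ?thesis unfolding V_def by auto
  qed
  then show ?thesis using measurable_sets[OF h V] by simp
qed

lemma reference_body_closedin:
  assumes "reference_body n B" shows "closedin (powertop_real {..<n}) B"
  using assms unfolding reference_body_def
  by (intro compactin_imp_closedin) (auto simp: Hausdorff_space_product_topology)

lemma reference_body_subset:
  assumes "reference_body n B" shows "B \<subseteq> {..<n} \<rightarrow>\<^sub>E UNIV"
  using closedin_subset[OF reference_body_closedin[OF assms]] by simp

lemma reference_body_measurable:
  assumes "reference_body n B" shows "B \<in> sets (lebesgue_Rn n)"
proof -
  have "({..<n} \<rightarrow>\<^sub>E UNIV) - B \<in> sets (lebesgue_Rn n)"
    using reference_body_closedin[OF assms] by (intro openin_measurable) (simp add: closedin_def)
  then have "space (lebesgue_Rn n) - (({..<n} \<rightarrow>\<^sub>E UNIV) - B) \<in> sets (lebesgue_Rn n)" by (rule sets.compl_sets)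
  moreover have "space (lebesgue_Rn n) - (({..<n} \<rightarrow>\<^sub>E UNIV) - B) = B"
    using reference_body_subset[OF assms] by (auto simp: space_lebesgue_Rn)
  ultimately show ?thesis by simp
qed

lemma reference_body_bounded:
  assumes "reference_body n B" shows "coord_bounded n B"
proof -
  have "\<exists>R. \<forall>x\<in>B. \<bar>x i\<bar> \<le> R" if "i < n" for i
  proof -
    have "compactin euclideanreal ((\<lambda>x. x i) ` B)"
      using assms that unfolding reference_body_def
      by (intro image_compactin[where X="powertop_real {..<n}"] continuous_map_product_projection) auto
    then have "bounded ((\<lambda>x. x i) ` B)" by (simp add: compact_imp_bounded)
    then show ?thesis unfolding bounded_iff by auto
  qed
  then obtain R where R: "\<And>i x. i < n \<Longrightarrow> x \<in> B \<Longrightarrow> \<bar>x i\<bar> \<le> R i" by metis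
  have "\<bar>x i\<bar> \<le> (\<Sum>j<n. \<bar>R j\<bar>)" if "x \<in> B" "i < n" for x i
  proof -
    have "\<bar>x i\<bar> \<le> \<bar>R i\<bar>" using R[OF that(2,1)] by linarith
    also have "\<dots> \<le> (\<Sum>j<n. \<bar>R j\<bar>)" using that by (intro member_le_sum) auto
    finally show ?thesis .
  qed
  then show ?thesis unfolding coord_bounded_def by blast
qed

lemma reference_body_contains_cube:
  assumes "reference_body n B"
  obtains p w where "w > 0" "({..<n} \<rightarrow>\<^sub>E UNIV) \<inter> {x. \<forall>i<n. p i \<le> x i \<and> x i \<le> p i + w} \<subseteq> B"
proof -
  obtain x where x: "x \<in> powertop_real {..<n} interior_of B" using assms unfolding reference_body_def by blast
  obtain r where r: "r > 0" "({..<n} \<rightarrow>\<^sub>E UNIV) \<inter> {y. \<forall>i<n. \<bar>y i - x i\<bar> \<le> r} \<subseteq> powertop_real {..<n} interior_of B"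
    using openin_box[OF openin_interior_of x] by blast
  have "({..<n} \<rightarrow>\<^sub>E UNIV) \<inter> {y. \<forall>i<n. x i \<le> y i \<and> y i \<le> x i + r} \<subseteq> ({..<n} \<rightarrow>\<^sub>E UNIV) \<inter> {y. \<forall>i<n. \<bar>y i - x i\<bar> \<le> r}"
    by (auto simp: abs_le_iff algebra_simps)
  then show ?thesis using that[of r x] r interior_of_subset by (meson order.trans)
qed

lemma emeasure_box:
  "emeasure (lebesgue_Rn n) ({..<n} \<rightarrow>\<^sub>E {a..a + w}) = ennreal (max 0 w) ^ n"
proof -
  interpret P: product_sigma_finite "\<lambda>_::nat. lborel :: real measure" ..
  show ?thesis unfolding lebesgue_Rn_def by (subst P.emeasure_PiM) (auto simp: max_def)
qed

lemma coord_bounded_finite_measure: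
  assumes "coord_bounded n A" "A \<subseteq> {..<n} \<rightarrow>\<^sub>E UNIV"
  shows "emeasure (lebesgue_Rn n) A < \<infinity>"
proof -
  obtain R where R: "\<And>x i. x \<in> A \<Longrightarrow> i < n \<Longrightarrow> \<bar>x i\<bar> \<le> R" using assms(1) unfolding coord_bounded_def by blast
  have "A \<subseteq> {..<n} \<rightarrow>\<^sub>E {- R.. - R + 2 * R}"
    using assms(2) R by (auto simp: PiE_iff abs_le_iff subset_eq) (smt (verit))+
  then have "emeasure (lebesgue_Rn n) A \<le> emeasure (lebesgue_Rn n) ({..<n} \<rightarrow>\<^sub>E {- R.. - R + 2 * R})"
    by (intro emeasure_mono) (auto simp: lebesgue_Rn_def intro!: sets_PiM_I_finite)
  also have "\<dots> < \<infinity>" unfolding emeasure_box by (simp add: power_less_top_ennreal)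
  finally show ?thesis .
qed

lemma reference_body_emeasure_pos:
  assumes "reference_body n B" shows "emeasure (lebesgue_Rn n) B > 0"
proof -
  obtain p w where w: "w > 0" "({..<n} \<rightarrow>\<^sub>E UNIV) \<inter> {x. \<forall>i<n. p i \<le> x i \<and> x i \<le> p i + w} \<subseteq> B"
    by (rule reference_body_contains_cube[OF assms])
  interpret P: product_sigma_finite "\<lambda>_::nat. lborel :: real measure" ..
  have "0 < ennreal (w ^ n)" using w by simp
  also have "\<dots> = emeasure (lebesgue_Rn n) (PiE {..<n} (\<lambda>i. {p i..p i + w}))"
    unfolding lebesgue_Rn_def using w by (subst P.emeasure_PiM) (auto simp: ennreal_power)
  also have "\<dots> \<le> emeasure (lebesgue_Rn n) B"
  proof (rule emeasure_mono[OF _ reference_body_measurable[OF assms]])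
    have "PiE {..<n} (\<lambda>i. {p i..p i + w}) \<subseteq> ({..<n} \<rightarrow>\<^sub>E UNIV) \<inter> {x. \<forall>i<n. p i \<le> x i \<and> x i \<le> p i + w}"
      by (intro subsetI) (simp add: PiE_iff)
    then show "PiE {..<n} (\<lambda>i. {p i..p i + w}) \<subseteq> B" using w(2) by (rule order.trans)
  qed
  finally show ?thesis .
qed

text \<open>
  Closedness makes the body the intersection of its open neighbourhoods, whose measures therefore
  decrease to that of the body. Nothing similar holds from below: the boundary may carry most of the
  measure and yet be missed by a periodic set.
\<close>

lemma reference_body_thickening:
  assumes B: "reference_body n B"
  obtains e A where "e > 0" "A \<in> sets (lebesgue_Rn n)" "emeasure (lebesgue_Rn n) A \<le> 2 * emeasure (lebesgue_Rn n) B"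
    "\<And>x y. x \<in> B \<Longrightarrow> y \<in> {..<n} \<rightarrow>\<^sub>E UNIV \<Longrightarrow> (\<And>i. i < n \<Longrightarrow> \<bar>y i - x i\<bar> < e) \<Longrightarrow> y \<in> A"
proof -
  define A where "A j = (\<Union>b\<in>B. PiE {..<n} (\<lambda>i. {b i - 1 / real (Suc j)<..<b i + 1 / real (Suc j)}))" for j
  have A_iff: "y \<in> A j \<longleftrightarrow> y \<in> {..<n} \<rightarrow>\<^sub>E UNIV \<and> (\<exists>b\<in>B. \<forall>i<n. \<bar>y i - b i\<bar> < 1 / real (Suc j))" for y j
    unfolding A_def by (auto simp: PiE_iff abs_less_iff algebra_simps)
  have openA: "openin (powertop_real {..<n}) (A j)" for j
    unfolding A_def by (intro openin_Union) (auto simp: openin_PiE)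
  have meas: "A j \<in> sets (lebesgue_Rn n)" for j by (rule openin_measurable[OF openA])
  have dec: "decseq A"
  proof (rule decseq_SucI)
    fix j
    have le: "1 / real (Suc (Suc j)) \<le> 1 / real (Suc j)" by (simp add: field_simps)
    show "A (Suc j) \<subseteq> A j"
    proof
      fix y assume "y \<in> A (Suc j)"
      then obtain b where b: "y \<in> {..<n} \<rightarrow>\<^sub>E UNIV" "b \<in> B" "\<And>i. i < n \<Longrightarrow> \<bar>y i - b i\<bar> < 1 / real (Suc (Suc j))"
        unfolding A_iff by blast
      then have "\<bar>y i - b i\<bar> < 1 / real (Suc j)" if "i < n" for i
        using b(3)[OF that] le by linarith
      then show "y \<in> A j" unfolding A_iff using b(1,2) by blast
    qed
  qed
  obtain R where R: "\<And>x i. x \<in> B \<Longrightarrow> i < n \<Longrightarrow> \<bar>x i\<bar> \<le> R"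
    using reference_body_bounded[OF B] unfolding coord_bounded_def by blast
  have fin: "emeasure (lebesgue_Rn n) (A j) < \<infinity>" for j
  proof (rule coord_bounded_finite_measure)
    have "\<bar>y i\<bar> \<le> R + 1" if y: "y \<in> A j" and i: "i < n" for y i
    proof -
      obtain b where b: "b \<in> B" "\<bar>y i - b i\<bar> < 1 / real (Suc j)" using y i unfolding A_iff by blast
      moreover have "1 / real (Suc j) \<le> 1" by simp
      ultimately show ?thesis using R[OF b(1) i] by linarith
    qed
    then show "coord_bounded n (A j)" unfolding coord_bounded_def by blast
  qed (auto simp: A_iff)
  have "(\<Inter>j. A j) = B"
  proof (intro equalityI subsetI)
    fix x assume "x \<in> B"
    then show "x \<in> (\<Inter>j. A j)" using reference_body_subset[OF B] by (auto simp: A_iff intro!: bexI[of _ x])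
  next
    fix x assume x: "x \<in> (\<Inter>j. A j)"
    show "x \<in> B"
    proof (rule ccontr)
      assume "x \<notin> B"
      moreover have xs: "x \<in> {..<n} \<rightarrow>\<^sub>E UNIV" using x A_iff by blast
      moreover have op: "openin (powertop_real {..<n}) (({..<n} \<rightarrow>\<^sub>E UNIV) - B)"
        using reference_body_closedin[OF B] by (simp add: closedin_def)
      ultimately obtain r where r: "r > 0" "({..<n} \<rightarrow>\<^sub>E UNIV) \<inter> {y. \<forall>i<n. \<bar>y i - x i\<bar> \<le> r} \<subseteq> ({..<n} \<rightarrow>\<^sub>E UNIV) - B"
        using openin_box[OF op, of x] by blast
      obtain j where j: "1 / real (Suc j) < r" using r(1) reals_Archimedean by (auto simp: inverse_eq_divide)
      obtain b where b: "b \<in> B" "\<And>i. i < n \<Longrightarrow> \<bar>x i - b i\<bar> < 1 / real (Suc j)" using x A_iff by blast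
      have "b \<in> ({..<n} \<rightarrow>\<^sub>E UNIV) \<inter> {y. \<forall>i<n. \<bar>y i - x i\<bar> \<le> r}"
        using b j reference_body_subset[OF B] by (force simp: abs_minus_commute)
      then show False using r(2) b(1) by blast
    qed
  qed
  then have "(INF j. emeasure (lebesgue_Rn n) (A j)) = emeasure (lebesgue_Rn n) B"
    using INF_emeasure_decseq[of A "lebesgue_Rn n"] meas dec fin by (auto simp: less_top)
  moreover have "emeasure (lebesgue_Rn n) B < 2 * emeasure (lebesgue_Rn n) B"
  proof -
    have "emeasure (lebesgue_Rn n) B < \<infinity>"
      by (intro coord_bounded_finite_measure reference_body_bounded reference_body_subset B)
    then have "emeasure (lebesgue_Rn n) B + 0 < emeasure (lebesgue_Rn n) B + emeasure (lebesgue_Rn n) B"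
      using reference_body_emeasure_pos[OF B] by (subst ennreal_add_left_cancel_less) auto
    then show ?thesis by (simp add: mult_2)
  qed
  ultimately obtain j where j: "emeasure (lebesgue_Rn n) (A j) < 2 * emeasure (lebesgue_Rn n) B"
    by (metis INF_less_iff)
  show ?thesis
  proof (rule that[of "1 / real (Suc j)" "A j"])
    fix x y assume "x \<in> B" "y \<in> {..<n} \<rightarrow>\<^sub>E UNIV" "\<And>i. i < n \<Longrightarrow> \<bar>y i - x i\<bar> < 1 / real (Suc j)"
    then show "y \<in> A j" unfolding A_iff by blast
  qed (use j meas in auto)
qed

lemma dilation_measurable:
  assumes "A \<in> sets (lebesgue_Rn n)"
  shows "{x \<in> space (lebesgue_Rn n). (\<lambda>i\<in>{..<n}. x i / K) \<in> A} \<in> sets (lebesgue_Rn n)"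
proof -
  have "(\<lambda>x. \<lambda>i\<in>{..<n}. x i / K) \<in> measurable (PiM {..<n} (\<lambda>_. borel)) (PiM {..<n} (\<lambda>_. borel :: real measure))"
    by measurable
  then have "(\<lambda>x. \<lambda>i\<in>{..<n}. x i / K) \<in> measurable (lebesgue_Rn n) (lebesgue_Rn n)"
    by (simp add: measurable_cong_sets[OF sets_lebesgue_Rn sets_lebesgue_Rn])
  from measurable_sets[OF this assms] show ?thesis
    by (simp add: vimage_def Int_def conj_commute)
qed

lemma emeasure_dilation:
  assumes K: "K > 0" and A: "A \<in> sets (lebesgue_Rn n)"
  shows "emeasure (lebesgue_Rn n) {x \<in> space (lebesgue_Rn n). (\<lambda>i\<in>{..<n}. x i / K) \<in> A}
    = ennreal (K ^ n) * emeasure (lebesgue_Rn n) A"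
proof -
  let ?e = "emeasure (lebesgue_Rn n) {x \<in> space (lebesgue_Rn n). (\<lambda>i\<in>{..<n}. x i / K) \<in> A}"
  have "ennreal ((1 / K) ^ n) * ?e = emeasure (lebesgue_Rn n) A"
    using lebesgue_Rn_affine[of "1 / K" A n "\<lambda>_. 0"] K A by simp
  then have "ennreal (K ^ n) * emeasure (lebesgue_Rn n) A = (ennreal (K ^ n) * ennreal ((1 / K) ^ n)) * ?e"
    by (simp add: mult.assoc)
  also have "ennreal (K ^ n) * ennreal ((1 / K) ^ n) = 1"
    using K by (simp add: ennreal_mult[symmetric] power_mult_distrib[symmetric])
  finally show ?thesis by (simp only: mult_1_left)
qed

lemma scale_set_eq:
  assumes "K > 0" "B \<subseteq> {..<n} \<rightarrow>\<^sub>E UNIV"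
  shows "scale_set n K B = {x \<in> space (lebesgue_Rn n). (\<lambda>i\<in>{..<n}. x i / K) \<in> B}"
proof (intro equalityI subsetI)
  fix x assume "x \<in> scale_set n K B"
  then obtain b where b: "b \<in> B" "x = (\<lambda>i\<in>{..<n}. K * b i)" unfolding scale_set_def by auto
  moreover have "(\<lambda>i\<in>{..<n}. x i / K) = b"
    using b assms by (intro PiE_ext[of _ "{..<n}" "\<lambda>_. UNIV"]) auto
  ultimately show "x \<in> {x \<in> space (lebesgue_Rn n). (\<lambda>i\<in>{..<n}. x i / K) \<in> B}"
    by (simp add: space_lebesgue_Rn)
next
  fix x assume x: "x \<in> {x \<in> space (lebesgue_Rn n). (\<lambda>i\<in>{..<n}. x i / K) \<in> B}"
  have "x = (\<lambda>i\<in>{..<n}. K * (\<lambda>i\<in>{..<n}. x i / K) i)"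
    using x assms by (intro PiE_ext[of _ "{..<n}" "\<lambda>_. UNIV"]) (auto simp: space_lebesgue_Rn)
  then show "x \<in> scale_set n K B" using x unfolding scale_set_def by blast
qed

lemma scale_set_measurable:
  assumes "reference_body n B" "K > 0"
  shows "scale_set n K B \<in> sets (lebesgue_Rn n)"
  unfolding scale_set_eq[OF assms(2) reference_body_subset[OF assms(1)]]
  by (intro dilation_measurable reference_body_measurable assms)

lemma scale_set_bounded:
  assumes "coord_bounded n B" shows "coord_bounded n (scale_set n K B)"
proof -
  obtain R where R: "\<And>x i. x \<in> B \<Longrightarrow> i < n \<Longrightarrow> \<bar>x i\<bar> \<le> R" using assms unfolding coord_bounded_def by blast
  have "\<bar>x i\<bar> \<le> \<bar>K\<bar> * R" if "x \<in> scale_set n K B" "i < n" for x i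
    using that R unfolding scale_set_def by (auto simp: abs_mult intro!: mult_left_mono)
  then show ?thesis unfolding coord_bounded_def by blast
qed

lemma emeasure_reference_body:
  assumes "reference_body n B"
  shows "emeasure (lebesgue_Rn n) B = ennreal (measure (lebesgue_Rn n) B)" "measure (lebesgue_Rn n) B > 0"
proof -
  have "emeasure (lebesgue_Rn n) B < \<infinity>"
    by (intro coord_bounded_finite_measure reference_body_bounded reference_body_subset assms)
  then show e: "emeasure (lebesgue_Rn n) B = ennreal (measure (lebesgue_Rn n) B)"
    by (intro emeasure_eq_ennreal_measure) auto
  show "measure (lebesgue_Rn n) B > 0"
    using reference_body_emeasure_pos[OF assms] unfolding e by simp
qed

lemma emeasure_scale_set:
  assumes "reference_body n B" "K > 0"
  shows "emeasure (lebesgue_Rn n) (scale_set n K B) = ennreal (K ^ n * measure (lebesgue_Rn n) B)"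
  unfolding scale_set_eq[OF assms(2) reference_body_subset[OF assms(1)]]
    emeasure_dilation[OF assms(2) reference_body_measurable[OF assms(1)]] emeasure_reference_body[OF assms(1)]
  using assms by (simp add: ennreal_mult)

lemma measure_scale_set:
  assumes "reference_body n B" "K > 0"
  shows "measure (lebesgue_Rn n) (scale_set n K B) = K ^ n * measure (lebesgue_Rn n) B"
  using emeasure_scale_set[OF assms] assms by (simp add: measure_def)

lemma lattice_hits_body_upper:
  assumes B: "reference_body n B" and s: "s > 0"
  shows "\<forall>\<^sub>F K in at_top. \<forall>v. real (card (lattice_hits n s (scale_set n K B) v)) * s ^ n
           \<le> 2 * K ^ n * measure (lebesgue_Rn n) B"
proof -
  obtain e A where e: "e > 0" and A: "A \<in> sets (lebesgue_Rn n)"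
    "emeasure (lebesgue_Rn n) A \<le> 2 * emeasure (lebesgue_Rn n) B"
    and thick: "\<And>x y. x \<in> B \<Longrightarrow> y \<in> {..<n} \<rightarrow>\<^sub>E UNIV \<Longrightarrow> (\<And>i. i < n \<Longrightarrow> \<bar>y i - x i\<bar> < e) \<Longrightarrow> y \<in> A"
    using reference_body_thickening[OF B] by blast
  have "real (card (lattice_hits n s (scale_set n K B) v)) * s ^ n \<le> 2 * K ^ n * measure (lebesgue_Rn n) B"
    if K: "K > s / e" for K v
  proof -
    have K0: "K > 0" using K s e by (meson divide_pos_pos less_trans)
    have sK: "s / K < e" using K K0 e by (simp add: field_simps)
    let ?A = "{x \<in> space (lebesgue_Rn n). (\<lambda>i\<in>{..<n}. x i / K) \<in> A}"
    have "ennreal (real (card (lattice_hits n s (scale_set n K B) v)) * s ^ n) \<le> emeasure (lebesgue_Rn n) ?A"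
    proof (rule card_lattice_hits_le[OF s scale_set_bounded[OF reference_body_bounded[OF B]] dilation_measurable[OF A(1)]])
      fix x y assume x: "x \<in> scale_set n K B" and y: "y \<in> {..<n} \<rightarrow>\<^sub>E UNIV" and xy: "\<And>i. i < n \<Longrightarrow> \<bar>y i - x i\<bar> \<le> s"
      have "(\<lambda>i\<in>{..<n}. y i / K) \<in> A"
      proof (rule thick)
        show "(\<lambda>i\<in>{..<n}. x i / K) \<in> B"
          using x unfolding scale_set_eq[OF K0 reference_body_subset[OF B]] by simp
        fix i assume i: "i < n"
        have "\<bar>y i / K - x i / K\<bar> = \<bar>y i - x i\<bar> / K" using K0 by (simp add: diff_divide_distrib[symmetric])
        also have "\<dots> \<le> s / K" using xy[OF i] K0 by (intro divide_right_mono) auto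
        also have "\<dots> < e" by (rule sK)
        finally show "\<bar>(\<lambda>i\<in>{..<n}. y i / K) i - (\<lambda>i\<in>{..<n}. x i / K) i\<bar> < e" using i by simp
      qed auto
      then show "y \<in> ?A" using y by (simp add: space_lebesgue_Rn)
    qed
    also have "\<dots> = ennreal (K ^ n) * emeasure (lebesgue_Rn n) A" by (rule emeasure_dilation[OF K0 A(1)])
    also have "\<dots> \<le> ennreal (K ^ n) * (2 * ennreal (measure (lebesgue_Rn n) B))"
      using A(2) unfolding emeasure_reference_body(1)[OF B] by (rule mult_left_mono) simp
    also have "2 * ennreal (measure (lebesgue_Rn n) B) = ennreal (2 * measure (lebesgue_Rn n) B)"
      by (simp add: ennreal_mult)
    also have "ennreal (K ^ n) * \<dots> = ennreal (2 * K ^ n * measure (lebesgue_Rn n) B)"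
      using K0 by (subst ennreal_mult[symmetric]) (auto simp: mult_ac)
    finally show ?thesis using K0 by (subst (asm) ennreal_le_iff) auto
  qed
  then show ?thesis by (intro eventually_mono[OF eventually_gt_at_top[of "s / e"]]) blast
qed

text \<open>
  A cube inside the body gives a lower bound of the right order. The constant \<open>w\<close> may be far
  smaller than the measure of the body, but it does not depend on the period \<open>s\<close>.
\<close>

lemma lattice_hits_body_lower:
  assumes B: "reference_body n B"
  obtains w where "w > 0" "\<And>s. s > 0 \<Longrightarrow> \<forall>\<^sub>F K in at_top. \<forall>v.
     K ^ n * w \<le> real (card (lattice_hits n s (scale_set n K B) v)) * s ^ n"
proof -
  obtain p w where w: "w > 0" and box: "({..<n} \<rightarrow>\<^sub>E UNIV) \<inter> {x. \<forall>i<n. p i \<le> x i \<and> x i \<le> p i + w} \<subseteq> B"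
    by (rule reference_body_contains_cube[OF B])
  have "\<forall>\<^sub>F K in at_top. \<forall>v. K ^ n * (w / 2) ^ n \<le> real (card (lattice_hits n s (scale_set n K B) v)) * s ^ n"
    if s: "s > 0" for s
  proof -
    have "K ^ n * (w / 2) ^ n \<le> real (card (lattice_hits n s (scale_set n K B) v)) * s ^ n"
      if K: "K \<ge> s / w" for K v
    proof -
      have K0: "K > 0" using K s w by (meson divide_pos_pos less_le_trans)
      have "(K * w / (2 * s)) ^ n \<le> real (card (lattice_hits n s (scale_set n K B) v))"
      proof (rule card_lattice_hits_ge[OF s _ scale_set_bounded[OF reference_body_bounded[OF B]]])
        show "s \<le> K * w" using K w by (simp add: field_simps)
        show "({..<n} \<rightarrow>\<^sub>E UNIV) \<inter> {x. \<forall>i<n. K * p i \<le> x i \<and> x i \<le> K * p i + K * w} \<subseteq> scale_set n K B"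
        proof
          fix x assume x: "x \<in> ({..<n} \<rightarrow>\<^sub>E UNIV) \<inter> {x. \<forall>i<n. K * p i \<le> x i \<and> x i \<le> K * p i + K * w}"
          have "p i \<le> x i / K \<and> x i / K \<le> p i + w" if "i < n" for i
            using x that K0 by (simp add: field_simps)
          then have "(\<lambda>i\<in>{..<n}. x i / K) \<in> B" by (intro subsetD[OF box]) auto
          then show "x \<in> scale_set n K B"
            using x unfolding scale_set_eq[OF K0 reference_body_subset[OF B]] by (simp add: space_lebesgue_Rn)
        qed
      qed
      then have "(K * w / (2 * s)) ^ n * s ^ n \<le> real (card (lattice_hits n s (scale_set n K B) v)) * s ^ n"
        using s by (intro mult_right_mono) auto
      moreover have "(K * w / (2 * s)) ^ n * s ^ n = K ^ n * (w / 2) ^ n"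
        unfolding power_mult_distrib[symmetric] using s by simp
      ultimately show ?thesis by simp
    qed
    then show ?thesis by (intro eventually_mono[OF eventually_ge_at_top[of "s / w"]]) blast
  qed
  then show ?thesis using that[of "(w / 2) ^ n"] w by simp
qed

text \<open>
  For each dilate the average number of hits over all translations is \<open>card Y\<close> times the ratio of
  volumes, and \<open>lattice_hits_body_upper\<close> bounds the numbers of hits uniformly. If no translation
  reached half of the average for arbitrarily large \<open>K\<close>, the reverse Fatou lemma would make the
  average at most half of itself. A translation is needed: a fixed periodic set may miss all
  of the body except a small part of its interior.
\<close>

lemma exists_good_shift:
  fixes Y :: "(nat \<Rightarrow> real) set" and s :: real
  assumes B: "reference_body n B" and s: "s > 0" and Y: "finite Y" "Y \<noteq> {}"
  obtains u where "\<exists>\<^sub>F K in at_top. real (card Y) * K ^ n * measure (lebesgue_Rn n) B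
      \<le> 2 * s ^ n * (\<Sum>y\<in>Y. real (card (lattice_hits n s (scale_set n K B) (\<lambda>i. y i + u i))))"
proof -
  define V where "V = measure (lebesgue_Rn n) B"
  have V: "V > 0" unfolding V_def by (rule emeasure_reference_body[OF B])
  define M where "M = real (card Y)"
  have M: "M > 0" using Y by (simp add: M_def card_gt_0_iff)
  define cnt where "cnt K u = (\<Sum>y\<in>Y. real (card (lattice_hits n s (scale_set n K B) (\<lambda>i. y i + u i))))" for K u
  define Q where "Q = half_open_cube n s"
  note bnd = scale_set_bounded[OF reference_body_bounded[OF B]]
  obtain K0 where K0: "\<And>K v. K \<ge> K0 \<Longrightarrow> real (card (lattice_hits n s (scale_set n K B) v)) * s ^ n \<le> 2 * K ^ n * V"
    using lattice_hits_body_upper[OF B s] unfolding V_def eventually_at_top_linorder by blast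
  \<comment> \<open>The reverse Fatou lemma needs a sequence; shifting the integers by \<open>K0\<close> makes the bound hold for all terms.\<close>
  define k where "k j = max 1 K0 + real j" for j :: nat
  have k: "k j > 0" "k j \<ge> K0" "k j \<ge> real j" for j unfolding k_def by auto
  define f where "f j u = ennreal (cnt (k j) u / k j ^ n) * indicator Q u" for j u
  have f_eq: "f j u = ennreal (1 / k j ^ n) * (\<Sum>y\<in>Y. (\<integral>\<^sup>+z. indicator (scale_set n (k j) B) (lattice_pt n s (\<lambda>i. y i + u i) z) \<partial>count_space (int_vectors n)) * indicator Q u)" for j u
  proof -
    have "ennreal (cnt (k j) u / k j ^ n) = ennreal (1 / k j ^ n) * ennreal (cnt (k j) u)"
      using k[of j] by (subst ennreal_mult[symmetric]) (auto simp: cnt_def sum_nonneg)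
    then show ?thesis unfolding f_def
      by (simp add: cnt_def sum_ennreal[symmetric] card_lattice_hits[OF s bnd] sum_distrib_right mult.assoc)
  qed
  have f_meas: "f j \<in> borel_measurable (lebesgue_Rn n)" for j
  proof -
    note lattice_hits_measurable[OF scale_set_measurable[OF B k(1)[of j]], measurable]
    have [measurable]: "Q \<in> sets (lebesgue_Rn n)" unfolding Q_def by measurable
    show ?thesis unfolding f_eq by measurable
  qed
  have f_int: "(\<integral>\<^sup>+u. f j u \<partial>lebesgue_Rn n) = ennreal (M * V)" for j
  proof -
    note lattice_hits_measurable[OF scale_set_measurable[OF B k(1)[of j]], measurable]
    have [measurable]: "Q \<in> sets (lebesgue_Rn n)" unfolding Q_def by measurable
    have "(\<integral>\<^sup>+u. f j u \<partial>lebesgue_Rn n) = ennreal (1 / k j ^ n) * (\<Sum>y\<in>Y. \<integral>\<^sup>+u. (\<integral>\<^sup>+z. indicator (scale_set n (k j) B) (lattice_pt n s (\<lambda>i. y i + u i) z) \<partial>count_space (int_vectors n)) * indicator Q u \<partial>lebesgue_Rn n)"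
      unfolding f_eq by (subst nn_integral_cmult, measurable, subst nn_integral_sum, measurable)
    also have "\<dots> = ennreal (1 / k j ^ n) * (\<Sum>y\<in>Y. emeasure (lebesgue_Rn n) (scale_set n (k j) B))"
      unfolding Q_def by (simp only: lattice_averaging[OF s scale_set_measurable[OF B k(1)]])
    also have "\<dots> = ennreal (1 / k j ^ n) * (ennreal M * ennreal (k j ^ n * V))"
      unfolding emeasure_scale_set[OF B k(1)] V_def[symmetric] M_def by (simp add: ennreal_of_nat_eq_real_of_nat)
    also have "\<dots> = ennreal (M * V)"
      using M V k(1)[of j] by (simp add: ennreal_mult[symmetric])
    finally show ?thesis .
  qed
  have f_bound: "f j u \<le> ennreal (2 * M * V / s ^ n) * indicator Q u" for j u
  proof -
    have "real (card (lattice_hits n s (scale_set n (k j) B) v)) \<le> 2 * k j ^ n * V / s ^ n" for v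
      using K0[OF k(2)[of j], of v] s by (simp add: pos_le_divide_eq)
    then have "cnt (k j) u \<le> (\<Sum>y\<in>Y. 2 * k j ^ n * V / s ^ n)"
      unfolding cnt_def by (intro sum_mono) auto
    also have "\<dots> = k j ^ n * (2 * M * V / s ^ n)" by (simp add: M_def)
    finally have "cnt (k j) u / k j ^ n \<le> 2 * M * V / s ^ n"
      using k(1)[of j] by (simp add: pos_divide_le_eq mult.commute)
    then show ?thesis unfolding f_def by (intro mult_right_mono ennreal_leI) auto
  qed
  have Qe: "emeasure (lebesgue_Rn n) Q = ennreal (s ^ n)"
    unfolding Q_def by (rule emeasure_half_open_cube[OF s])
  have Qs[measurable]: "Q \<in> sets (lebesgue_Rn n)" unfolding Q_def by measurable
  have "\<exists>u. \<exists>\<^sub>F j in sequentially. M * k j ^ n * V \<le> 2 * s ^ n * cnt (k j) u"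
  proof (rule ccontr)
    assume "\<not> ?thesis"
    then have ev: "\<forall>\<^sub>F j in sequentially. 2 * s ^ n * cnt (k j) u < M * k j ^ n * V" for u
      by (auto simp: not_frequently not_le)
    have lim: "limsup (\<lambda>j. f j u) \<le> ennreal (M * V / (2 * s ^ n)) * indicator Q u" for u
    proof (rule Limsup_bounded)
      show "\<forall>\<^sub>F j in sequentially. f j u \<le> ennreal (M * V / (2 * s ^ n)) * indicator Q u"
        using ev[of u]
      proof eventually_elim
        case (elim j)
        then have "cnt (k j) u / k j ^ n \<le> M * V / (2 * s ^ n)"
          using s k(1)[of j] by (simp add: field_simps)
        then show ?case unfolding f_def by (intro mult_right_mono ennreal_leI) auto
      qed
    qed
    have "ennreal (M * V) = limsup (\<lambda>j. \<integral>\<^sup>+u. f j u \<partial>lebesgue_Rn n)"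
      unfolding f_int by (simp add: Limsup_const)
    also have "\<dots> \<le> (\<integral>\<^sup>+u. limsup (\<lambda>j. f j u) \<partial>lebesgue_Rn n)"
    proof (rule nn_integral_limsup[OF f_meas, where w="\<lambda>u. ennreal (2 * M * V / s ^ n) * indicator Q u"])
      show "(\<integral>\<^sup>+u. ennreal (2 * M * V / s ^ n) * indicator Q u \<partial>lebesgue_Rn n) < \<infinity>"
        by (subst nn_integral_cmult_indicator) (auto simp: Qe ennreal_mult_less_top)
    qed (use f_bound in auto)
    also have "\<dots> \<le> (\<integral>\<^sup>+u. ennreal (M * V / (2 * s ^ n)) * indicator Q u \<partial>lebesgue_Rn n)"
      using lim by (intro nn_integral_mono) auto
    also have "\<dots> = ennreal (M * V / 2)"
      using s M V by (subst nn_integral_cmult_indicator) (auto simp: Qe ennreal_mult[symmetric])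
    finally show False using M V by (subst (asm) ennreal_le_iff) auto
  qed
  then obtain u where u: "\<exists>\<^sub>F j in sequentially. M * k j ^ n * V \<le> 2 * s ^ n * cnt (k j) u" by blast
  have lim: "filterlim k at_top sequentially"
    by (rule filterlim_at_top_mono[OF filterlim_real_sequentially]) (use k in auto)
  have "\<exists>\<^sub>F K in at_top. M * K ^ n * V \<le> 2 * s ^ n * cnt K u"
    unfolding frequently_def
  proof
    assume "\<forall>\<^sub>F K in at_top. \<not> M * K ^ n * V \<le> 2 * s ^ n * cnt K u"
    then have "\<forall>\<^sub>F j in sequentially. \<not> M * k j ^ n * V \<le> 2 * s ^ n * cnt (k j) u"
      using lim by (rule eventually_compose_filterlim)
    then show False using u by (simp add: frequently_def)
  qed
  then show ?thesis using that unfolding M_def V_def cnt_def by blast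
qed

section \<open>Periodic codes\<close>

lemma L2_set_abs_eq: "L2_set (\<lambda>i. \<bar>f i\<bar>) A = L2_set f A"
  by (simp add: L2_set_def)

definition periodic_code :: "nat \<Rightarrow> real \<Rightarrow> (nat \<Rightarrow> real) \<Rightarrow> (nat \<Rightarrow> real) set \<Rightarrow> (nat \<Rightarrow> real) set" where
  "periodic_code n s u Y = (\<lambda>(y, z). lattice_pt n s (\<lambda>i. y i + u i) z) ` (Y \<times> int_vectors n)"

lemma half_open_cube_lattice_unique:
  assumes s: "s > 0" and y: "y \<in> half_open_cube n s" "y' \<in> half_open_cube n s"
    and z: "z \<in> int_vectors n" "z' \<in> int_vectors n"
    and eq: "lattice_pt n s (\<lambda>i. y i + u i) z = lattice_pt n s (\<lambda>i. y' i + u i) z'"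
  shows "y = y'" "z = z'"
proof -
  have zi: "z i = z' i" and yi: "y i = y' i" if i: "i < n" for i
  proof -
    have e: "y i + s * real_of_int (z i) = y' i + s * real_of_int (z' i)"
      using fun_cong[OF eq, of i] i by (simp add: lattice_pt_def)
    have "y i \<in> {0..<s}" "y' i \<in> {0..<s}" using y[unfolded half_open_cube_def, THEN PiE_mem, of i] i by auto
    then have "\<bar>y' i - y i\<bar> < s" by (auto simp: abs_less_iff)
    moreover have "y' i - y i = s * real_of_int (z i - z' i)" using e by (simp add: algebra_simps)
    ultimately have "s * \<bar>real_of_int (z i - z' i)\<bar> < s * 1" using s by (simp add: abs_mult)
    then have "\<bar>real_of_int (z i - z' i)\<bar> < 1" using s by (simp only: mult_less_cancel_left_pos)
    then have "\<bar>z i - z' i\<bar> < 1" by linarith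
    then show "z i = z' i" by simp
    then show "y i = y' i" using e by simp
  qed
  show "y = y'" using yi y unfolding half_open_cube_def by (intro PiE_ext[of y _ _ y']) auto
  show "z = z'" using zi z by (intro PiE_ext[of z _ _ z']) auto
qed

lemma sum_periodic_code:
  assumes s: "s > 0" and Y: "finite Y" "Y \<subseteq> half_open_cube n s" and A: "coord_bounded n A"
  shows "finite (periodic_code n s u Y \<inter> A)"
    "(\<Sum>x\<in>periodic_code n s u Y \<inter> A. f x)
       = (\<Sum>y\<in>Y. \<Sum>z\<in>lattice_hits n s A (\<lambda>i. y i + u i). f (lattice_pt n s (\<lambda>i. y i + u i) z))"
proof -
  let ?S = "SIGMA y:Y. lattice_hits n s A (\<lambda>i. y i + u i)"
  let ?h = "\<lambda>(y, z). lattice_pt n s (\<lambda>i. y i + u i) z"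
  have fin: "finite (lattice_hits n s A v)" for v by (rule finite_lattice_hits[OF s A])
  have eq: "periodic_code n s u Y \<inter> A = ?h ` ?S"
    unfolding periodic_code_def lattice_hits_def by auto
  have inj: "inj_on ?h ?S"
  proof (rule inj_onI)
    fix p q assume "p \<in> ?S" "q \<in> ?S" and eq: "?h p = ?h q"
    then have "fst p \<in> half_open_cube n s" "fst q \<in> half_open_cube n s"
      "snd p \<in> int_vectors n" "snd q \<in> int_vectors n"
      using Y(2) by (auto simp: lattice_hits_def)
    from half_open_cube_lattice_unique[OF s this] eq show "p = q"
      by (simp add: case_prod_beta prod_eq_iff)
  qed
  show "finite (periodic_code n s u Y \<inter> A)" unfolding eq using Y fin by auto
  have "(\<Sum>x\<in>periodic_code n s u Y \<inter> A. f x) = (\<Sum>p\<in>?S. f (?h p))"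
    unfolding eq sum.reindex[OF inj] by (simp add: comp_def)
  also have "\<dots> = (\<Sum>y\<in>Y. \<Sum>z\<in>lattice_hits n s A (\<lambda>i. y i + u i). f (lattice_pt n s (\<lambda>i. y i + u i) z))"
    using Y fin by (subst sum.Sigma) (auto simp: case_prod_beta)
  finally show "(\<Sum>x\<in>periodic_code n s u Y \<inter> A. f x)
       = (\<Sum>y\<in>Y. \<Sum>z\<in>lattice_hits n s A (\<lambda>i. y i + u i). f (lattice_pt n s (\<lambda>i. y i + u i) z))" .
qed

lemma periodic_code_unbounded_code:
  assumes s: "s > 0" and Y: "finite Y" "Y \<subseteq> half_open_cube n s"
  shows "unbounded_code n (periodic_code n s u Y)"
  unfolding unbounded_code_def
proof (intro conjI allI)
  show "periodic_code n s u Y \<subseteq> {..<n} \<rightarrow>\<^sub>E UNIV"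
    unfolding periodic_code_def lattice_pt_def by auto
  show "countable (periodic_code n s u Y)"
    unfolding periodic_code_def using Y by (intro countable_image countable_SIGMA countable_int_vectors) (auto intro: countable_finite)
  fix r
  have "{x \<in> periodic_code n s u Y. L2_set x {..<n} \<le> r} \<subseteq> periodic_code n s u Y \<inter> {x. \<forall>i<n. \<bar>x i\<bar> \<le> r}"
  proof -
    have "\<bar>x i\<bar> \<le> L2_set x {..<n}" if "i < n" for x :: "nat \<Rightarrow> real" and i
      using member_le_L2_set[of "{..<n}" i "\<lambda>i. \<bar>x i\<bar>"] that unfolding L2_set_abs_eq by simp
    then show ?thesis by (auto intro: order.trans)
  qed
  moreover have "finite (periodic_code n s u Y \<inter> {x. \<forall>i<n. \<bar>x i\<bar> \<le> r})"
    by (rule sum_periodic_code(1)[OF s Y]) (auto simp: coord_bounded_def)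
  ultimately show "finite {x \<in> periodic_code n s u Y. L2_set x {..<n} \<le> r}" by (rule finite_subset)
qed

definition list_event ::
    "nat \<Rightarrow> real \<Rightarrow> nat \<Rightarrow> (nat \<Rightarrow> real) set \<Rightarrow> (nat \<Rightarrow> real) \<Rightarrow> (nat \<Rightarrow> real) set" where
  "list_event n \<sigma> l C x = {g \<in> space (awgn n \<sigma>).
        \<exists>xs. length xs = l \<and> distinct xs \<and> set xs \<subseteq> C - {x} \<and>
          (\<forall>y\<in>set xs. L2_set (\<lambda>i. y i - (x i + g i)) {..<n} < L2_set g {..<n})}"

lemma list_error_eq: "list_error n \<sigma> l C x = measure (awgn n \<sigma>) (list_event n \<sigma> l C x)"
  by (simp add: list_error_def list_event_def)

lemma list_event_measurable:
  assumes "countable C"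
  shows "list_event n \<sigma> l C x \<in> sets (awgn n \<sigma>)"
proof -
  let ?I = "{xs \<in> lists (C - {x}). length xs = l \<and> distinct xs}"
  have I: "countable ?I"
    using assms by (intro countable_subset[OF _ countable_lists[of "C - {x}"]]) (auto intro: countable_subset)
  have "list_event n \<sigma> l C x = {g \<in> space (awgn n \<sigma>). \<exists>xs\<in>?I. \<forall>y\<in>set xs.
      L2_set (\<lambda>i. y i - (x i + g i)) {..<n} < L2_set g {..<n}}"
    unfolding list_event_def by (auto simp: lists_eq_set)
  also have "\<dots> \<in> sets (awgn n \<sigma>)"
  proof (intro sets.sets_Collect_countable_Ex'[OF _ I] sets.sets_Collect_finite_All)
    fix y
    show "{g \<in> space (awgn n \<sigma>). L2_set (\<lambda>i. y i - (x i + g i)) {..<n} < L2_set g {..<n}} \<in> sets (awgn n \<sigma>)"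
      by measurable
  qed auto
  finally show ?thesis .
qed

lemma awgn_radius_tail:
  assumes \<sigma>: "\<sigma> > 0" and e: "e > 0"
  obtains D where "D > 0" "measure (awgn n \<sigma>) {g \<in> space (awgn n \<sigma>). D / 2 \<le> L2_set g {..<n}} \<le> e"
proof -
  interpret prob_space "awgn n \<sigma>" by (rule prob_space_awgn[OF \<sigma>])
  define S where "S j = {g \<in> space (awgn n \<sigma>). real j \<le> L2_set g {..<n}}" for j :: nat
  have S: "S j \<in> sets (awgn n \<sigma>)" for j unfolding S_def by measurable
  have "(\<lambda>j. measure (awgn n \<sigma>) (S j)) \<longlonglongrightarrow> measure (awgn n \<sigma>) (\<Inter>j. S j)"
    using S by (intro finite_Lim_measure_decseq) (auto simp: S_def decseq_def)
  moreover have "(\<Inter>j. S j) = {}"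
  proof -
    have "\<exists>j. \<not> real j \<le> L2_set g {..<n}" for g :: "nat \<Rightarrow> real"
      using reals_Archimedean2[of "L2_set g {..<n}"] not_le by blast
    then show ?thesis unfolding S_def by blast
  qed
  ultimately have "(\<lambda>j. measure (awgn n \<sigma>) (S j)) \<longlonglongrightarrow> 0" by simp
  then have "\<forall>\<^sub>F j in sequentially. measure (awgn n \<sigma>) (S j) < e" using e by (rule order_tendstoD)
  then obtain j where j: "measure (awgn n \<sigma>) (S j) < e" "j \<ge> 1"
    using eventually_conj[OF _ eventually_ge_at_top[of 1]] eventually_happens'[OF sequentially_bot] by blast
  show ?thesis using that[of "2 * real j"] j unfolding S_def by simp
qed

text \<open>
  An infinite supply of words on a segment of length \<open>\<sigma>\<close>, so that their number can be chosen after
  their positions.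
\<close>

definition crowd_pt :: "nat \<Rightarrow> real \<Rightarrow> nat \<Rightarrow> nat \<Rightarrow> real" where
  "crowd_pt n \<sigma> k = (\<lambda>i\<in>{..<n}. if i = 0 then \<sigma> / real (Suc k) else 0)"

lemma inj_crowd_pt:
  assumes "n \<ge> 1" "\<sigma> > 0" shows "inj (crowd_pt n \<sigma>)"
proof (rule injI)
  fix k l assume "crowd_pt n \<sigma> k = crowd_pt n \<sigma> l"
  from fun_cong[OF this, of 0] show "k = l" using assms by (simp add: crowd_pt_def)
qed

text \<open>
  If the noise moves the word number \<open>k\<close> by more than \<open>\<sigma>\<close> in the direction of the segment, then all
  words with smaller numbers are closer to the output.
\<close>

lemma list_error_crowd_ge:
  fixes l n k :: nat
  assumes n: "n \<ge> 1" and \<sigma>: "\<sigma> > 0" and s: "s > 0" and C: "countable C" and k: "l \<le> k"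
    and sub: "\<And>j. j \<le> k \<Longrightarrow> lattice_pt n s (\<lambda>i. crowd_pt n \<sigma> j i + u i) z \<in> C"
  shows "exp (-2) / sqrt (2 * pi) \<le> list_error n \<sigma> l C (lattice_pt n s (\<lambda>i. crowd_pt n \<sigma> k i + u i) z)"
proof -
  interpret prob_space "awgn n \<sigma>" by (rule prob_space_awgn[OF \<sigma>])
  define q where "q j = lattice_pt n s (\<lambda>i. crowd_pt n \<sigma> j i + u i) z" for j
  have q0: "q j 0 = \<sigma> / real (Suc j) + u 0 + s * real_of_int (z 0)" for j
    using n by (simp add: q_def lattice_pt_def crowd_pt_def)
  have qi: "q j i = q k i" if "i \<noteq> 0" for i j
    using that by (simp add: q_def lattice_pt_def crowd_pt_def)
  have injq: "inj q"
  proof (rule injI)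
    fix a b assume "q a = q b"
    then have "q a 0 = q b 0" by simp
    then show "a = b" using \<sigma> unfolding q0 by simp
  qed
  have "{g \<in> space (awgn n \<sigma>). g 0 > \<sigma>} \<subseteq> list_event n \<sigma> l C (q k)"
  proof
    fix g assume "g \<in> {g \<in> space (awgn n \<sigma>). g 0 > \<sigma>}"
    then have g: "g \<in> space (awgn n \<sigma>)" "g 0 > \<sigma>" by auto
    let ?xs = "map q [0..<l]"
    have "L2_set (\<lambda>i. y i - (q k i + g i)) {..<n} < L2_set g {..<n}" if y: "y \<in> set ?xs" for y
    proof -
      obtain j where j: "j < l" "y = q j" using y by auto
      define d where "d = \<sigma> / real (Suc j) - \<sigma> / real (Suc k)"
      have "\<sigma> / real (Suc k) < \<sigma> / real (Suc j)"
        using j k \<sigma> by (intro divide_strict_left_mono) auto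
      moreover have "\<sigma> / real (Suc j) \<le> \<sigma>" using \<sigma> by (simp add: divide_le_eq)
      moreover have "\<sigma> / real (Suc k) > 0" using \<sigma> by simp
      ultimately have d: "0 < d" "d < \<sigma>" unfolding d_def by auto
      have split: "(\<Sum>i<n. h i) = h 0 + (\<Sum>i\<in>{..<n} - {0}. h i)" for h :: "nat \<Rightarrow> real"
        using n by (intro sum.remove) auto
      have "(\<Sum>i<n. (y i - (q k i + g i))\<^sup>2) = (d - g 0)\<^sup>2 + (\<Sum>i\<in>{..<n} - {0}. (g i)\<^sup>2)"
      proof -
        have "(\<Sum>i\<in>{..<n} - {0}. (y i - (q k i + g i))\<^sup>2) = (\<Sum>i\<in>{..<n} - {0}. (g i)\<^sup>2)"
          using qi[of _ j] j by (intro sum.cong) auto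
        moreover have "y 0 - (q k 0 + g 0) = d - g 0" unfolding j q0 d_def by simp
        ultimately show ?thesis unfolding split by (simp only:)
      qed
      also have "(d - g 0)\<^sup>2 < (g 0)\<^sup>2"
      proof -
        have "0 < d * (2 * g 0 - d)" using d g by (intro mult_pos_pos) auto
        then show ?thesis by (simp add: power2_eq_square algebra_simps)
      qed
      finally have "(\<Sum>i<n. (y i - (q k i + g i))\<^sup>2) < (\<Sum>i<n. (g i)\<^sup>2)"
        unfolding split[of "\<lambda>i. (g i)\<^sup>2"] by simp
      then show ?thesis unfolding L2_set_less_iff .
    qed
    moreover have "distinct ?xs" using injq by (simp add: distinct_map inj_on_subset[OF _ subset_UNIV])
    moreover have "set ?xs \<subseteq> C - {q k}"
      using sub injq k unfolding q_def[symmetric] by (auto dest: injD)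
    ultimately show "g \<in> list_event n \<sigma> l C (q k)"
      unfolding list_event_def using g(1) by (intro CollectI conjI exI[of _ ?xs]) auto
  qed
  then have "measure (awgn n \<sigma>) {g \<in> space (awgn n \<sigma>). g 0 > \<sigma>} \<le> list_error n \<sigma> l C (q k)"
    unfolding list_error_eq by (intro finite_measure_mono list_event_measurable C)
  then show ?thesis using awgn_first_coordinate[OF \<sigma> n] unfolding q_def by linarith
qed

text \<open>
  Unless \<open>\<bar>g\<bar> \<ge> D / 2\<close>, all words closer to the output than the sent one are within
  distance \<open>D\<close> of it and so belong to the same copy of \<open>X\<close>.
\<close>

lemma list_error_isolated_le:
  fixes n m l :: nat and u :: "nat \<Rightarrow> real"
  assumes n: "n \<ge> 1" and \<sigma>: "\<sigma> > 0" and D: "D > 0" and t: "t > 0"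
    and tail: "measure (awgn n \<sigma>) {g \<in> space (awgn n \<sigma>). D / 2 \<le> L2_set g {..<n}} \<le> e"
    and X: "finite X" "X \<subseteq> {..<n} \<rightarrow>\<^sub>E {D + \<sigma>..D + \<sigma> + t}" and s: "s = t + 2 * (D + \<sigma>)"
    and y: "y \<in> X" and z: "z \<in> int_vectors n"
  defines "C \<equiv> periodic_code n s u (X \<union> crowd_pt n \<sigma> ` {..<m})"
  shows "list_error n \<sigma> l C (lattice_pt n s (\<lambda>i. y i + u i) z) \<le> list_error n \<sigma> l X y + e"
proof -
  interpret prob_space "awgn n \<sigma>" by (rule prob_space_awgn[OF \<sigma>])
  define x where "x = lattice_pt n s (\<lambda>i. y i + u i) z"
  let ?F = "{g \<in> space (awgn n \<sigma>). D / 2 \<le> L2_set g {..<n}}"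
  have near: "\<exists>c\<in>X. c \<noteq> y \<and> w = lattice_pt n s (\<lambda>i. c i + u i) z"
    if w: "w \<in> C" "w \<noteq> x" and close: "\<And>i. i < n \<Longrightarrow> \<bar>w i - x i\<bar> < D" for w
  proof -
    obtain c z' where c: "c \<in> X \<union> crowd_pt n \<sigma> ` {..<m}" and z': "z' \<in> int_vectors n"
      and weq: "w = lattice_pt n s (\<lambda>i. c i + u i) z'"
      using w(1) unfolding C_def periodic_code_def by auto
    have diff: "w i - x i = c i - y i + s * real_of_int (z' i - z i)" if "i < n" for i
      using that by (simp add: weq x_def lattice_pt_def algebra_simps)
    have yi: "D + \<sigma> \<le> y i \<and> y i \<le> D + \<sigma> + t" if "i < n" for i
      using PiE_mem[OF subsetD[OF X(2) y], of i] that by simp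
    have spos: "s > 0" using D \<sigma> t s by simp
    have cX: "c \<in> X"
    proof (rule ccontr)
      assume "c \<notin> X"
      then obtain k where "c = crowd_pt n \<sigma> k" using c by auto
      then have c0: "0 < c 0" "c 0 \<le> \<sigma>" using n \<sigma> by (auto simp: crowd_pt_def divide_le_eq)
      have n0: "0 < n" using n by simp
      show False
      proof (cases "z' 0 - z 0 \<le> 0")
        case True
        then have "s * real_of_int (z' 0 - z 0) \<le> 0" using spos by (intro mult_nonneg_nonpos) auto
        then show False using close[OF n0] diff[OF n0] yi[OF n0] c0 by linarith
      next
        case False
        then have "s * 1 \<le> s * real_of_int (z' 0 - z 0)" using spos by (intro mult_left_mono) auto
        then have "s \<le> w 0 - x 0 + y 0 - c 0" using diff[OF n0] by linarith
        moreover have "w 0 - x 0 < D" using close[OF n0] by (simp only: abs_less_iff)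
        moreover have "y 0 \<le> D + \<sigma> + t" using yi[OF n0] by (rule conjunct2)
        moreover have "s = t + 2 * D + 2 * \<sigma>" using s by simp
        ultimately show False using c0 \<sigma> by linarith
      qed
    qed
    have "z' i = z i" if i: "i < n" for i
    proof -
      have ci: "D + \<sigma> \<le> c i \<and> c i \<le> D + \<sigma> + t" using PiE_mem[OF subsetD[OF X(2) cX], of i] i by simp
      have "\<bar>s * real_of_int (z' i - z i)\<bar> < s"
      proof -
        have "\<bar>c i - y i\<bar> \<le> t" using yi[OF i] ci by (simp add: abs_le_iff)
        then have "\<bar>s * real_of_int (z' i - z i)\<bar> < D + t" using close[OF i] unfolding diff[OF i] by linarith
        also have "D + t < s" using s D \<sigma> by simp
        finally show ?thesis .
      qed
      then have "s * \<bar>real_of_int (z' i - z i)\<bar> < s * 1" using spos by (simp add: abs_mult)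
      then have "\<bar>real_of_int (z' i - z i)\<bar> < 1" using spos by (simp only: mult_less_cancel_left_pos)
      then have "\<bar>z' i - z i\<bar> < 1" by linarith
      then show ?thesis by simp
    qed
    then have "z' = z" using z z' by (intro PiE_ext[of z' _ _ z]) auto
    then have "w = lattice_pt n s (\<lambda>i. c i + u i) z" using weq by simp
    moreover have "c \<noteq> y" using calculation w(2) unfolding x_def by auto
    ultimately show ?thesis using cX by blast
  qed
  have "list_event n \<sigma> l C x \<subseteq> list_event n \<sigma> l X y \<union> ?F"
  proof
    fix g assume "g \<in> list_event n \<sigma> l C x"
    then obtain xs where g: "g \<in> space (awgn n \<sigma>)" and xs: "length xs = l" "distinct xs" "set xs \<subseteq> C - {x}"
      "\<And>w. w \<in> set xs \<Longrightarrow> L2_set (\<lambda>i. w i - (x i + g i)) {..<n} < L2_set g {..<n}"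
      unfolding list_event_def by blast
    show "g \<in> list_event n \<sigma> l X y \<union> ?F"
    proof (cases "D / 2 \<le> L2_set g {..<n}")
      case False
      define h where "h w = (\<lambda>i\<in>{..<n}. w i - u i - s * real_of_int (z i))" for w :: "nat \<Rightarrow> real"
      have pull: "h w \<in> X \<and> h w \<noteq> y \<and> w = lattice_pt n s (\<lambda>i. h w i + u i) z" if w: "w \<in> set xs" for w
      proof -
        have "\<bar>w i - x i\<bar> < D" if i: "i < n" for i
        proof -
          have "\<bar>w i - x i\<bar> \<le> L2_set (\<lambda>i. \<bar>w i - x i\<bar>) {..<n}"
            using i by (intro member_le_L2_set) auto
          also have "\<dots> = L2_set (\<lambda>i. (w i - (x i + g i)) + g i) {..<n}"
            unfolding L2_set_abs_eq by simp
          also have "\<dots> \<le> L2_set (\<lambda>i. w i - (x i + g i)) {..<n} + L2_set g {..<n}"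
            by (rule L2_set_triangle_ineq)
          also have "\<dots> < D" using xs(4)[OF w] False by simp
          finally show ?thesis .
        qed
        then obtain c where c: "c \<in> X" "c \<noteq> y" "w = lattice_pt n s (\<lambda>i. c i + u i) z"
          using near[of w] w xs(3) by blast
        moreover have "h w = c"
          using c(1,3) X(2) by (intro PiE_ext[of _ "{..<n}" "\<lambda>_. UNIV"]) (auto simp: h_def lattice_pt_def)
        ultimately show ?thesis by simp
      qed
      have "distinct (map h xs)"
      proof -
        have "inj_on h (set xs)" by (rule inj_onI) (metis pull)
        then show ?thesis using xs(2) by (simp add: distinct_map)
      qed
      moreover have "set (map h xs) \<subseteq> X - {y}" using pull by auto
      moreover have "L2_set (\<lambda>i. v i - (y i + g i)) {..<n} < L2_set g {..<n}" if v: "v \<in> set (map h xs)" for v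
      proof -
        obtain w where w: "w \<in> set xs" "v = h w" using v by auto
        have "L2_set (\<lambda>i. v i - (y i + g i)) {..<n} = L2_set (\<lambda>i. w i - (x i + g i)) {..<n}"
        proof (rule L2_set_cong[OF refl])
          fix i assume "i \<in> {..<n}"
          then have "w i = v i + u i + s * real_of_int (z i)" "x i = y i + u i + s * real_of_int (z i)"
            unfolding w x_def by (auto simp: h_def lattice_pt_def)
          then show "v i - (y i + g i) = w i - (x i + g i)" by simp
        qed
        then show ?thesis using xs(4)[OF w(1)] by simp
      qed
      ultimately have "g \<in> list_event n \<sigma> l X y"
        unfolding list_event_def using g xs(1) by (intro CollectI conjI exI[of _ "map h xs"]) auto
      then show ?thesis by blast
    qed (use g in auto)
  qed
  moreover have X': "list_event n \<sigma> l X y \<in> sets (awgn n \<sigma>)"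
    using X(1) by (intro list_event_measurable countable_finite)
  moreover have F: "?F \<in> sets (awgn n \<sigma>)" by measurable
  ultimately have "measure (awgn n \<sigma>) (list_event n \<sigma> l C x) \<le> measure (awgn n \<sigma>) (list_event n \<sigma> l X y \<union> ?F)"
    by (intro finite_measure_mono) auto
  also have "\<dots> \<le> measure (awgn n \<sigma>) (list_event n \<sigma> l X y) + measure (awgn n \<sigma>) ?F"
    using X' F by (intro measure_Un_le)
  finally show ?thesis using tail unfolding list_error_eq x_def by linarith
qed

section \<open>The code in a fixed dimension\<close>

text \<open>
  The guard band costs at most half of the volume once the cube is large.
\<close>

lemma large_side_exists:
  fixes a R :: real
  assumes a: "a > 0" and n: "n \<ge> 1"
  obtains t where "t > 0" "(t + a) ^ n \<le> 2 * t ^ n" "R \<le> t ^ n"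
proof -
  define t where "t = Max {1, R, 2 * real n * a}"
  have t: "t \<ge> 1" "t \<ge> R" "t \<ge> 2 * real n * a" unfolding t_def by (auto intro!: Max_ge)
  have ta: "t + a > 0" using t a by linarith
  have "1 / 2 \<le> 1 + real n * (- (a / (t + a)))"
  proof -
    have "real n * a \<le> 1 / 2 * (t + a)" using t(3) a by simp
    then have "real n * a / (t + a) \<le> 1 / 2" using ta by (simp add: pos_divide_le_eq)
    then show ?thesis by simp
  qed
  also have "\<dots> \<le> (1 + - (a / (t + a))) ^ n"
    using ta t a by (intro Bernoulli_inequality) (simp add: pos_divide_le_eq)
  also have "1 + - (a / (t + a)) = t / (t + a)" using ta by (simp add: field_simps)
  finally have "1 / 2 \<le> t ^ n / (t + a) ^ n" by (simp only: power_divide)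
  then have "(t + a) ^ n \<le> 2 * t ^ n" using ta by (simp add: pos_le_divide_eq)
  moreover have "R \<le> t ^ n" using t n self_le_power[of t n] by simp
  moreover have "t > 0" using t(1) by simp
  ultimately show ?thesis by (intro that)
qed

lemma le_Limsup_of_frequently:
  fixes f :: "real \<Rightarrow> ereal"
  assumes "\<exists>\<^sub>F x in F. c \<le> f x" shows "c \<le> Limsup F f"
proof (rule ccontr)
  assume "\<not> c \<le> Limsup F f"
  then have "\<forall>\<^sub>F x in F. f x < c" by (intro Limsup_lessD) simp
  with assms have "\<exists>\<^sub>F x in F. f x < c \<and> c \<le> f x" by (rule frequently_eventually_conj)
  then show False by (simp add: frequently_def flip: not_le)
qed

lemma ext_ln_le:
  assumes "x \<le> ereal a" "a > 0" shows "ext_ln x \<le> ereal (ln a)"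
  using assms by (cases x) (auto simp: ext_ln_def)

lemma ext_ln_ge:
  assumes "ereal a \<le> x" "a > 0" shows "ereal (ln a) \<le> ext_ln x"
  using assms by (cases x) (auto simp: ext_ln_def)

text \<open>
  The guard width \<open>D\<close> is chosen first, from the noise; then the side \<open>t\<close>, so large that a single
  additional word per period makes up less than the fraction \<open>\<epsilon> / (2 * L)\<close> of the code in every large
  dilate of the body; then the translation \<open>u\<close>; and last the number \<open>m\<close> of crowded words.
  At the least \<open>m\<close> whose crowd reaches the fraction \<open>\<epsilon>\<close> for arbitrarily large \<open>K\<close>, the crowd stays
  eventually below \<open>2 * \<epsilon>\<close>. Its first \<open>L - 1\<close> words need not have large error, but they amount to
  less than half of that fraction.
\<close>

lemma code_exists_in_dimension:
  fixes \<sigma> \<alpha> :: real and L n :: nat and B :: "(nat \<Rightarrow> real) set"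
  assumes n: "n \<ge> 1" and \<sigma>: "\<sigma> > 0" and \<alpha>: "\<alpha> \<ge> 1" and L: "L \<ge> 2" and B: "reference_body n B"
  defines "\<delta> \<equiv> exp (- real n * max 0 (exponent_ex L \<alpha>))" and "\<Delta> \<equiv> critical_density n \<sigma> \<alpha>"
  obtains C where "unbounded_code n C"
    "ereal (1 / real n) * ereal (ln (\<Delta> / 128)) \<le> code_rate n B C"
    "code_rate n B C \<le> ereal (1 / real n) * ereal (ln \<Delta>)"
    "ereal (exp (-2) / sqrt (2 * pi) / 8 * \<delta>) \<le> avg_list_error n \<sigma> (L - 1) B C"
    "avg_list_error n \<sigma> (L - 1) B C \<le> ereal (10 * \<delta>)"
proof -
  interpret prob_space "awgn n \<sigma>" by (rule prob_space_awgn[OF \<sigma>])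
  define c0 :: real where "c0 = exp (-2) / sqrt (2 * pi)"
  have c0: "c0 > 0" unfolding c0_def by simp
  have \<delta>: "\<delta> > 0" "\<delta> \<le> 1" unfolding \<delta>_def by auto
  have \<Delta>: "\<Delta> > 0" unfolding \<Delta>_def critical_density_def using \<sigma> \<alpha> by simp
  \<comment> \<open>Intended fraction of crowded words: with it, the two contributions to the average error have the same order.\<close>
  define \<epsilon> where "\<epsilon> = \<delta> / 4"
  have \<epsilon>: "\<epsilon> > 0" "\<epsilon> \<le> 1 / 4" using \<delta> unfolding \<epsilon>_def by auto
  define V where "V = measure (lebesgue_Rn n) B"
  have V: "V > 0" unfolding V_def by (rule emeasure_reference_body[OF B])
  obtain w where w: "w > 0" and lower: "\<And>s. s > 0 \<Longrightarrow> \<forall>\<^sub>F K in at_top. \<forall>v.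
     K ^ n * w \<le> real (card (lattice_hits n s (scale_set n K B) v)) * s ^ n"
    using lattice_hits_body_lower[OF B] by blast
  obtain D where D: "D > 0" and tail: "measure (awgn n \<sigma>) {g \<in> space (awgn n \<sigma>). D / 2 \<le> L2_set g {..<n}} \<le> \<delta>"
    using awgn_radius_tail[OF \<sigma> \<delta>(1)] by blast
  \<comment> \<open>The ratio \<open>V / w\<close> compares the counts in the body for any two translations of the lattice.\<close>
  define M0 where "M0 = 4 * V * real L / (w * \<epsilon>)"
  define R where "R = max (16 / \<Delta>) (32 * M0 / \<Delta>)"
  obtain t where t: "t > 0" "(t + 2 * (D + \<sigma>)) ^ n \<le> 2 * t ^ n" "R \<le> t ^ n"
    using large_side_exists[of "2 * (D + \<sigma>)" n R] D \<sigma> n by auto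
  define s where "s = t + 2 * (D + \<sigma>)"
  have s: "s > 0" "s \<ge> t" using t D \<sigma> unfolding s_def by auto
  have sn: "s ^ n > 0" "t ^ n \<le> s ^ n" "s ^ n \<le> 2 * t ^ n"
    using s t unfolding s_def by (auto intro: power_mono)
  define N0 where "N0 = nat \<lfloor>\<Delta> * t ^ n / 8\<rfloor>"
  have tR: "16 \<le> \<Delta> * t ^ n" "32 * M0 \<le> \<Delta> * t ^ n"
    using t(3) \<Delta> unfolding R_def by (auto simp: field_simps)
  have N0: "real N0 \<le> \<Delta> * t ^ n / 8" "real N0 \<ge> \<Delta> * t ^ n / 16" "N0 \<ge> 1"
  proof -
    have e: "real N0 = real_of_int \<lfloor>\<Delta> * t ^ n / 8\<rfloor>" unfolding N0_def using tR(1) by simp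
    show "real N0 \<le> \<Delta> * t ^ n / 8" unfolding e by (rule of_int_floor_le)
    have "real N0 > \<Delta> * t ^ n / 8 - 1" unfolding e by linarith
    then show "real N0 \<ge> \<Delta> * t ^ n / 16" using tR(1) by linarith
    then have "real N0 \<ge> 1" using tR(1) by linarith
    then show "N0 \<ge> 1" by simp
  qed
  obtain X where X: "finite X" "X \<subseteq> {..<n} \<rightarrow>\<^sub>E {D + \<sigma>..D + \<sigma> + t}" "real (card X) \<ge> real N0 / 2" "card X \<le> N0"
    and errX: "\<And>x. x \<in> X \<Longrightarrow> list_error n \<sigma> (L - 1) X x \<le> 8 * exp (- n * exponent_ex L \<alpha>)"
    using finite_code_exists[OF n \<sigma> \<alpha> L t(1) N0(3) N0(1)[unfolded \<Delta>_def], of "D + \<sigma>"] by blast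
  define M where "M = real (card X)"
  have M: "M \<ge> \<Delta> * t ^ n / 32" "M \<le> \<Delta> * t ^ n / 8" "M > 0" "M \<ge> M0"
    using X(3,4) N0 tR unfolding M_def by auto
  have Xne: "X \<noteq> {}" using M(3) unfolding M_def by auto
  have errX': "list_error n \<sigma> (L - 1) X x \<le> 8 * \<delta>" if "x \<in> X" for x
  proof (cases "exponent_ex L \<alpha> \<ge> 0")
    case True
    then show ?thesis using errX[OF that] unfolding \<delta>_def by simp
  next
    case False
    then have "\<delta> = 1" unfolding \<delta>_def by simp
    moreover have "list_error n \<sigma> (L - 1) X x \<le> 1" unfolding list_error_eq by (rule prob_le_1)
    ultimately show ?thesis by simp
  qed
  define cnt where "cnt K v = real (card (lattice_hits n s (scale_set n K B) v))" for K v
  obtain u where u: "\<exists>\<^sub>F K in at_top. M * K ^ n * V \<le> 2 * s ^ n * (\<Sum>y\<in>X. cnt K (\<lambda>i. y i + u i))"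
    using exists_good_shift[OF B s(1) X(1) Xne] unfolding M_def V_def cnt_def by blast
  define crowd where "crowd = crowd_pt n \<sigma>"
  define C where "C m = periodic_code n s u (X \<union> crowd ` {..<m})" for m
  define base where "base K = (\<Sum>y\<in>X. cnt K (\<lambda>i. y i + u i))" for K
  define bad where "bad m K = (\<Sum>k<m. cnt K (\<lambda>i. crowd k i + u i))" for m K
  define total where "total m K = base K + bad m K" for m K
  define S where "S m K = (\<Sum>x\<in>C m \<inter> scale_set n K B. list_error n \<sigma> (L - 1) (C m) x)" for m K
  have cnt0: "cnt K v \<ge> 0" for K v unfolding cnt_def by simp
  have bad0: "bad m K \<ge> 0" for m K unfolding bad_def using cnt0 by (intro sum_nonneg) auto
  have X_cube: "X \<subseteq> half_open_cube n s"
  proof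
    fix x assume "x \<in> X"
    then have x: "x \<in> {..<n} \<rightarrow>\<^sub>E {D + \<sigma>..D + \<sigma> + t}" using X by blast
    have "x i \<in> {0..<s}" if "i < n" for i
      using PiE_mem[OF x, of i] that D \<sigma> unfolding s_def by auto
    then show "x \<in> half_open_cube n s" using x unfolding half_open_cube_def by (auto simp: PiE_iff)
  qed
  have crowd_cube: "crowd k \<in> half_open_cube n s" for k
  proof -
    have "\<sigma> / real (Suc k) \<le> \<sigma>" using \<sigma> by (simp add: divide_le_eq)
    also have "\<sigma> < s" using D \<sigma> t unfolding s_def by simp
    finally show ?thesis using s \<sigma> unfolding crowd_def crowd_pt_def half_open_cube_def by auto
  qed
  have disj: "X \<inter> crowd ` {..<m} = {}" for m
  proof -
    have "crowd k \<notin> X" for k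
    proof
      assume "crowd k \<in> X"
      then have "D + \<sigma> \<le> crowd k 0" using PiE_mem[OF subsetD[OF X(2)], of "crowd k" 0] n by auto
      moreover have "crowd k 0 \<le> \<sigma>" using n \<sigma> by (simp add: crowd_def crowd_pt_def divide_le_eq)
      ultimately show False using D by linarith
    qed
    then show ?thesis by auto
  qed
  have inj: "inj crowd" unfolding crowd_def by (rule inj_crowd_pt[OF n \<sigma>])
  have finY: "finite (X \<union> crowd ` {..<m})" and Y_cube: "X \<union> crowd ` {..<m} \<subseteq> half_open_cube n s" for m
    using X(1) X_cube crowd_cube by auto
  note bnd = scale_set_bounded[OF reference_body_bounded[OF B]]
  have sum_C: "(\<Sum>x\<in>C m \<inter> scale_set n K B. f x)
     = (\<Sum>y\<in>X. \<Sum>z\<in>lattice_hits n s (scale_set n K B) (\<lambda>i. y i + u i). f (lattice_pt n s (\<lambda>i. y i + u i) z))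
     + (\<Sum>k<m. \<Sum>z\<in>lattice_hits n s (scale_set n K B) (\<lambda>i. crowd k i + u i). f (lattice_pt n s (\<lambda>i. crowd k i + u i) z))"
    for m K and f :: "(nat \<Rightarrow> real) \<Rightarrow> real"
    unfolding C_def sum_periodic_code(2)[OF s(1) finY Y_cube bnd]
    using X(1) disj by (subst sum.union_disjoint) (auto simp: sum.reindex[OF inj_on_subset[OF inj subset_UNIV]] comp_def)
  have card_C: "real (card (C m \<inter> scale_set n K B)) = total m K" for m K
    using sum_C[of "\<lambda>_. 1" m K] unfolding total_def base_def bad_def cnt_def by simp
  have unb: "unbounded_code n (C m)" for m
    unfolding C_def by (rule periodic_code_unbounded_code[OF s(1) finY Y_cube])
  have countC: "countable (C m)" for m using unb unfolding unbounded_code_def by blast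
  have err_le_1: "list_error n \<sigma> (L - 1) C' x \<le> 1" for C' x unfolding list_error_eq by (rule prob_le_1)
  have err_ge_0: "list_error n \<sigma> (L - 1) C' x \<ge> 0" for C' x unfolding list_error_eq by simp
  have S_upper: "S m K \<le> 9 * \<delta> * base K + bad m K" for m K
  proof -
    have "(\<Sum>y\<in>X. \<Sum>z\<in>lattice_hits n s (scale_set n K B) (\<lambda>i. y i + u i). list_error n \<sigma> (L - 1) (C m) (lattice_pt n s (\<lambda>i. y i + u i) z))
       \<le> (\<Sum>y\<in>X. \<Sum>z\<in>lattice_hits n s (scale_set n K B) (\<lambda>i. y i + u i). 9 * \<delta>)"
    proof (intro sum_mono)
      fix y z assume y: "y \<in> X" and z: "z \<in> lattice_hits n s (scale_set n K B) (\<lambda>i. y i + u i)"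
      have "list_error n \<sigma> (L - 1) (C m) (lattice_pt n s (\<lambda>i. y i + u i) z) \<le> list_error n \<sigma> (L - 1) X y + \<delta>"
        using z unfolding C_def crowd_def
        by (intro list_error_isolated_le[OF n \<sigma> D t(1) tail X(1,2) s_def y]) (simp add: lattice_hits_def)
      then show "list_error n \<sigma> (L - 1) (C m) (lattice_pt n s (\<lambda>i. y i + u i) z) \<le> 9 * \<delta>"
        using errX'[OF y] by simp
    qed
    also have "\<dots> = 9 * \<delta> * base K" unfolding base_def cnt_def by (simp add: sum_distrib_left mult.commute)
    finally have 1: "(\<Sum>y\<in>X. \<Sum>z\<in>lattice_hits n s (scale_set n K B) (\<lambda>i. y i + u i). list_error n \<sigma> (L - 1) (C m) (lattice_pt n s (\<lambda>i. y i + u i) z)) \<le> 9 * \<delta> * base K" .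
    have "(\<Sum>k<m. \<Sum>z\<in>lattice_hits n s (scale_set n K B) (\<lambda>i. crowd k i + u i). list_error n \<sigma> (L - 1) (C m) (lattice_pt n s (\<lambda>i. crowd k i + u i) z))
       \<le> (\<Sum>k<m. \<Sum>z\<in>lattice_hits n s (scale_set n K B) (\<lambda>i. crowd k i + u i). 1)"
      by (intro sum_mono err_le_1)
    also have "\<dots> = bad m K" unfolding bad_def cnt_def by simp
    finally show ?thesis using 1 unfolding S_def sum_C by linarith
  qed
  have S_lower: "c0 * (\<Sum>k\<in>{L - 1..<m}. cnt K (\<lambda>i. crowd k i + u i)) \<le> S m K" for m K
  proof -
    have "c0 * (\<Sum>k\<in>{L - 1..<m}. cnt K (\<lambda>i. crowd k i + u i))
       = (\<Sum>k\<in>{L - 1..<m}. \<Sum>z\<in>lattice_hits n s (scale_set n K B) (\<lambda>i. crowd k i + u i). c0)"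
      unfolding cnt_def by (simp add: sum_distrib_left mult.commute)
    also have "\<dots> \<le> (\<Sum>k\<in>{L - 1..<m}. \<Sum>z\<in>lattice_hits n s (scale_set n K B) (\<lambda>i. crowd k i + u i). list_error n \<sigma> (L - 1) (C m) (lattice_pt n s (\<lambda>i. crowd k i + u i) z))"
    proof (intro sum_mono)
      fix k z assume k: "k \<in> {L - 1..<m}" and z: "z \<in> lattice_hits n s (scale_set n K B) (\<lambda>i. crowd k i + u i)"
      have "lattice_pt n s (\<lambda>i. crowd j i + u i) z \<in> C m" if "j \<le> k" for j
        using that k z unfolding C_def periodic_code_def
        by (intro image_eqI[where x="(crowd j, z)"]) (auto simp: lattice_hits_def)
      then show "c0 \<le> list_error n \<sigma> (L - 1) (C m) (lattice_pt n s (\<lambda>i. crowd k i + u i) z)"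
        unfolding c0_def crowd_def using k by (intro list_error_crowd_ge[OF n \<sigma> s(1) countC]) auto
    qed
    also have "\<dots> \<le> (\<Sum>k<m. \<Sum>z\<in>lattice_hits n s (scale_set n K B) (\<lambda>i. crowd k i + u i). list_error n \<sigma> (L - 1) (C m) (lattice_pt n s (\<lambda>i. crowd k i + u i) z))"
      using err_ge_0 by (intro sum_mono2 sum_nonneg) auto
    also have "\<dots> \<le> S m K" unfolding S_def sum_C using err_ge_0 by (simp add: sum_nonneg)
    finally show ?thesis .
  qed
  \<comment> \<open>The counts for all translations have the same order, with constants depending on the body.\<close>
  define good where "good K \<longleftrightarrow> K > 0 \<and> (\<forall>v. cnt K v * s ^ n \<le> 2 * K ^ n * V) \<and> (\<forall>v. K ^ n * w \<le> cnt K v * s ^ n)" for K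
  have ev_good: "\<forall>\<^sub>F K in at_top. good K"
    unfolding good_def using lattice_hits_body_upper[OF B s(1)] lower[OF s(1)] eventually_gt_at_top[of 0]
    unfolding cnt_def V_def by eventually_elim auto
  have base_lower: "M * (K ^ n * w) \<le> base K * s ^ n" and base_upper: "base K * s ^ n \<le> M * (2 * K ^ n * V)"
    and base_pos: "base K > 0" and cnt_le: "\<And>v. cnt K v \<le> \<epsilon> / (2 * L) * base K" if K: "good K" for K
  proof -
    have "M * (K ^ n * w) = (\<Sum>y\<in>X. K ^ n * w)" unfolding M_def by simp
    also have "\<dots> \<le> (\<Sum>y\<in>X. cnt K (\<lambda>i. y i + u i) * s ^ n)" using K unfolding good_def by (intro sum_mono) auto
    finally show lo: "M * (K ^ n * w) \<le> base K * s ^ n" unfolding base_def sum_distrib_right .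
    have "base K * s ^ n \<le> (\<Sum>y\<in>X. 2 * K ^ n * V)"
      unfolding base_def sum_distrib_right using K unfolding good_def by (intro sum_mono) auto
    then show "base K * s ^ n \<le> M * (2 * K ^ n * V)" unfolding M_def by simp
    have "0 < M * (K ^ n * w)" using M w K unfolding good_def by simp
    then have "0 < base K * s ^ n" using lo by linarith
    then show "base K > 0" using sn(1) by (rule zero_less_mult_pos2)
    fix v
    have "cnt K v * s ^ n \<le> 2 * K ^ n * V" using K unfolding good_def by blast
    also have "\<dots> = \<epsilon> / (2 * L) * (M0 * (K ^ n * w))"
      unfolding M0_def using w \<epsilon> L by (simp add: field_simps)
    also have "\<dots> \<le> \<epsilon> / (2 * L) * (M * (K ^ n * w))"
      using M(4) w K \<epsilon> unfolding good_def by (intro mult_left_mono mult_right_mono) auto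
    also have "\<dots> \<le> \<epsilon> / (2 * L) * (base K * s ^ n)"
      using lo \<epsilon> by (intro mult_left_mono) auto
    finally have "cnt K v * s ^ n \<le> (\<epsilon> / (2 * L) * base K) * s ^ n" by (simp only: mult.assoc)
    then show "cnt K v \<le> \<epsilon> / (2 * L) * base K" using sn(1) by (rule mult_right_le_imp_le)
  qed
  define P where "P m \<longleftrightarrow> (\<exists>\<^sub>F K in at_top. \<epsilon> * total m K \<le> bad m K)" for m
  have ex: "\<exists>m. P m"
  proof -
    obtain m where m: "2 * M * V / w \<le> real m" using real_arch_simple by blast
    have "\<forall>\<^sub>F K in at_top. \<epsilon> * total m K \<le> bad m K"
      using ev_good
    proof eventually_elim
      case (elim K)
      have "base K * s ^ n \<le> M * (2 * K ^ n * V)" by (rule base_upper[OF elim])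
      also have "\<dots> = 2 * M * V / w * (K ^ n * w)" using w by simp
      also have "\<dots> \<le> real m * (K ^ n * w)"
        using m w elim unfolding good_def by (intro mult_right_mono) auto
      also have "\<dots> = (\<Sum>k<m. K ^ n * w)" by simp
      also have "\<dots> \<le> (\<Sum>k<m. cnt K (\<lambda>i. crowd k i + u i) * s ^ n)"
        using elim unfolding good_def by (intro sum_mono) auto
      also have "\<dots> = bad m K * s ^ n" unfolding bad_def by (rule sum_distrib_right[symmetric])
      finally have "base K \<le> bad m K" using sn(1) by (rule mult_right_le_imp_le)
      then have "total m K \<le> 2 * bad m K" unfolding total_def by simp
      then have "\<epsilon> * total m K \<le> \<epsilon> * (2 * bad m K)" using \<epsilon> by (intro mult_left_mono) auto
      also have "\<dots> \<le> 1 * bad m K" using \<epsilon> bad0[of m K] unfolding mult.assoc[symmetric] by (intro mult_right_mono) auto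
      finally show ?case by simp
    qed
    then have "P m" unfolding P_def by (intro eventually_frequently) auto
    then show ?thesis ..
  qed
  define m where "m = (LEAST m. P m)"
  have Pm: "P m" unfolding m_def using ex by (rule LeastI_ex)
  have bad_upper: "\<forall>\<^sub>F K in at_top. bad m K \<le> 2 * \<epsilon> * total m K"
  proof (cases m)
    case 0
    have "bad 0 K \<le> 2 * \<epsilon> * total 0 K" if "good K" for K
      using base_pos[OF that] \<epsilon> by (simp add: bad_def total_def)
    then show ?thesis unfolding 0 using ev_good by (auto elim: eventually_mono)
  next
    case (Suc m')
    have "\<not> P m'" using Suc not_less_Least[of m' P] unfolding m_def by simp
    then have "\<forall>\<^sub>F K in at_top. bad m' K < \<epsilon> * total m' K"
      unfolding P_def not_frequently by (simp add: not_le)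
    with ev_good show ?thesis
    proof eventually_elim
      case (elim K)
      have eq: "bad m K = bad m' K + cnt K (\<lambda>i. crowd m' i + u i)" unfolding bad_def Suc by simp
      have tt: "total m' K \<le> total m K" "base K \<le> total m K"
        using cnt0 bad0 unfolding total_def eq by auto
      have "cnt K (\<lambda>i. crowd m' i + u i) \<le> \<epsilon> / (2 * L) * base K" by (rule cnt_le[OF elim(1)])
      also have "\<dots> \<le> \<epsilon> * total m K"
        using \<epsilon> L tt(2) base_pos[OF elim(1)] by (intro mult_mono) (auto simp: field_simps)
      finally have "cnt K (\<lambda>i. crowd m' i + u i) \<le> \<epsilon> * total m K" .
      moreover have "bad m' K \<le> \<epsilon> * total m K"
        using elim(2) tt(1) \<epsilon> by (smt (verit) mult_left_mono)
      ultimately show ?case unfolding eq by linarith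
    qed
  qed
  have total_pos: "total m K > 0" if "good K" for K
    using base_pos[OF that] bad0[of m K] unfolding total_def by linarith
  have "avg_list_error n \<sigma> (L - 1) B (C m) \<le> ereal (10 * \<delta>)"
    unfolding avg_list_error_def
  proof (rule Limsup_bounded)
    show "\<forall>\<^sub>F K in at_top. ereal (1 / real (card (C m \<inter> scale_set n K B)) *
            (\<Sum>x\<in>C m \<inter> scale_set n K B. list_error n \<sigma> (L - 1) (C m) x)) \<le> ereal (10 * \<delta>)"
      using ev_good bad_upper
    proof eventually_elim
      case (elim K)
      have "S m K \<le> 9 * \<delta> * base K + bad m K" by (rule S_upper)
      also have "\<dots> \<le> 9 * \<delta> * total m K + 2 * \<epsilon> * total m K"
        using elim(2) bad0[of m K] \<delta> by (intro add_mono mult_left_mono) (auto simp: total_def)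
      also have "\<dots> \<le> 10 * \<delta> * total m K"
        using \<delta> total_pos[OF elim(1)] unfolding \<epsilon>_def by (simp add: field_simps)
      finally have "1 / total m K * S m K \<le> 10 * \<delta>"
        using total_pos[OF elim(1)] by (simp add: pos_divide_le_eq)
      then show ?case unfolding card_C S_def by simp
    qed
  qed
  moreover have "ereal (c0 / 8 * \<delta>) \<le> avg_list_error n \<sigma> (L - 1) B (C m)"
    unfolding avg_list_error_def
  proof (rule le_Limsup_of_frequently)
    have "\<exists>\<^sub>F K in at_top. good K \<and> \<epsilon> * total m K \<le> bad m K"
      using Pm ev_good unfolding P_def by (rule frequently_eventually_conj)
    then show "\<exists>\<^sub>F K in at_top. ereal (c0 / 8 * \<delta>) \<le> ereal (1 / real (card (C m \<inter> scale_set n K B)) *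
            (\<Sum>x\<in>C m \<inter> scale_set n K B. list_error n \<sigma> (L - 1) (C m) x))"
    proof (rule frequently_elim1)
      fix K assume K: "good K \<and> \<epsilon> * total m K \<le> bad m K"
      let ?c = "\<lambda>k. cnt K (\<lambda>i. crowd k i + u i)"
      have "bad m K \<le> (\<Sum>k\<in>{..<L - 1} \<union> {L - 1..<m}. ?c k)"
        unfolding bad_def using cnt0 by (intro sum_mono2) auto
      also have "\<dots> = (\<Sum>k<L - 1. ?c k) + (\<Sum>k\<in>{L - 1..<m}. ?c k)"
        by (intro sum.union_disjoint) auto
      also have "(\<Sum>k<L - 1. ?c k) \<le> (\<Sum>k<L - 1. \<epsilon> / (2 * L) * base K)"
        using K by (intro sum_mono cnt_le) auto
      also have "\<dots> = real (L - 1) * (\<epsilon> / (2 * L) * base K)" by simp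
      also have "\<dots> \<le> real L * (\<epsilon> / (2 * L) * base K)"
        using \<epsilon> base_pos[of K] K by (intro mult_right_mono) auto
      also have "\<dots> = \<epsilon> / 2 * base K" using L by simp
      also have "\<dots> \<le> \<epsilon> / 2 * total m K"
        using \<epsilon> bad0[of m K] unfolding total_def by (intro mult_left_mono) auto
      finally have "bad m K \<le> \<epsilon> / 2 * total m K + (\<Sum>k\<in>{L - 1..<m}. ?c k)" by simp
      then have "\<epsilon> / 2 * total m K \<le> (\<Sum>k\<in>{L - 1..<m}. ?c k)" using K by simp
      then have "c0 * (\<epsilon> / 2 * total m K) \<le> c0 * (\<Sum>k\<in>{L - 1..<m}. ?c k)"
        using c0 by (intro mult_left_mono) auto
      also have "\<dots> \<le> S m K" by (rule S_lower)
      finally have "c0 / 8 * \<delta> \<le> 1 / total m K * S m K"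
        using total_pos[of K] K unfolding \<epsilon>_def by (simp add: field_simps)
      then show "ereal (c0 / 8 * \<delta>) \<le> ereal (1 / real (card (C m \<inter> scale_set n K B)) *
            (\<Sum>x\<in>C m \<inter> scale_set n K B. list_error n \<sigma> (L - 1) (C m) x))"
        unfolding card_C S_def by simp
    qed
  qed
  moreover have "code_rate n B (C m) \<le> ereal (1 / real n) * ereal (ln \<Delta>)"
    unfolding code_rate_def
  proof (rule Limsup_bounded)
    show "\<forall>\<^sub>F K in at_top. ereal (1 / real n) * ext_ln (ereal (real (card (C m \<inter> scale_set n K B)) /
                      measure (lebesgue_Rn n) (scale_set n K B))) \<le> ereal (1 / real n) * ereal (ln \<Delta>)"
      using ev_good bad_upper
    proof eventually_elim
      case (elim K)
      have K0: "K > 0" using elim unfolding good_def by blast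
      have "2 * \<epsilon> * total m K \<le> 1 / 2 * total m K"
        using \<epsilon> total_pos[OF elim(1)] by (intro mult_right_mono) auto
      with elim(2) have "bad m K \<le> 1 / 2 * total m K" by (rule order.trans)
      then have "total m K \<le> 2 * base K" unfolding total_def by simp
      then have "total m K * s ^ n \<le> 2 * base K * s ^ n" using sn by (intro mult_right_mono) auto
      also have "\<dots> \<le> 2 * (M * (2 * K ^ n * V))" 
        using base_upper[OF elim(1)] unfolding mult.assoc by (rule mult_left_mono) simp
      also have "\<dots> \<le> 2 * ((\<Delta> * t ^ n / 8) * (2 * K ^ n * V))"
        using M(2) K0 V by (intro mult_left_mono mult_right_mono) auto
      also have "\<dots> \<le> 2 * ((\<Delta> * s ^ n / 8) * (2 * K ^ n * V))"
        using sn \<Delta> K0 V by (intro mult_left_mono mult_right_mono divide_right_mono) auto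
      also have "\<dots> \<le> (\<Delta> * (K ^ n * V)) * s ^ n" using sn \<Delta> K0 V by simp
      finally have "total m K \<le> \<Delta> * (K ^ n * V)" using sn(1) by (rule mult_right_le_imp_le)
      then have "real (card (C m \<inter> scale_set n K B)) / measure (lebesgue_Rn n) (scale_set n K B) \<le> \<Delta>"
        unfolding card_C measure_scale_set[OF B K0] V_def[symmetric] using K0 V by (simp add: pos_divide_le_eq)
      then show ?case using \<Delta> by (intro ereal_mult_left_mono ext_ln_le) auto
    qed
  qed
  moreover have "ereal (1 / real n) * ereal (ln (\<Delta> / 128)) \<le> code_rate n B (C m)"
    unfolding code_rate_def
  proof (rule le_Limsup_of_frequently)
    have "\<exists>\<^sub>F K in at_top. good K \<and> M * K ^ n * V \<le> 2 * s ^ n * base K"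
      using u ev_good unfolding base_def by (rule frequently_eventually_conj)
    then show "\<exists>\<^sub>F K in at_top. ereal (1 / real n) * ereal (ln (\<Delta> / 128)) \<le> ereal (1 / real n) * ext_ln (ereal (real (card (C m \<inter> scale_set n K B)) /
                      measure (lebesgue_Rn n) (scale_set n K B)))"
    proof (rule frequently_elim1)
      fix K assume K: "good K \<and> M * K ^ n * V \<le> 2 * s ^ n * base K"
      have K0: "K > 0" using K unfolding good_def by blast
      have "\<Delta> * (s ^ n / 2) / 32 \<le> M" 
      proof -
        have "\<Delta> * (s ^ n / 2) \<le> \<Delta> * t ^ n" using sn(3) \<Delta> by (intro mult_left_mono) auto
        then show ?thesis using M(1) by linarith
      qed
      then have "(\<Delta> * (s ^ n / 2) / 32) * (K ^ n * V) \<le> M * (K ^ n * V)"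
        using K0 V by (intro mult_right_mono) auto
      also have "\<dots> \<le> 2 * s ^ n * base K" using K by (simp add: mult.assoc)
      also have "\<dots> \<le> 2 * s ^ n * total m K" using bad0[of m K] sn unfolding total_def by (intro mult_left_mono) auto
      finally have "(\<Delta> / 128 * (K ^ n * V)) * s ^ n \<le> total m K * s ^ n" by (simp add: field_simps)
      then have "\<Delta> / 128 * (K ^ n * V) \<le> total m K" using sn(1) by (rule mult_right_le_imp_le)
      then have "\<Delta> / 128 \<le> real (card (C m \<inter> scale_set n K B)) / measure (lebesgue_Rn n) (scale_set n K B)"
        unfolding card_C measure_scale_set[OF B K0] V_def[symmetric] using K0 V by (simp add: pos_le_divide_eq)
      then show "ereal (1 / real n) * ereal (ln (\<Delta> / 128)) \<le> ereal (1 / real n) * ext_ln (ereal (real (card (C m \<inter> scale_set n K B)) /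
                      measure (lebesgue_Rn n) (scale_set n K B)))"
        using \<Delta> by (intro ereal_mult_left_mono ext_ln_ge) auto
    qed
  qed
  ultimately show ?thesis using that unb unfolding c0_def by blast
qed

theorem mainTheorem7:
  fixes \<sigma> \<alpha> :: real and L :: nat and B :: "nat \<Rightarrow> (nat \<Rightarrow> real) set"
  assumes "\<sigma> > 0" and "\<alpha> \<ge> 1" and "L \<ge> 2"
    and "\<And>n. n \<ge> 1 \<Longrightarrow> reference_body n (B n)"
  shows "\<exists>(C :: nat \<Rightarrow> (nat \<Rightarrow> real) set) (E :: ereal).
           (\<forall>n\<ge>1. unbounded_code n (C n)) \<and>
           (\<lambda>n. code_rate n (B n) (C n))
             \<longlonglongrightarrow> ereal (1/2 * ln (1 / (2 * pi * exp 1 * \<sigma>^2 * \<alpha>^2))) \<and>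
           (\<lambda>n. ereal (- (1 / real n)) * ext_ln (avg_list_error n \<sigma> (L - 1) (B n) (C n)))
             \<longlonglongrightarrow> E \<and>
           ereal (exponent_ex L \<alpha>) \<le> E"
proof -
  define E' where "E' = max 0 (exponent_ex L \<alpha>)"
  define r where "r = 1/2 * ln (1 / (2 * pi * exp 1 * \<sigma>^2 * \<alpha>^2))"
  define c where "c = exp (-2) / sqrt (2 * pi) / (8::real)"
  have c: "c > 0" unfolding c_def by simp
  have "\<forall>n\<ge>1. \<exists>C. unbounded_code n C \<and>
      ereal (1 / real n) * ereal (ln (critical_density n \<sigma> \<alpha> / 128)) \<le> code_rate n (B n) C \<and>
      code_rate n (B n) C \<le> ereal (1 / real n) * ereal (ln (critical_density n \<sigma> \<alpha>)) \<and>
      ereal (c * exp (- real n * E')) \<le> avg_list_error n \<sigma> (L - 1) (B n) C \<and>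
      avg_list_error n \<sigma> (L - 1) (B n) C \<le> ereal (10 * exp (- real n * E'))"
    using code_exists_in_dimension[OF _ assms(1-3) assms(4)] unfolding c_def E'_def by metis
  then obtain C where C: "\<And>n. n \<ge> 1 \<Longrightarrow> unbounded_code n (C n)"
      "\<And>n. n \<ge> 1 \<Longrightarrow> ereal (1 / real n) * ereal (ln (critical_density n \<sigma> \<alpha> / 128)) \<le> code_rate n (B n) (C n)"
      "\<And>n. n \<ge> 1 \<Longrightarrow> code_rate n (B n) (C n) \<le> ereal (1 / real n) * ereal (ln (critical_density n \<sigma> \<alpha>))"
      "\<And>n. n \<ge> 1 \<Longrightarrow> ereal (c * exp (- real n * E')) \<le> avg_list_error n \<sigma> (L - 1) (B n) (C n)"
      "\<And>n. n \<ge> 1 \<Longrightarrow> avg_list_error n \<sigma> (L - 1) (B n) (C n) \<le> ereal (10 * exp (- real n * E'))"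
    by metis
  define Q where "Q = 2 * pi * exp 1 * \<sigma>^2 * \<alpha>^2"
  have Q: "Q > 0" unfolding Q_def using assms by simp
  have lnd: "ln (critical_density n \<sigma> \<alpha>) = real n * r" and dpos: "critical_density n \<sigma> \<alpha> > 0" for n
    unfolding critical_density_def r_def Q_def[symmetric] using Q
    by (auto simp: ln_realpow ln_div ln_sqrt)
  have "(\<lambda>n. code_rate n (B n) (C n)) \<longlonglongrightarrow> ereal r"
  proof (rule tendsto_sandwich)
    show "\<forall>\<^sub>F n in sequentially. ereal (r - ln 128 / real n) \<le> code_rate n (B n) (C n)"
      using eventually_ge_at_top[of 1]
    proof eventually_elim
      case (elim n)
      have "1 / real n * ln (critical_density n \<sigma> \<alpha> / 128) = r - ln 128 / real n"
        using elim dpos[of n] by (simp add: ln_div lnd field_simps)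
      then show ?case using C(2)[OF elim] by simp
    qed
    show "\<forall>\<^sub>F n in sequentially. code_rate n (B n) (C n) \<le> ereal r"
      using eventually_ge_at_top[of 1]
    proof eventually_elim
      case (elim n)
      then show ?case using C(3)[OF elim] by (simp add: lnd)
    qed
    have "(\<lambda>n. r - ln 128 / real n) \<longlonglongrightarrow> r - 0"
      by (intro tendsto_intros lim_const_over_n)
    then show "(\<lambda>n. ereal (r - ln 128 / real n)) \<longlonglongrightarrow> ereal r" by simp
  qed simp
  moreover have "(\<lambda>n. ereal (- (1 / real n)) * ext_ln (avg_list_error n \<sigma> (L - 1) (B n) (C n))) \<longlonglongrightarrow> ereal E'"
  proof (rule tendsto_sandwich)
    have flip: "ereal (- (1 / real n)) * ereal (ln a - real n * E') = ereal (E' - ln a / real n)"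
      if "n \<ge> 1" for n a using that by (simp add: field_simps)
    have lne: "ln (a * exp (- real n * E')) = ln a - real n * E'" if "a > 0" for a n
      using that by (simp add: ln_mult_pos)
    have neg: "ereal (- (1 / real n)) * y \<le> ereal (- (1 / real n)) * x" if "x \<le> y" for x y n
      using that ereal_mult_left_mono[OF that, of "ereal (1 / real n)"]
      by (simp add: uminus_ereal.simps(1)[symmetric] del: uminus_ereal.simps)
    show "\<forall>\<^sub>F n in sequentially. ereal (E' - ln 10 / real n) \<le> ereal (- (1 / real n)) * ext_ln (avg_list_error n \<sigma> (L - 1) (B n) (C n))"
      using eventually_ge_at_top[of 1]
    proof eventually_elim
      case (elim n)
      have "ext_ln (avg_list_error n \<sigma> (L - 1) (B n) (C n)) \<le> ereal (ln 10 - real n * E')"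
        using ext_ln_le[OF C(5)[OF elim]] lne[of 10 n] by simp
      from neg[OF this, where n=n] show ?case unfolding flip[OF elim] .
    qed
    show "\<forall>\<^sub>F n in sequentially. ereal (- (1 / real n)) * ext_ln (avg_list_error n \<sigma> (L - 1) (B n) (C n)) \<le> ereal (E' - ln c / real n)"
      using eventually_ge_at_top[of 1]
    proof eventually_elim
      case (elim n)
      have "ereal (ln c - real n * E') \<le> ext_ln (avg_list_error n \<sigma> (L - 1) (B n) (C n))"
        using ext_ln_ge[OF C(4)[OF elim]] lne[OF c, of n] c by simp
      from neg[OF this, where n=n] show ?case unfolding flip[OF elim] .
    qed
    have "(\<lambda>n. E' - ln a / real n) \<longlonglongrightarrow> E' - 0" for a
      by (intro tendsto_intros lim_const_over_n)
    then show "(\<lambda>n. ereal (E' - ln 10 / real n)) \<longlonglongrightarrow> ereal E'" "(\<lambda>n. ereal (E' - ln c / real n)) \<longlonglongrightarrow> ereal E'"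
      by simp_all
  qed
  moreover have "ereal (exponent_ex L \<alpha>) \<le> ereal E'" unfolding E'_def by simp
  ultimately show ?thesis using C(1) unfolding r_def by blast
qed

end
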